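(* Let $\mathcal{X}$ be a spike prior with rate function $f_{\mathcal{X}}$. Let $\beta>-1$ and $\gamma^*>0$. Suppose that either (i) $\beta^2/\gamma^*\le(\lambda^*_{\mathcal{X}})^2$, or (ii) $f_{\mathcal{X}}$ admits a local Chernoff bound. If $$\gamma^*f_{\mathcal{X}}(t)\ge(1+\beta)\frac{t(w-t)}{1-t^2}+\frac12\log\left(\frac{1-w^2}{1-t^2}\right)\quad\text{for all }t\in(0,1),$$ where $$w=\sqrt{A^2+1}-A\quad\text{with}\quad A=\frac{1-t^2}{2t(\beta+1)},$$ then $\mathrm{Wish}(\gamma,\beta,\mathcal{X})$ is contiguous to $\mathrm{Wish}(\gamma)$ for all $\gamma>\gamma^*$.
   Context: A spike prior is a family $\mathcal{X}=\{\mathcal{X}_n\}$, where $\mathcal{X}_n$ is a probability distribution on $\mathbb{R}^n$ such that for $x\sim\mathcal{X}_n$, $\|x\|\to1$ in probability as $n\to\infty$. Below $x,x'$ denote independent draws from $\mathcal{X}_n$. Spiked Wishart model $\mathrm{Wish}(\gamma,\beta,\mathcal{X})$, for $\gamma>0$, $\beta\in[-1,\infty)$: draw $x\sim\mathcal{X}_n$ and reveal $Y=\frac1NXX^\top$, where $X$ is an $n\times N$ matrix whose columns are sampled independently from $\mathcal{N}(0,I_n+\beta xx^\top)$, and $N=N(n)$ satisfies $n/N\to\gamma$ as $n\to\infty$. If $\beta<0$ and $|\beta|\cdot\|x\|^2>1$, output instead a failure symbol $\perp$. The unspiked model $\mathrm{Wish}(\gamma)$ is the case $\beta=0$ (with the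 same $N$). Rate function: for $t\in[0,1)$ let $f_{n,\mathcal{X}}(t)=-\frac1n\log\Pr[|\langle x,x'\rangle|\ge t]$. A function $f_{\mathcal{X}}:[0,1)\to[0,\infty)$ is called a rate function of $\mathcal{X}$ if there is a sequence of functions $b_{n,\mathcal{X}}$ with $f_{n,\mathcal{X}}(t)\ge b_{n,\mathcal{X}}(t)$ for all $t\in[0,1)$ such that $b_{n,\mathcal{X}}\to f_{\mathcal{X}}$ uniformly on $[0,1)$ as $n\to\infty$. Local Chernoff bound: a rate function $f_{\mathcal{X}}$ admits a local Chernoff bound if there exist $T>0$ and $C>0$ such that for every $n$, $\Pr[|\langle x,x'\rangle|\ge t]\le C\exp(-nf_{\mathcal{X}}(t))$ for all $t\in[0,T]$. Wigner second-moment threshold: $$\lambda^*_{\mathcal{X}}=\sup\left\{\lambda\;\Big|\;\mathbb{E}_{x,x'}\exp\left(\frac{n\lambda^2}2\langle x,x'\rangle^2\right)\text{ is bounded as }n\to\infty\right\}.$$ A sequence of distributions $Q_n$ is contiguous to $P_n$ if for every sequence of events $A_n$, $P_n(A_n)\to0$ implies $Q_n(A_n)\to0$. *)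

theory Defs
  imports "HOL-Probability.Probability"
begin

text \<open>
  Vectors of \<open>\<real>\<^sup>n\<close> are functions on \<open>{..<n}\<close> (extensional outside), with the product Borel
  \<open>\<sigma>\<close>-algebra; this allows the dimension \<open>n\<close> to be a variable.
\<close>

abbreviation borel_vec :: "nat \<Rightarrow> (nat \<Rightarrow> real) measure" where
  "borel_vec n \<equiv> PiM {..<n} (\<lambda>_. borel)"

abbreviation borel_mat :: "nat \<Rightarrow> (nat \<times> nat \<Rightarrow> real) measure" where
  "borel_mat n \<equiv> PiM ({..<n} \<times> {..<n}) (\<lambda>_. borel)"

definition vec_inner :: "nat \<Rightarrow> (nat \<Rightarrow> real) \<Rightarrow> (nat \<Rightarrow> real) \<Rightarrow> real" where
  "vec_inner n x y = (\<Sum>i<n. x i * y i)"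

definition vec_norm :: "nat \<Rightarrow> (nat \<Rightarrow> real) \<Rightarrow> real" where
  "vec_norm n x = L2_set x {..<n}"

definition spike_prior :: "(nat \<Rightarrow> (nat \<Rightarrow> real) measure) \<Rightarrow> bool" where
  "spike_prior \<X> \<longleftrightarrow>
     (\<forall>n. prob_space (\<X> n) \<and> sets (\<X> n) = sets (borel_vec n)) \<and>
     (\<forall>\<epsilon>>0. (\<lambda>n. measure (\<X> n) {x \<in> space (\<X> n). \<bar>vec_norm n x - 1\<bar> > \<epsilon>}) \<longlonglongrightarrow> 0)"

definition overlap_tail :: "(nat \<Rightarrow> (nat \<Rightarrow> real) measure) \<Rightarrow> nat \<Rightarrow> real \<Rightarrow> real" where
  "overlap_tail \<X> n t =
     measure (\<X> n \<Otimes>\<^sub>M \<X> n)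
       {p \<in> space (\<X> n \<Otimes>\<^sub>M \<X> n). \<bar>vec_inner n (fst p) (snd p)\<bar> \<ge> t}"

text \<open>The value is \<open>\<infinity>\<close> when the tail probability vanishes (\<open>ln 0 = 0\<close> in HOL).\<close>

definition overlap_rate :: "(nat \<Rightarrow> (nat \<Rightarrow> real) measure) \<Rightarrow> nat \<Rightarrow> real \<Rightarrow> ereal" where
  "overlap_rate \<X> n t =
     (if overlap_tail \<X> n t = 0 then \<infinity> else ereal (- (1 / real n) * ln (overlap_tail \<X> n t)))"

text \<open>Only the values of \<open>f\<close> on \<open>[0, 1)\<close> matter.\<close>

definition is_rate_function :: "(nat \<Rightarrow> (nat \<Rightarrow> real) measure) \<Rightarrow> (real \<Rightarrow> real) \<Rightarrow> bool" where
  "is_rate_function \<X> f \<longleftrightarrow>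
     (\<forall>t\<in>{0..<1}. 0 \<le> f t) \<and>
     (\<exists>b :: nat \<Rightarrow> real \<Rightarrow> real.
        (\<forall>n\<ge>1. \<forall>t\<in>{0..<1}. ereal (b n t) \<le> overlap_rate \<X> n t) \<and>
        uniform_limit {0..<1} b f sequentially)"

text \<open>\<open>T < 1\<close> because \<open>f\<close> is only meaningful on \<open>[0, 1)\<close>.\<close>

definition local_chernoff_bound :: "(nat \<Rightarrow> (nat \<Rightarrow> real) measure) \<Rightarrow> (real \<Rightarrow> real) \<Rightarrow> bool" where
  "local_chernoff_bound \<X> f \<longleftrightarrow>
     (\<exists>T C. 0 < T \<and> T < 1 \<and> 0 < C \<and>
        (\<forall>n\<ge>1. \<forall>t\<in>{0..T}. overlap_tail \<X> n t \<le> C * exp (- real n * f t)))"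

text \<open>
  The expectation is taken in \<open>[0, \<infinity>]\<close>, and the supremum in the extended reals.
  ``Bounded as \<open>n \<rightarrow> \<infinity>\<close>'' is boundedness for all sufficiently large \<open>n\<close>.
\<close>

definition wigner_second_moment ::
  "(nat \<Rightarrow> (nat \<Rightarrow> real) measure) \<Rightarrow> real \<Rightarrow> nat \<Rightarrow> ennreal" where
  "wigner_second_moment \<X> l n =
     (\<integral>\<^sup>+ p. ennreal (exp (real n * l\<^sup>2 / 2 * (vec_inner n (fst p) (snd p))\<^sup>2)) \<partial>(\<X> n \<Otimes>\<^sub>M \<X> n))"

definition wigner_threshold :: "(nat \<Rightarrow> (nat \<Rightarrow> real) measure) \<Rightarrow> ereal" where
  "wigner_threshold \<X> =
     Sup (ereal ` {l. \<exists>B::real. eventually (\<lambda>n. wigner_second_moment \<X> l n \<le> ennreal B) sequentially})"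

text \<open>
  Only the entries with indices below \<open>n\<close> are relevant; on these, the positive semidefinite
  square root of a symmetric positive semidefinite matrix is unique.
\<close>

definition psd_sqrt :: "nat \<Rightarrow> (nat \<Rightarrow> nat \<Rightarrow> real) \<Rightarrow> nat \<Rightarrow> nat \<Rightarrow> real" where
  "psd_sqrt n \<Sigma> = (SOME S.
     (\<forall>i<n. \<forall>j<n. S i j = S j i) \<and>
     (\<forall>u. 0 \<le> (\<Sum>i<n. \<Sum>j<n. u i * S i j * u j)) \<and>
     (\<forall>i<n. \<forall>j<n. (\<Sum>k<n. S i k * S k j) = \<Sigma> i j))"

text \<open>
  \<open>\<N>(0, \<Sigma>)\<close> as the law of \<open>\<Sigma>\<^bsup>1/2\<^esup> g\<close> for a standard Gaussian vector \<open>g\<close>; unlike a density,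
  this covers singular \<open>\<Sigma>\<close> (here: \<open>\<beta> \<parallel>x\<parallel>\<^sup>2 = -1\<close>).
\<close>

definition gaussian_vec :: "nat \<Rightarrow> (nat \<Rightarrow> nat \<Rightarrow> real) \<Rightarrow> (nat \<Rightarrow> real) measure" where
  "gaussian_vec n \<Sigma> =
     distr (PiM {..<n} (\<lambda>_. std_normal_distribution)) (borel_vec n)
       (\<lambda>g. \<lambda>i\<in>{..<n}. \<Sum>j<n. psd_sqrt n \<Sigma> i j * g j)"

definition spiked_cov :: "real \<Rightarrow> (nat \<Rightarrow> real) \<Rightarrow> nat \<Rightarrow> nat \<Rightarrow> real" where
  "spiked_cov \<beta> x i j = (if i = j then 1 else 0) + \<beta> * x i * x j"

text \<open>
  The law of \<open>(1/N) X X\<^sup>T\<close> given the covariance \<open>\<Sigma>\<close> of the \<open>N\<close> independent columns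
  of \<open>X\<close>; here \<open>X k\<close> is the \<open>k\<close>-th column.
\<close>

definition wishart_given :: "nat \<Rightarrow> nat \<Rightarrow> (nat \<Rightarrow> nat \<Rightarrow> real) \<Rightarrow> (nat \<times> nat \<Rightarrow> real) measure" where
  "wishart_given n N \<Sigma> =
     distr (PiM {..<N} (\<lambda>_. gaussian_vec n \<Sigma>)) (borel_mat n)
       (\<lambda>X. \<lambda>(i, j)\<in>{..<n} \<times> {..<n}. 1 / real N * (\<Sum>k<N. X k i * X k j))"

text \<open>The outcomes of \<open>M\<close> together with an additional point \<open>None\<close> (the failure symbol).\<close>

definition option_algebra :: "'a measure \<Rightarrow> 'a option measure" where
  "option_algebra M =
     sigma (insert None (Some ` space M))
       {A. A \<subseteq> insert None (Some ` space M) \<and> Some -` A \<in> sets M}"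

text \<open>
  The parameter \<open>\<gamma>\<close> of the model enters only through the sample sizes \<open>N n\<close>, with
  \<open>n / N n \<rightarrow> \<gamma>\<close>.
\<close>

definition wishart ::
  "(nat \<Rightarrow> nat) \<Rightarrow> real \<Rightarrow> (nat \<Rightarrow> (nat \<Rightarrow> real) measure) \<Rightarrow> nat \<Rightarrow> (nat \<times> nat \<Rightarrow> real) option measure" where
  "wishart N \<beta> \<X> n =
     bind (\<X> n) (\<lambda>x.
       if \<beta> < 0 \<and> \<bar>\<beta>\<bar> * (vec_norm n x)\<^sup>2 > 1
       then return (option_algebra (borel_mat n)) None
       else distr (wishart_given n (N n) (spiked_cov \<beta> x)) (option_algebra (borel_mat n)) Some)"

definition contiguous :: "(nat \<Rightarrow> 'a measure) \<Rightarrow> (nat \<Rightarrow> 'a measure) \<Rightarrow> bool" where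
  "contiguous Q P \<longleftrightarrow>
     (\<forall>n. sets (Q n) = sets (P n)) \<and>
     (\<forall>A. (\<forall>n. A n \<in> sets (P n)) \<longrightarrow>
        (\<lambda>n. measure (P n) (A n)) \<longlonglongrightarrow> 0 \<longrightarrow> (\<lambda>n. measure (Q n) (A n)) \<longlonglongrightarrow> 0)"

end

theory Submission
  imports Defs
begin

text \<open>
  Everything is reduced to the \<open>N\<close> columns, of which the Wishart matrix is a function. The
  likelihood ratio \<open>L\<^sub>x\<close> of the spiked columns is truncated to the event that the energy
  \<open>\<Sum>\<^sub>k \<langle>x, y\<^sub>k\<rangle>\<^sup>2\<close> is near its spiked mean; this loses only an exponentially small mass, and by
  Cauchy--Schwarz contiguity follows once the second moment of the truncated ratio, averaged over
  the spike, is bounded. For a pair \<open>x, x'\<close> with overlap \<open>t\<close> bounded away from 0, replacing the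
  exponents of \<open>L\<^sub>x L\<^bsub>x'\<^esub>\<close> by a common tilt \<open>a\<close> costs little on the truncation event and gives the
  exponent \<open>\<beta> - ln (1 + \<beta>) - 2 a (1 + \<beta>) - 1/2 ln ((1 - 2 a)\<^sup>2 - 4 a\<^sup>2 t\<^sup>2)\<close> per column; its minimum
  over \<open>a\<close> is the right-hand side of the hypothesis on the rate function, so that \<open>\<gamma> > \<gamma>'\<close> leaves
  room for a finite cover of the overlaps. For small \<open>t\<close> the exponent without truncation,
  \<open>- 1/2 ln (1 - \<beta>\<^sup>2 t\<^sup>2)\<close>, is of order \<open>\<beta>\<^sup>2 t\<^sup>2 / 2\<close> and is handled by the local Chernoff bound or
  the Wigner second moment.
\<close>

section \<open>Rotation invariance of the standard Gaussian vector\<close>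

text \<open>Truncation is forced: the plain second moment of a pair is
  \<open>1 - \<beta>\<^sup>2 * t\<^sup>2\<close> to the power -N/2. It blows up as |\<beta> t|
  approaches 1, and even where finite it can be dominated by columns of exceptional energy that the
  spiked law hardly ever produces. On the truncation event each energy per column is pinned near 1 +
  \<beta>, so any tilt a may replace the exponent \<beta>/(2(1 + \<beta>)), as in a Chernoff bound.
  The best a is the one whose tilted Gaussian gives <x, g> variance exactly 1 + \<beta>.

  Two borders need care. Near t = 0 the exponent itself tends to 0, while the bounds b approximate f
  only up to o(1), an error of n o(1) after scaling; hence hypothesis (i) or (ii) takes over there.
  Near t = 1 the rate hypothesis stops short of 1, whereas overlaps may slightly exceed 1 because
  norms are only close to 1; the exponent is therefore put into a form that is continuous at 1. In
  between, positivity of the exponent turns \<gamma> > \<gamma>' into a strict gap, which is why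
  \<beta> = 0 is treated apart.\<close>

abbreviation std_gauss :: "nat \<Rightarrow> (nat \<Rightarrow> real) measure" where
  "std_gauss n \<equiv> PiM {..<n} (\<lambda>_. std_normal_distribution)"

interpretation std_normal: prob_space std_normal_distribution
  by (rule prob_space_normal_density) simp

interpretation std_normal_product: product_prob_space "\<lambda>_. std_normal_distribution" I for I
  by standard

lemma sets_std_gauss [measurable_cong]: "sets (std_gauss n) = sets (borel_vec n)"
  by (intro sets_PiM_cong) auto

lemma space_std_gauss: "space (std_gauss n) = {..<n} \<rightarrow>\<^sub>E UNIV"
  by (simp add: space_PiM)

lemma prob_space_std_gauss: "prob_space (std_gauss n)"
  by (intro prob_space_PiM std_normal.prob_space_axioms)

lemma vec_inner_commute: "vec_inner n x y = vec_inner n y x"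
  by (simp add: vec_inner_def mult.commute)

lemma measurable_vec_inner [measurable]:
  assumes [measurable]: "f \<in> M \<rightarrow>\<^sub>M borel_vec n" "g \<in> M \<rightarrow>\<^sub>M borel_vec n"
  shows "(\<lambda>z. vec_inner n (f z) (g z)) \<in> borel_measurable M"
  unfolding vec_inner_def by measurable

lemma vec_norm_sq: "(vec_norm n x)\<^sup>2 = vec_inner n x x"
  by (simp add: vec_norm_def L2_set_def vec_inner_def sum_nonneg power2_eq_square)

lemma measurable_vec_norm [measurable]:
  assumes [measurable]: "f \<in> M \<rightarrow>\<^sub>M borel_vec n"
  shows "(\<lambda>z. vec_norm n (f z)) \<in> borel_measurable M"
  unfolding vec_norm_def L2_set_def by measurable

text \<open>The joint density depends only on the sum of the two squares. The plane substitution is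
  made one variable at a time: p = c a - s b replaces b, then a = c p + s q replaces a. Both
  substitutions need s nonzero, and their Jacobians 1/|s| and |s| cancel.\<close>

lemma nn_integral_std_normal_rotation:
  fixes c s :: real
  assumes cs: "c\<^sup>2 + s\<^sup>2 = 1" and s: "s \<noteq> 0"
    and F [measurable]: "case_prod F \<in> borel_measurable (borel \<Otimes>\<^sub>M borel)"
  shows "(\<integral>\<^sup>+b. \<integral>\<^sup>+a. F (c * a - s * b) (s * a + c * b)
            \<partial>std_normal_distribution \<partial>std_normal_distribution) =
         (\<integral>\<^sup>+b. \<integral>\<^sup>+a. F a b \<partial>std_normal_distribution \<partial>std_normal_distribution)"
    (is "?l = ?r")
proof -

  let ?\<phi> = "\<lambda>a b. ennreal (std_normal_density a * std_normal_density b)"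
  have \<phi>: "ennreal (std_normal_density a) * (ennreal (std_normal_density b) * C) = ?\<phi> a b * C" for a b C
    by (simp add: ennreal_mult mult.assoc)
  have \<phi>': "ennreal (std_normal_density b) * (ennreal (std_normal_density a) * C) = ?\<phi> a b * C" for a b C
    by (simp add: ennreal_mult mult_ac)
  have rot: "?\<phi> (c * p + s * q) (c * q - s * p) = ?\<phi> p q" for p q
  proof -
    have "(c * p + s * q)\<^sup>2 + (c * q - s * p)\<^sup>2 = (c\<^sup>2 + s\<^sup>2) * (p\<^sup>2 + q\<^sup>2)"
      by (simp add: power2_eq_square algebra_simps)
    then have "exp (- (c * p + s * q)\<^sup>2 / 2) * exp (- (c * q - s * p)\<^sup>2 / 2) = exp (- p\<^sup>2 / 2) * exp (- q\<^sup>2 / 2)"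
      using cs by (simp add: exp_add[symmetric] add_divide_distrib[symmetric])
    then show ?thesis by (simp add: std_normal_density_def)
  qed
  have "?l = (\<integral>\<^sup>+b. \<integral>\<^sup>+a. ?\<phi> a b * F (c * a - s * b) (s * a + c * b) \<partial>lborel \<partial>lborel)"
    by (simp add: nn_integral_density nn_integral_cmult[symmetric] \<phi>')
  also have "\<dots> = (\<integral>\<^sup>+a. \<integral>\<^sup>+b. ?\<phi> a b * F (c * a - s * b) (s * a + c * b) \<partial>lborel \<partial>lborel)"
    by (intro lborel_pair.Fubini') measurable
  also have "\<dots> = (\<integral>\<^sup>+a. \<bar>- 1 / s\<bar> * (\<integral>\<^sup>+p. ?\<phi> a (c * a / s + (- 1 / s) * p) *
      F (c * a - s * (c * a / s + (- 1 / s) * p)) (s * a + c * (c * a / s + (- 1 / s) * p)) \<partial>lborel) \<partial>lborel)"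
    by (intro nn_integral_cong nn_integral_real_affine) (use s in \<open>auto\<close>)
  also have "\<dots> = (\<integral>\<^sup>+a. \<integral>\<^sup>+p. \<bar>1 / s\<bar> * (?\<phi> a ((c * a - p) / s) * F p ((a - c * p) / s)) \<partial>lborel \<partial>lborel)"
  proof (intro nn_integral_cong)
    fix a :: real
    have 1: "c * a / s + (- 1 / s) * p = (c * a - p) / s" for p by (simp add: diff_divide_distrib)
    have 2: "s * a + c * ((c * a - p) / s) = (a - c * p) / s" for p
    proof -
      have "s * a + c * ((c * a - p) / s) = ((c\<^sup>2 + s\<^sup>2) * a - c * p) / s"
        using s by (simp add: field_simps power2_eq_square)
      then show ?thesis using cs by simp
    qed
    have 3: "c * a - s * ((c * a - p) / s) = p" for p using s by simp
    show "\<bar>- 1 / s\<bar> * (\<integral>\<^sup>+p. ?\<phi> a (c * a / s + (- 1 / s) * p) *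
      F (c * a - s * (c * a / s + (- 1 / s) * p)) (s * a + c * (c * a / s + (- 1 / s) * p)) \<partial>lborel)
      = (\<integral>\<^sup>+p. \<bar>1 / s\<bar> * (?\<phi> a ((c * a - p) / s) * F p ((a - c * p) / s)) \<partial>lborel)"
      unfolding 1 2 3 by (subst nn_integral_cmult) auto
  qed
  also have "\<dots> = (\<integral>\<^sup>+p. \<integral>\<^sup>+a. \<bar>1 / s\<bar> * (?\<phi> a ((c * a - p) / s) * F p ((a - c * p) / s)) \<partial>lborel \<partial>lborel)"
    by (intro lborel_pair.Fubini') measurable
  also have "\<dots> = (\<integral>\<^sup>+p. \<bar>s\<bar> * (\<integral>\<^sup>+q. \<bar>1 / s\<bar> * (?\<phi> (c * p + s * q) ((c * (c * p + s * q) - p) / s)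
       * F p ((c * p + s * q - c * p) / s)) \<partial>lborel) \<partial>lborel)"
    by (intro nn_integral_cong nn_integral_real_affine) (use s in \<open>auto\<close>)
  also have "\<dots> = (\<integral>\<^sup>+p. \<integral>\<^sup>+q. ?\<phi> p q * F p q \<partial>lborel \<partial>lborel)"
  proof (intro nn_integral_cong)
    fix p :: real
    have 1: "(c * (c * p + s * q) - p) / s = c * q - s * p" for q
    proof -
      have "c * (c * p + s * q) - p = (c\<^sup>2 + s\<^sup>2) * p - p + s * (c * q - s * p)"
        by (simp add: power2_eq_square algebra_simps)
      then show ?thesis using cs s by simp
    qed
    have 2: "(c * p + s * q - c * p) / s = q" for q using s by simp
    have 3: "ennreal \<bar>s\<bar> * (ennreal (1 / \<bar>s\<bar>) * C) = C" for C
      using s by (simp add: mult.assoc[symmetric] ennreal_mult[symmetric])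
    show "\<bar>s\<bar> * (\<integral>\<^sup>+q. \<bar>1 / s\<bar> * (?\<phi> (c * p + s * q) ((c * (c * p + s * q) - p) / s)
       * F p ((c * p + s * q - c * p) / s)) \<partial>lborel) = (\<integral>\<^sup>+q. ?\<phi> p q * F p q \<partial>lborel)"
      unfolding 1 2 rot by (simp add: nn_integral_cmult 3)
  qed
  also have "\<dots> = (\<integral>\<^sup>+q. \<integral>\<^sup>+p. ?\<phi> p q * F p q \<partial>lborel \<partial>lborel)"
    by (intro lborel_pair.Fubini') measurable
  also have "\<dots> = ?r"
    by (simp add: nn_integral_density nn_integral_cmult[symmetric] \<phi>')
  finally show ?thesis .
qed

lemma nn_integral_std_normal_scale:
  fixes q :: real
  assumes q: "q > 0" and G [measurable]: "G \<in> borel_measurable borel"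
  shows "(\<integral>\<^sup>+a. G (q * a) \<partial>std_normal_distribution) =
         (\<integral>\<^sup>+a. ennreal (exp ((1 - 1 / q\<^sup>2) / 2 * a\<^sup>2) / q) * G a \<partial>std_normal_distribution)"
proof -
  have 1: "std_normal_density (a / q) = exp ((1 - 1 / q\<^sup>2) / 2 * a\<^sup>2) * std_normal_density a" for a
    by (simp add: std_normal_density_def exp_add[symmetric] field_simps power_divide)
  have "(\<integral>\<^sup>+a. G (q * a) \<partial>std_normal_distribution) = (\<integral>\<^sup>+a. std_normal_density a * G (q * a) \<partial>lborel)"
    by (simp add: nn_integral_density)
  also have "\<dots> = \<bar>1 / q\<bar> * (\<integral>\<^sup>+a. std_normal_density (0 + (1 / q) * a) * G (q * (0 + (1 / q) * a)) \<partial>lborel)"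
    by (intro nn_integral_real_affine) (use q in auto)
  also have "\<dots> = (\<integral>\<^sup>+a. \<bar>1 / q\<bar> * (std_normal_density (a / q) * G a) \<partial>lborel)"
    using q by (simp add: nn_integral_cmult)
  also have "\<dots> = (\<integral>\<^sup>+a. std_normal_density a * (ennreal (exp ((1 - 1 / q\<^sup>2) / 2 * a\<^sup>2) / q) * G a) \<partial>lborel)"
    unfolding 1 using q
    by (intro nn_integral_cong) (simp add: mult.assoc[symmetric] ennreal_mult[symmetric] field_simps)
  also have "\<dots> = (\<integral>\<^sup>+a. ennreal (exp ((1 - 1 / q\<^sup>2) / 2 * a\<^sup>2) / q) * G a \<partial>std_normal_distribution)"
    by (simp add: nn_integral_density)
  finally show ?thesis .
qed

text \<open>An orthogonal map, described by the three properties used later: it preserves the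
  Gaussian law, is linear and keeps inner products. No matrix has to be carried along. The
  restrictions in the linearity clause keep vectors extensional.\<close>

definition gauss_isometry :: "nat \<Rightarrow> ((nat \<Rightarrow> real) \<Rightarrow> nat \<Rightarrow> real) \<Rightarrow> bool" where
  "gauss_isometry n R \<longleftrightarrow>
     R \<in> borel_vec n \<rightarrow>\<^sub>M borel_vec n \<and>
     (\<forall>F\<in>borel_measurable (borel_vec n). (\<integral>\<^sup>+g. F (R g) \<partial>std_gauss n) = (\<integral>\<^sup>+g. F g \<partial>std_gauss n)) \<and>
     (\<forall>g h. \<forall>a. R (\<lambda>i\<in>{..<n}. g i + a * h i) = (\<lambda>i\<in>{..<n}. R g i + a * R h i)) \<and>
     (\<forall>g h. vec_inner n (R g) (R h) = vec_inner n g h)"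

lemma gauss_isometry_nn_integral:
  assumes "gauss_isometry n R" "F \<in> borel_measurable (borel_vec n)"
  shows "(\<integral>\<^sup>+g. F (R g) \<partial>std_gauss n) = (\<integral>\<^sup>+g. F g \<partial>std_gauss n)"
  using assms by (simp add: gauss_isometry_def)

lemma gauss_isometry_comp:
  assumes "gauss_isometry n R" "gauss_isometry n S"
  shows "gauss_isometry n (R \<circ> S)"
proof -
  have [measurable]: "R \<in> borel_vec n \<rightarrow>\<^sub>M borel_vec n" "S \<in> borel_vec n \<rightarrow>\<^sub>M borel_vec n"
    using assms by (auto simp: gauss_isometry_def)
  have "(\<integral>\<^sup>+g. F (R (S g)) \<partial>std_gauss n) = (\<integral>\<^sup>+g. F g \<partial>std_gauss n)"
    if [measurable]: "F \<in> borel_measurable (borel_vec n)" for F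
  proof -
    have "(\<lambda>g. F (R g)) \<in> borel_measurable (borel_vec n)" by measurable
    from gauss_isometry_nn_integral[OF assms(2) this] gauss_isometry_nn_integral[OF assms(1) that]
    show ?thesis by simp
  qed
  then show ?thesis using assms unfolding gauss_isometry_def by (simp add: comp_def)
qed

lemma gauss_isometry_restrict: "gauss_isometry n (\<lambda>g. restrict g {..<n})"
proof -
  have "restrict g {..<n} = g" if "g \<in> space (std_gauss n)" for g
    using that by (auto simp: space_std_gauss)
  then have "(\<integral>\<^sup>+g. F (restrict g {..<n}) \<partial>std_gauss n) = (\<integral>\<^sup>+g. F g \<partial>std_gauss n)" for F :: "(nat \<Rightarrow> real) \<Rightarrow> ennreal"
    by (intro nn_integral_cong) simp
  then show ?thesis
    unfolding gauss_isometry_def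
    by (auto simp: vec_inner_def fun_eq_iff intro!: measurable_restrict)
qed

definition givens :: "nat \<Rightarrow> nat \<Rightarrow> nat \<Rightarrow> real \<Rightarrow> real \<Rightarrow> (nat \<Rightarrow> real) \<Rightarrow> nat \<Rightarrow> real" where
  "givens n i j c s y =
     (\<lambda>k\<in>{..<n}. if k = i then c * y i - s * y j else if k = j then s * y i + c * y j else y k)"

lemma measurable_givens [measurable]:
  assumes "i < n" "j < n"
  shows "givens n i j c s \<in> borel_vec n \<rightarrow>\<^sub>M borel_vec n"
  unfolding givens_def using assms
  by (intro measurable_restrict) (auto intro!: borel_measurable_diff borel_measurable_add borel_measurable_times)

lemma gauss_isometry_givens:
  assumes ij: "i < n" "j < n" "i \<noteq> j" and cs: "c\<^sup>2 + s\<^sup>2 = 1" "s \<noteq> 0"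
  shows "gauss_isometry n (givens n i j c s)"
  unfolding gauss_isometry_def
proof (intro conjI ballI allI)
  show "givens n i j c s \<in> borel_vec n \<rightarrow>\<^sub>M borel_vec n"
    using ij by measurable
next
  fix g h a
  show "givens n i j c s (\<lambda>i\<in>{..<n}. g i + a * h i) =
     (\<lambda>k\<in>{..<n}. givens n i j c s g k + a * givens n i j c s h k)"
    using ij by (auto simp: givens_def restrict_def fun_eq_iff algebra_simps)
next
  fix g h
  \<comment> \<open>Only the coordinates i and j change, and there the four products recombine with
    the factor \<open>c\<^sup>2 + s\<^sup>2\<close> = 1.\<close>
  have split: "(\<Sum>k<n. u k) = u i + u j + (\<Sum>k\<in>{..<n} - {i, j}. u k)" for u :: "nat \<Rightarrow> real"
  proof -
    have "(\<Sum>k<n. u k) = sum u {i, j} + sum u ({..<n} - {i, j})"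
      using ij by (subst add.commute, subst sum.subset_diff[of "{i, j}"]) auto
    then show ?thesis using ij by simp
  qed
  have "(c * g i - s * g j) * (c * h i - s * h j) + (s * g i + c * g j) * (s * h i + c * h j) =
    (c\<^sup>2 + s\<^sup>2) * (g i * h i + g j * h j)"
    by (simp add: power2_eq_square algebra_simps)
  then show "vec_inner n (givens n i j c s g) (givens n i j c s h) = vec_inner n g h"
    using ij cs unfolding vec_inner_def split by (simp add: givens_def)
next
  fix F :: "(nat \<Rightarrow> real) \<Rightarrow> ennreal" assume [measurable]: "F \<in> borel_measurable (borel_vec n)"
  define J where "J = {..<n} - {i, j}"
  have n: "{..<n} = insert i (insert j J)" and J: "finite J" "i \<notin> insert j J" "j \<notin> J"
    using ij by (auto simp: J_def)
  have split: "(\<integral>\<^sup>+g. H g \<partial>std_gauss n) = (\<integral>\<^sup>+x. \<integral>\<^sup>+b. \<integral>\<^sup>+a. H (x(j := b, i := a))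
      \<partial>std_normal_distribution \<partial>std_normal_distribution \<partial>PiM J (\<lambda>_. std_normal_distribution))"
    if H: "H \<in> borel_measurable (borel_vec n)" for H
  proof -
    have H' [measurable]: "H \<in> borel_measurable (PiM (insert i (insert j J)) (\<lambda>_. std_normal_distribution))"
      using H unfolding n[symmetric] by measurable
    show ?thesis unfolding n using J
      by (subst std_normal_product.product_nn_integral_insert)
         (auto simp: std_normal_product.product_nn_integral_insert)
  qed
  have "(\<integral>\<^sup>+g. F (givens n i j c s g) \<partial>std_gauss n) =
    (\<integral>\<^sup>+x. \<integral>\<^sup>+b. \<integral>\<^sup>+a. F (givens n i j c s (x(j := b, i := a)))
      \<partial>std_normal_distribution \<partial>std_normal_distribution \<partial>PiM J (\<lambda>_. std_normal_distribution))"
    by (intro split) (use ij in measurable)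
  also have "\<dots> = (\<integral>\<^sup>+x. \<integral>\<^sup>+b. \<integral>\<^sup>+a. F (x(j := s * a + c * b, i := c * a - s * b))
      \<partial>std_normal_distribution \<partial>std_normal_distribution \<partial>PiM J (\<lambda>_. std_normal_distribution))"
  proof (intro nn_integral_cong)
    fix x a b assume "x \<in> space (PiM J (\<lambda>_. std_normal_distribution))"
    then have "x \<in> J \<rightarrow>\<^sub>E UNIV" by (simp add: space_PiM)
    then have "givens n i j c s (x(j := b, i := a)) = x(j := s * a + c * b, i := c * a - s * b)"
      using ij by (auto simp: givens_def fun_eq_iff J_def PiE_def extensional_def)
    then show "F (givens n i j c s (x(j := b, i := a))) = F (x(j := s * a + c * b, i := c * a - s * b))"
      by simp
  qed
  also have "\<dots> = (\<integral>\<^sup>+x. \<integral>\<^sup>+b. \<integral>\<^sup>+a. F (x(j := b, i := a))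
      \<partial>std_normal_distribution \<partial>std_normal_distribution \<partial>PiM J (\<lambda>_. std_normal_distribution))"
  proof (rule nn_integral_cong)
    fix x assume x: "x \<in> space (PiM J (\<lambda>_. std_normal_distribution))"
    then have [measurable]: "(\<lambda>p. F (x(j := snd p, i := fst p))) \<in> borel_measurable (borel \<Otimes>\<^sub>M borel)"
    proof -
      have "(\<lambda>p. x(j := snd p, i := fst p)) \<in> borel \<Otimes>\<^sub>M borel \<rightarrow>\<^sub>M borel_vec n"
        using x J unfolding n
        by (intro measurable_fun_upd[where J="insert j J"] measurable_fun_upd[where J=J])
           (auto simp: space_PiM)
      then show ?thesis by measurable
    qed
    show "(\<integral>\<^sup>+b. \<integral>\<^sup>+a. F (x(j := s * a + c * b, i := c * a - s * b))
        \<partial>std_normal_distribution \<partial>std_normal_distribution) =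
      (\<integral>\<^sup>+b. \<integral>\<^sup>+a. F (x(j := b, i := a)) \<partial>std_normal_distribution \<partial>std_normal_distribution)"
      by (rule nn_integral_std_normal_rotation[OF cs, of "\<lambda>a b. F (x(j := b, i := a))"])
         (simp add: case_prod_beta')
  qed
  also have "\<dots> = (\<integral>\<^sup>+g. F g \<partial>std_gauss n)"
    by (rule split[symmetric]) measurable
  finally show "(\<integral>\<^sup>+g. F (givens n i j c s g) \<partial>std_gauss n) = (\<integral>\<^sup>+g. F g \<partial>std_gauss n)" .
qed

text \<open>Coordinates 1, ..., n - 1 are cleared one after the other by a rotation in the plane of
  coordinate 0 and coordinate k. The composite \<open>R\<close> leads from the axis vector back to
  x, so each new rotation is composed on the inside.\<close>

lemma gauss_isometry_to_axis:
  assumes n: "n > 0" and x: "x \<in> {..<n} \<rightarrow>\<^sub>E UNIV"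
  obtains R z where "gauss_isometry n R" "z \<in> {..<n} \<rightarrow>\<^sub>E UNIV" "R z = x" "\<And>i. 0 < i \<Longrightarrow> i < n \<Longrightarrow> z i = 0"
proof -
  have "\<exists>R z. gauss_isometry n R \<and> z \<in> {..<n} \<rightarrow>\<^sub>E UNIV \<and> R z = x \<and> (\<forall>i. 0 < i \<and> i < n \<and> i < k \<longrightarrow> z i = 0)" for k
  proof (induction k)
    case 0
    have "\<exists>R. gauss_isometry n R \<and> R x = x"
      by (rule exI[of _ "\<lambda>g. restrict g {..<n}"], rule conjI, rule gauss_isometry_restrict, rule PiE_restrict[OF x])
    then show ?case using x by blast
  next
    case (Suc k)
    then obtain R z where R: "gauss_isometry n R" "z \<in> {..<n} \<rightarrow>\<^sub>E UNIV" "R z = x"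
      and z: "\<And>i. 0 < i \<Longrightarrow> i < n \<Longrightarrow> i < k \<Longrightarrow> z i = 0" by blast
    show ?case
    proof (cases "k = 0 \<or> n \<le> k \<or> z k = 0")
      case True
      \<comment> \<open>If \<open>z k\<close> is already 0 the rotation would have s = 0, which the
        invariance lemma excludes, so the old witnesses are kept.\<close>
      then show ?thesis using R z by (intro exI[of _ R] exI[of _ z]) (auto simp: less_Suc_eq)
    next
      case False
      define r where "r = sqrt ((z 0)\<^sup>2 + (z k)\<^sup>2)"
      have r2: "r\<^sup>2 = (z 0)\<^sup>2 + (z k)\<^sup>2" by (simp add: r_def)
      have r: "r > 0" using False by (auto simp: r_def intro!: add_nonneg_pos)
      define z' where "z' = z(0 := r, k := 0)"
      have cs: "(z 0 / r)\<^sup>2 + (z k / r)\<^sup>2 = 1"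
        using r by (simp add: power_divide add_divide_distrib[symmetric] r2[symmetric])
      have g: "givens n 0 k (z 0 / r) (z k / r) z' = z"
        using False r n R(2) by (auto simp: givens_def z'_def fun_eq_iff PiE_def extensional_def)
      have "gauss_isometry n (R \<circ> givens n 0 k (z 0 / r) (z k / r))"
        by (intro gauss_isometry_comp gauss_isometry_givens R) (use False n r cs in auto)
      moreover have "(R \<circ> givens n 0 k (z 0 / r) (z k / r)) z' = x"
        by (simp only: comp_apply g R)
      moreover have "z' \<in> {..<n} \<rightarrow>\<^sub>E UNIV" "\<forall>i. 0 < i \<and> i < n \<and> i < Suc k \<longrightarrow> z' i = 0"
        using R z False n by (auto simp: z'_def PiE_def extensional_def less_Suc_eq)
      ultimately show ?thesis by blast
    qed
  qed
  from this[of n] show ?thesis using that by blast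
qed

section \<open>Rank-one changes of the Gaussian covariance\<close>

definition rank_one_shift :: "nat \<Rightarrow> real \<Rightarrow> (nat \<Rightarrow> real) \<Rightarrow> (nat \<Rightarrow> real) \<Rightarrow> nat \<Rightarrow> real" where
  "rank_one_shift n c x g = (\<lambda>i\<in>{..<n}. g i + c * vec_inner n x g * x i)"

lemma measurable_rank_one_shift [measurable]:
  assumes [measurable]: "c \<in> borel_measurable M" "f \<in> M \<rightarrow>\<^sub>M borel_vec n" "g \<in> M \<rightarrow>\<^sub>M borel_vec n"
  shows "(\<lambda>z. rank_one_shift n (c z) (f z) (g z)) \<in> M \<rightarrow>\<^sub>M borel_vec n"
  unfolding rank_one_shift_def by measurable

text \<open>After rotating x onto the first axis the shift merely multiplies one coordinate by the
  square root of 1 + \<beta> s, and the one-dimensional scaling formula applies. The weight on the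
  right is the density of N(0, I + \<beta> x x^T) relative to N(0, I).\<close>

lemma nn_integral_rank_one_shift:
  fixes \<beta> :: real
  assumes x: "x \<in> {..<n} \<rightarrow>\<^sub>E UNIV" and s: "s = vec_inner n x x" "s > 0" and \<beta>: "1 + \<beta> * s > 0"
    and F [measurable]: "F \<in> borel_measurable (borel_vec n)"
  shows "(\<integral>\<^sup>+g. F (rank_one_shift n ((sqrt (1 + \<beta> * s) - 1) / s) x g) \<partial>std_gauss n) =
         (\<integral>\<^sup>+g. ennreal (exp (\<beta> / (2 * (1 + \<beta> * s)) * (vec_inner n x g)\<^sup>2) / sqrt (1 + \<beta> * s)) * F g \<partial>std_gauss n)"
proof -
  have n: "n > 0" using s by (cases n) (auto simp: vec_inner_def)
  obtain R z where R: "gauss_isometry n R" and z: "z \<in> {..<n} \<rightarrow>\<^sub>E UNIV" "R z = x"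
    and z0: "\<And>i. 0 < i \<Longrightarrow> i < n \<Longrightarrow> z i = 0"
    using gauss_isometry_to_axis[OF n x] by blast
  have [measurable]: "R \<in> borel_vec n \<rightarrow>\<^sub>M borel_vec n" using R by (simp add: gauss_isometry_def)
  define q where "q = sqrt (1 + \<beta> * s)"
  define c where "c = (q - 1) / s"
  have q: "q > 0" "q\<^sup>2 = 1 + \<beta> * s" using \<beta> by (auto simp: q_def)
  have xm [measurable]: "x \<in> space (borel_vec n)" using x by (simp add: space_PiM)
  have inner_z: "vec_inner n z g = z 0 * g 0" for g
  proof -
    have "vec_inner n z g = (\<Sum>i\<in>{0}. z i * g i)"
      unfolding vec_inner_def by (rule sum.mono_neutral_right) (use n z0 in auto)
    then show ?thesis by simp
  qed
  have iso: "vec_inner n (R g) (R h) = vec_inner n g h" for g h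
    using R by (simp add: gauss_isometry_def)
  have s': "s = (z 0)\<^sup>2" using iso[of z z] inner_z[of z] s z by (simp add: power2_eq_square)
  have inner_x: "vec_inner n x (R g) = z 0 * g 0" for g
    using iso[of z g] z inner_z by simp
  have shift: "rank_one_shift n c x (R g) = R (g(0 := q * g 0))" if g: "g \<in> space (std_gauss n)" for g
  proof -
    have "rank_one_shift n c x (R g) = (\<lambda>i\<in>{..<n}. R g i + (c * (z 0 * g 0)) * R z i)"
      using z by (simp add: rank_one_shift_def inner_x)
    also have "\<dots> = R (\<lambda>i\<in>{..<n}. g i + (c * (z 0 * g 0)) * z i)"
      using R by (simp add: gauss_isometry_def)
    also have "(\<lambda>i\<in>{..<n}. g i + (c * (z 0 * g 0)) * z i) = g(0 := q * g 0)"
    proof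
      fix i
      have "g 0 + c * (z 0 * g 0) * z 0 = (1 + c * s) * g 0"
        by (simp add: s' power2_eq_square algebra_simps)
      also have "1 + c * s = q" using s by (simp add: c_def)
      finally show "(\<lambda>i\<in>{..<n}. g i + (c * (z 0 * g 0)) * z i) i = (g(0 := q * g 0)) i"
        using n z0 g by (cases "i = 0") (auto simp: space_std_gauss PiE_def extensional_def)
    qed
    finally show ?thesis .
  qed
  have inv: "(\<integral>\<^sup>+g. H (R g) \<partial>std_gauss n) = (\<integral>\<^sup>+g. H g \<partial>std_gauss n)"
    if "H \<in> borel_measurable (borel_vec n)" for H
    using R that by (simp add: gauss_isometry_def)
  define J where "J = {1..<n}"
  have J: "{..<n} = insert 0 J" "finite J" "0 \<notin> J" using n by (auto simp: J_def)
  have split: "(\<integral>\<^sup>+g. H g \<partial>std_gauss n) = (\<integral>\<^sup>+x. \<integral>\<^sup>+a. H (x(0 := a))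
      \<partial>std_normal_distribution \<partial>PiM J (\<lambda>_. std_normal_distribution))"
    if H: "H \<in> borel_measurable (borel_vec n)" for H
  proof -
    have H' [measurable]: "H \<in> borel_measurable (PiM (insert 0 J) (\<lambda>_. std_normal_distribution))"
      using H unfolding J(1)[symmetric] by measurable
    show ?thesis unfolding J(1) using J
      by (subst std_normal_product.product_nn_integral_insert) auto
  qed
  have upd [measurable]: "(\<lambda>g. g(0 := q * g 0)) \<in> borel_vec n \<rightarrow>\<^sub>M borel_vec n"
    unfolding J(1) by (intro measurable_fun_upd[where J="insert 0 J"]) (auto intro!: borel_measurable_times)
  have "(\<integral>\<^sup>+g. F (rank_one_shift n c x g) \<partial>std_gauss n) = (\<integral>\<^sup>+g. F (rank_one_shift n c x (R g)) \<partial>std_gauss n)"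
    by (rule inv[symmetric]) measurable
  also have "\<dots> = (\<integral>\<^sup>+g. F (R (g(0 := q * g 0))) \<partial>std_gauss n)"
    by (intro nn_integral_cong) (simp add: shift)
  also have "\<dots> = (\<integral>\<^sup>+y. \<integral>\<^sup>+a. F (R (y(0 := q * a)))
      \<partial>std_normal_distribution \<partial>PiM J (\<lambda>_. std_normal_distribution))"
    by (subst split) auto
  also have "\<dots> = (\<integral>\<^sup>+y. \<integral>\<^sup>+a. ennreal (exp ((1 - 1 / q\<^sup>2) / 2 * a\<^sup>2) / q) * F (R (y(0 := a)))
      \<partial>std_normal_distribution \<partial>PiM J (\<lambda>_. std_normal_distribution))"
  proof (rule nn_integral_cong, rule nn_integral_std_normal_scale[OF q(1)])
    fix y assume y: "y \<in> space (PiM J (\<lambda>_. std_normal_distribution))"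
    have "(\<lambda>a. y(0 := a)) \<in> borel \<rightarrow>\<^sub>M borel_vec n"
      using y unfolding J(1) by (intro measurable_fun_upd[where J=J]) (auto simp: space_PiM)
    then show "(\<lambda>a. F (R (y(0 := a)))) \<in> borel_measurable borel" by measurable
  qed
  also have "\<dots> = (\<integral>\<^sup>+g. ennreal (exp ((1 - 1 / q\<^sup>2) / 2 * (g 0)\<^sup>2) / q) * F (R g) \<partial>std_gauss n)"
    using n by (subst split) auto
  also have "\<dots> = (\<integral>\<^sup>+g. ennreal (exp (\<beta> / (2 * (1 + \<beta> * s)) * (vec_inner n x (R g))\<^sup>2) / q) * F (R g) \<partial>std_gauss n)"
  proof -
    have "(1 - 1 / q\<^sup>2) / 2 * a\<^sup>2 = \<beta> / (2 * (1 + \<beta> * s)) * (z 0 * a)\<^sup>2" for a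
      using \<beta> unfolding q by (simp add: power_mult_distrib s'[symmetric] field_simps)
    then show ?thesis by (simp only: inner_x)
  qed
  also have "\<dots> = (\<integral>\<^sup>+g. ennreal (exp (\<beta> / (2 * (1 + \<beta> * s)) * (vec_inner n x g)\<^sup>2) / q) * F g \<partial>std_gauss n)"
    by (rule inv) measurable
  finally show ?thesis by (simp add: q_def c_def)
qed

section \<open>Quadratic exponential moments and the spiked covariance\<close>

text \<open>No integral is computed: \<beta> is chosen with
  \<open>\<beta> / (2 * (1 + \<beta> * s)) = a\<close>, and the change of variables for the constant
  function 1 says that the weighted total mass is 1. The case s = 0 is separate because the shift
  divides by s.\<close>

lemma nn_integral_exp_inner_sq:
  assumes x: "x \<in> {..<n} \<rightarrow>\<^sub>E UNIV" and s: "s = vec_inner n x x" and a: "2 * a * s < 1"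
  shows "(\<integral>\<^sup>+g. ennreal (exp (a * (vec_inner n x g)\<^sup>2)) \<partial>std_gauss n) = ennreal (1 / sqrt (1 - 2 * a * s))"
proof (cases "s = 0")
  case True
  have "(\<Sum>i<n. (x i)\<^sup>2) = 0" using True s by (simp add: vec_inner_def power2_eq_square)
  then have "x i = 0" if "i < n" for i using that by (subst (asm) sum_nonneg_eq_0_iff) auto
  then have "vec_inner n x g = 0" for g by (simp add: vec_inner_def)
  then show ?thesis using True prob_space.emeasure_space_1[OF prob_space_std_gauss] by simp
next
  case False
  have xm [measurable]: "x \<in> space (borel_vec n)" using x by (simp add: space_PiM)
  have s_pos: "s > 0"
    using False s sum_nonneg[of "{..<n}" "\<lambda>i. x i * x i"] by (simp add: vec_inner_def less_le)
  define \<beta> where "\<beta> = 2 * a / (1 - 2 * a * s)"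
  have \<beta>: "1 + \<beta> * s = 1 / (1 - 2 * a * s)" using a by (simp add: \<beta>_def field_simps)
  have \<beta>': "\<beta> / (2 * (1 + \<beta> * s)) = a" unfolding \<beta> using a by (simp add: \<beta>_def)
  have pos: "1 + \<beta> * s > 0" unfolding \<beta> using a by simp
  have "1 = (\<integral>\<^sup>+g. 1 \<partial>std_gauss n)"
    using prob_space.emeasure_space_1[OF prob_space_std_gauss] by simp
  also have "\<dots> = (\<integral>\<^sup>+g. ennreal (exp (a * (vec_inner n x g)\<^sup>2) / sqrt (1 + \<beta> * s)) * 1 \<partial>std_gauss n)"
    using nn_integral_rank_one_shift[OF x s s_pos pos, of "\<lambda>_. 1", unfolded \<beta>'] by simp
  also have "\<dots> = (\<integral>\<^sup>+g. ennreal (exp (a * (vec_inner n x g)\<^sup>2)) * ennreal (1 / sqrt (1 + \<beta> * s)) \<partial>std_gauss n)"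
    using pos by (intro nn_integral_cong) (simp add: ennreal_mult[symmetric])
  also have "\<dots> = (\<integral>\<^sup>+g. ennreal (exp (a * (vec_inner n x g)\<^sup>2)) \<partial>std_gauss n) * ennreal (1 / sqrt (1 + \<beta> * s))"
    by (intro nn_integral_multc) measurable
  finally have "ennreal (sqrt (1 + \<beta> * s)) * 1 =
    (\<integral>\<^sup>+g. ennreal (exp (a * (vec_inner n x g)\<^sup>2)) \<partial>std_gauss n) * (ennreal (1 / sqrt (1 + \<beta> * s)) * ennreal (sqrt (1 + \<beta> * s)))"
    by (simp add: mult_ac)
  then show ?thesis using pos by (simp add: ennreal_mult[symmetric] \<beta> real_sqrt_divide)
qed

text \<open>The weight in x is absorbed by the rank-one shift along x. The shift is self-adjoint, so
  it can be moved onto y, giving z with squared norm r + \<beta> \<open>t\<^sup>2\<close>, and the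
  single-vector formula finishes. \<open>D\<close> is the determinant of I - 2 a x x^T - 2 b y y^T;
  its positivity is what makes the integral over z finite.\<close>

lemma nn_integral_exp_inner_sq_pair:
  assumes x: "x \<in> {..<n} \<rightarrow>\<^sub>E UNIV" and y: "y \<in> {..<n} \<rightarrow>\<^sub>E UNIV"
    and s: "s = vec_inner n x x" "s > 0" and r: "r = vec_inner n y y" and t: "t = vec_inner n x y"
    and a: "2 * a * s < 1" and D: "D = (1 - 2 * a * s) * (1 - 2 * b * r) - 4 * a * b * t\<^sup>2" "D > 0"
  shows "(\<integral>\<^sup>+g. ennreal (exp (a * (vec_inner n x g)\<^sup>2 + b * (vec_inner n y g)\<^sup>2)) \<partial>std_gauss n) =
    ennreal (1 / sqrt D)"
proof -
  have xm [measurable]: "x \<in> space (borel_vec n)" "y \<in> space (borel_vec n)" using x y by (auto simp: space_PiM)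
  define \<beta> where "\<beta> = 2 * a / (1 - 2 * a * s)"
  have \<beta>: "1 + \<beta> * s = 1 / (1 - 2 * a * s)" using a by (simp add: \<beta>_def field_simps)
  have \<beta>': "\<beta> / (2 * (1 + \<beta> * s)) = a" unfolding \<beta> using a by (simp add: \<beta>_def)
  have pos: "1 + \<beta> * s > 0" unfolding \<beta> using a by simp
  define c where "c = (sqrt (1 + \<beta> * s) - 1) / s"
  have c: "c * (2 + c * s) = \<beta>"
  proof -
    have "(1 + c * s)\<^sup>2 = 1 + \<beta> * s" using s pos by (simp add: c_def)
    then have "s * (c * (2 + c * s)) = s * \<beta>" by (simp add: power2_eq_square algebra_simps)
    then show ?thesis using s by simp
  qed
  define z where "z = rank_one_shift n c x y"
  have z: "z \<in> {..<n} \<rightarrow>\<^sub>E UNIV" by (simp add: z_def rank_one_shift_def)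
  have shift: "vec_inner n u (rank_one_shift n c x v) = vec_inner n u v + c * vec_inner n x v * vec_inner n u x" for u v
  proof -
    have "vec_inner n u (rank_one_shift n c x v) = (\<Sum>i<n. u i * v i + (c * vec_inner n x v) * (u i * x i))"
      unfolding rank_one_shift_def vec_inner_def[of n u] by (intro sum.cong refl) (simp add: algebra_simps)
    then show ?thesis
      by (simp only: sum.distrib sum_distrib_left[symmetric] vec_inner_def[of n u])
  qed
  have zg: "vec_inner n y (rank_one_shift n c x g) = vec_inner n z g" for g
    unfolding z_def vec_inner_commute[of n "rank_one_shift n c x y" g] shift
    by (simp add: vec_inner_commute[of n g] vec_inner_commute[of n y x] mult_ac)
  have zz: "vec_inner n z z = r + \<beta> * t\<^sup>2"
  proof -
    have zu: "vec_inner n z u = vec_inner n u y + c * t * vec_inner n u x" for u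
    proof -
      have "vec_inner n z u = vec_inner n u z" by (rule vec_inner_commute)
      then show ?thesis unfolding z_def t shift .
    qed
    have "vec_inner n z z = vec_inner n z y + c * t * vec_inner n z x" by (rule zu)
    also have "\<dots> = (r + c * t * t) + c * t * (t + c * t * s)"
      unfolding zu vec_inner_commute[of n y x] by (simp add: r t s)
    finally have "vec_inner n z z = r + (c * (2 + c * s)) * t\<^sup>2" by (simp add: power2_eq_square algebra_simps)
    then show ?thesis by (simp add: c)
  qed
  have D': "(1 - 2 * a * s) * (1 - 2 * b * vec_inner n z z) = D"
  proof -
    have "(1 - 2 * a * s) * \<beta> = 2 * a" using a by (simp add: \<beta>_def)
    moreover have "(1 - 2 * a * s) * (1 - 2 * b * vec_inner n z z)
       = (1 - 2 * a * s) * (1 - 2 * b * r) - 2 * b * t\<^sup>2 * ((1 - 2 * a * s) * \<beta>)"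
      unfolding zz by (simp add: algebra_simps)
    ultimately show ?thesis by (simp add: D)
  qed
  then have bz: "2 * b * vec_inner n z z < 1"
    using D(2) a by (simp add: zero_less_mult_iff flip: D')
  have "(\<integral>\<^sup>+g. ennreal (exp (b * (vec_inner n z g)\<^sup>2)) \<partial>std_gauss n) =
    (\<integral>\<^sup>+g. ennreal (exp (b * (vec_inner n y (rank_one_shift n c x g))\<^sup>2)) \<partial>std_gauss n)"
    by (simp add: zg)
  also have "\<dots> = (\<integral>\<^sup>+g. ennreal (exp (a * (vec_inner n x g)\<^sup>2) / sqrt (1 + \<beta> * s)) *
      ennreal (exp (b * (vec_inner n y g)\<^sup>2)) \<partial>std_gauss n)"
    unfolding c_def
    by (rule nn_integral_rank_one_shift[OF x s pos, of "\<lambda>g. ennreal (exp (b * (vec_inner n y g)\<^sup>2))", unfolded \<beta>']) measurable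
  also have "\<dots> = (\<integral>\<^sup>+g. ennreal (exp (a * (vec_inner n x g)\<^sup>2 + b * (vec_inner n y g)\<^sup>2)) *
      ennreal (1 / sqrt (1 + \<beta> * s)) \<partial>std_gauss n)"
    using pos by (intro nn_integral_cong) (simp add: ennreal_mult[symmetric] exp_add)
  also have "\<dots> = (\<integral>\<^sup>+g. ennreal (exp (a * (vec_inner n x g)\<^sup>2 + b * (vec_inner n y g)\<^sup>2)) \<partial>std_gauss n) *
      ennreal (1 / sqrt (1 + \<beta> * s))"
    by (intro nn_integral_multc) measurable
  finally have "ennreal (sqrt (1 + \<beta> * s)) * (\<integral>\<^sup>+g. ennreal (exp (b * (vec_inner n z g)\<^sup>2)) \<partial>std_gauss n) =
    (\<integral>\<^sup>+g. ennreal (exp (a * (vec_inner n x g)\<^sup>2 + b * (vec_inner n y g)\<^sup>2)) \<partial>std_gauss n) *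
     (ennreal (1 / sqrt (1 + \<beta> * s)) * ennreal (sqrt (1 + \<beta> * s)))"
    by (simp add: mult_ac)
  also have "ennreal (1 / sqrt (1 + \<beta> * s)) * ennreal (sqrt (1 + \<beta> * s)) = 1"
    using pos by (simp add: ennreal_mult[symmetric])
  finally have "(\<integral>\<^sup>+g. ennreal (exp (a * (vec_inner n x g)\<^sup>2 + b * (vec_inner n y g)\<^sup>2)) \<partial>std_gauss n) =
     ennreal (sqrt (1 + \<beta> * s)) * ennreal (1 / sqrt (1 - 2 * b * vec_inner n z z))"
    by (simp add: nn_integral_exp_inner_sq[OF z refl bz])
  also have "\<dots> = ennreal (1 / sqrt D)"
    using pos a bz by (simp add: ennreal_mult[symmetric] \<beta> real_sqrt_divide D'[symmetric] real_sqrt_mult)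
  finally show ?thesis .
qed

section \<open>The positive semidefinite square root of the spiked covariance\<close>

definition mat_vec :: "nat \<Rightarrow> (nat \<Rightarrow> nat \<Rightarrow> real) \<Rightarrow> (nat \<Rightarrow> real) \<Rightarrow> nat \<Rightarrow> real" where
  "mat_vec n S v i = (\<Sum>k<n. S i k * v k)"

lemma vec_inner_eq_0_iff: "vec_inner n w w = 0 \<longleftrightarrow> (\<forall>i<n. w i = 0)"
proof -
  have "vec_inner n w w = (\<Sum>i<n. (w i)\<^sup>2)" by (simp add: vec_inner_def power2_eq_square)
  then show ?thesis by (auto simp: sum_nonneg_eq_0_iff)
qed

lemma vec_inner_self_nonneg: "0 \<le> vec_inner n w w"
  by (simp add: vec_inner_def sum_nonneg)

text \<open>\<open>S\<close> has eigenvalue \<open>sqrt (1 + \<beta> s)\<close> at \<open>x\<close>, and a vector \<open>w\<close> with \<open>S w = - q w\<close>, \<open>q > 0\<close>,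
  vanishes since \<open>S\<close> is positive semidefinite.\<close>

lemma psd_sqrt_spiked_cov_unique:
  fixes \<beta> :: real
  assumes sym: "\<And>i j. i < n \<Longrightarrow> j < n \<Longrightarrow> S i j = S j i"
    and psd: "\<And>u. 0 \<le> (\<Sum>i<n. \<Sum>j<n. u i * S i j * u j)"
    and sq: "\<And>i j. i < n \<Longrightarrow> j < n \<Longrightarrow> (\<Sum>k<n. S i k * S k j) = spiked_cov \<beta> x i j"
    and s: "s = vec_inner n x x" and \<beta>: "1 + \<beta> * s \<ge> 0"
    and ij: "i < n" "j < n"
  shows "S i j = (if i = j then 1 else 0) + (sqrt (1 + \<beta> * s) - 1) / s * x i * x j"
proof -
  define q where "q = sqrt (1 + \<beta> * s)"
  define c where "c = (q - 1) / s"
  have q: "q \<ge> 0" "q\<^sup>2 = 1 + \<beta> * s" using \<beta> by (auto simp: q_def)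
  have x0: "x i = 0" if "s = 0" "i < n" for i using that s vec_inner_eq_0_iff[of n x] by simp
  have cs: "c * s = q - 1" if "i < n" "x i \<noteq> 0" for i using x0 that by (auto simp: c_def)
  have psd': "0 \<le> vec_inner n u (mat_vec n S u)" for u
    using psd[of u] by (simp add: vec_inner_def mat_vec_def sum_distrib_left mult_ac)
  have selfadj: "vec_inner n u (mat_vec n S v) = vec_inner n (mat_vec n S u) v" for u v
  proof -
    have "vec_inner n u (mat_vec n S v) = (\<Sum>i<n. \<Sum>k<n. u i * S i k * v k)"
      by (simp add: vec_inner_def mat_vec_def sum_distrib_left mult_ac)
    also have "\<dots> = (\<Sum>k<n. \<Sum>i<n. u i * S i k * v k)" by (rule sum.swap)
    also have "\<dots> = vec_inner n (mat_vec n S u) v"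
      unfolding vec_inner_def mat_vec_def sum_distrib_right
      by (intro sum.cong refl) (simp add: sym)
    finally show ?thesis .
  qed
  have lin: "mat_vec n S (\<lambda>i. u i + a * v i) i = mat_vec n S u i + a * mat_vec n S v i" for u v a i
    by (simp add: mat_vec_def distrib_left sum.distrib sum_distrib_left mult_ac)
  have inner_lin: "vec_inner n w (\<lambda>i. u i + a * v i) = vec_inner n w u + a * vec_inner n w v" for u v w a
    by (simp add: vec_inner_def distrib_left sum.distrib sum_distrib_left mult_ac)
  have inner_cong: "vec_inner n w u = vec_inner n w v" if "\<And>i. i < n \<Longrightarrow> u i = v i" for u v w
    using that by (simp add: vec_inner_def)
  have sq': "mat_vec n S (mat_vec n S v) i = v i + \<beta> * vec_inner n x v * x i" if i: "i < n" for v i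
  proof -
    have "mat_vec n S (mat_vec n S v) i = (\<Sum>k<n. \<Sum>j<n. S i k * S k j * v j)"
      by (simp add: mat_vec_def sum_distrib_left mult_ac)
    also have "\<dots> = (\<Sum>j<n. \<Sum>k<n. S i k * S k j * v j)" by (rule sum.swap)
    also have "\<dots> = (\<Sum>j<n. spiked_cov \<beta> x i j * v j)"
      using i by (simp add: sum_distrib_right[symmetric] sq)
    also have "\<dots> = (\<Sum>j<n. if i = j then v j else 0) + (\<Sum>j<n. \<beta> * x i * x j * v j)"
      unfolding sum.distrib[symmetric] by (intro sum.cong refl) (simp add: spiked_cov_def distrib_right)
    also have "\<dots> = v i + \<beta> * vec_inner n x v * x i"
      using i by (simp add: vec_inner_def sum_distrib_left sum_distrib_right mult_ac)
    finally show ?thesis .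
  qed
  have neg_eig: "w i = 0" if w: "\<And>i. i < n \<Longrightarrow> mat_vec n S w i = - (p * w i)" and p: "p > 0" and i: "i < n" for w p i
  proof -
    have "vec_inner n w (mat_vec n S w) = vec_inner n w (\<lambda>i. 0 + (- p) * w i)"
      by (rule inner_cong) (simp add: w)
    also have "\<dots> = - p * vec_inner n w w"
      unfolding inner_lin by (simp add: vec_inner_def)
    finally have "p * vec_inner n w w \<le> 0" using psd'[of w] by simp
    then have "vec_inner n w w = 0"
      using p vec_inner_self_nonneg[of n w] by (simp add: mult_le_0_iff)
    then show ?thesis using i by (simp add: vec_inner_eq_0_iff)
  qed
  have Sx: "mat_vec n S x i = q * x i" if i: "i < n" for i
  proof (cases "q = 0")
    case True
    \<comment> \<open>For q = 0 there is no negative eigenvalue to exclude; instead the squared norm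
      of S x is <x, S S x> = 0.\<close>
    have "vec_inner n (mat_vec n S x) (mat_vec n S x) = vec_inner n x (mat_vec n S (mat_vec n S x))"
      by (rule selfadj[symmetric])
    also have "\<dots> = vec_inner n x (\<lambda>i. 0 + q\<^sup>2 * x i)"
      by (rule inner_cong) (simp add: sq' q s algebra_simps)
    also have "\<dots> = 0" using True by (simp add: vec_inner_def)
    finally show ?thesis using i True by (simp add: vec_inner_eq_0_iff)
  next
    case False
    have "mat_vec n S x i + (- q) * x i = 0"
    proof (rule neg_eig[where p = q and w = "\<lambda>i. mat_vec n S x i + (- q) * x i"])
      fix i assume i: "i < n"
      have "mat_vec n S (mat_vec n S x) i = q\<^sup>2 * x i" using i by (simp add: sq' q s algebra_simps)
      then show "mat_vec n S (\<lambda>i. mat_vec n S x i + (- q) * x i) i = - (q * (mat_vec n S x i + (- q) * x i))"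
        unfolding lin by (simp add: power2_eq_square algebra_simps)
    qed (use False q i in auto)
    then show ?thesis by simp
  qed
  have Sv: "mat_vec n S v i = v i + c * vec_inner n x v * x i" if i: "i < n" for v i
  proof -
    define h where "h = vec_inner n x v"
    \<comment> \<open>\<open>w\<close> is S v minus the candidate root applied to v. Both have the
      same square and the same value at x, which forces S w = - w.\<close>
    define w where "w = (\<lambda>i. mat_vec n S v i + (- 1) * (v i + (c * h) * x i))"
    have Sw: "mat_vec n S w i = - (1 * w i)" if i: "i < n" for i
    proof -
      have "mat_vec n S w i = v i + \<beta> * h * x i - mat_vec n S v i - c * h * (q * x i)"
        unfolding w_def lin by (simp add: sq' i Sx h_def)
      moreover have "\<beta> * h * x i - c * h * (q * x i) = c * h * x i"
      proof (cases "x i = 0")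
        case False
        then have cs: "c * s = q - 1" and "s \<noteq> 0" using cs i x0 by auto
        have "s * (\<beta> - c * q) = (q\<^sup>2 - 1) - (c * s) * q" unfolding q by (simp add: algebra_simps)
        also have "\<dots> = s * c" unfolding cs using cs by (simp add: power2_eq_square algebra_simps)
        finally have "\<beta> - c * q = c" using \<open>s \<noteq> 0\<close> by simp
        then have "(\<beta> - c * q) * (h * x i) = c * (h * x i)" by simp
        then show ?thesis by (simp add: algebra_simps)
      qed simp
      ultimately show ?thesis by (simp add: w_def)
    qed
    have "w i = 0" by (rule neg_eig[where p = 1, OF Sw]) (use i in auto)
    then show ?thesis by (simp add: w_def h_def)
  qed
  have "S i j = mat_vec n S (\<lambda>k. if k = j then 1 else 0) i"
    using ij by (simp add: mat_vec_def if_distrib cong: if_cong)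
  also have "\<dots> = (if i = j then 1 else 0) + c * x j * x i"
    using ij by (subst Sv) (simp_all add: vec_inner_def if_distrib cong: if_cong)
  finally show ?thesis by (simp add: c_def q_def mult_ac)
qed

text \<open>Existence of a root, so that the choice in \<open>psd_sqrt\<close> is not void. Its
  eigenvalues are 1 and q; positivity follows from Cauchy--Schwarz because q \<ge> 0 means c \<ge>
  -1/s.\<close>

lemma rank_one_sqrt_props:
  fixes \<beta> :: real
  assumes s: "s = vec_inner n x x" and \<beta>: "1 + \<beta> * s \<ge> 0"
  defines "S \<equiv> \<lambda>i j. (if i = j then 1 else 0) + (sqrt (1 + \<beta> * s) - 1) / s * x i * x j"
  shows "0 \<le> (\<Sum>i<n. \<Sum>j<n. u i * S i j * u j)"
    and "i < n \<Longrightarrow> j < n \<Longrightarrow> (\<Sum>k<n. S i k * S k j) = spiked_cov \<beta> x i j"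
proof -
  define q where "q = sqrt (1 + \<beta> * s)"
  define c where "c = (q - 1) / s"
  have q: "q \<ge> 0" "q\<^sup>2 = 1 + \<beta> * s" using \<beta> by (auto simp: q_def)
  have S: "S i j = (if i = j then 1 else 0) + c * x i * x j" for i j
    by (simp add: S_def c_def q_def)
  have x0: "x i = 0" if "s = 0" "i < n" for i using that s vec_inner_eq_0_iff[of n x] by simp
  have s0: "s \<ge> 0" by (simp add: s vec_inner_self_nonneg)
  have "(\<Sum>i<n. \<Sum>j<n. u i * S i j * u j) = (\<Sum>i<n. \<Sum>j<n. (if i = j then u i * u j else 0) + c * (u i * x i) * (x j * u j))"
    by (intro sum.cong refl) (simp add: S algebra_simps)
  also have "\<dots> = vec_inner n u u + c * (vec_inner n u x)\<^sup>2"
    by (simp add: sum.distrib vec_inner_def power2_eq_square sum_product sum_distrib_left mult_ac)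
  also have "\<dots> \<ge> 0"
  proof (cases "s = 0")
    case True
    then show ?thesis by (simp add: c_def vec_inner_self_nonneg)
  next
    case False
    then have s_pos: "s > 0" using s0 by simp
    have CS: "(vec_inner n u x)\<^sup>2 \<le> vec_inner n u u * s"
      using Cauchy_Schwarz_ineq_sum[of u x "{..<n}"] by (simp add: vec_inner_def s power2_eq_square)
    have "- (1 / s) \<le> c" using q s_pos by (simp add: c_def field_simps)
    then have "- (1 / s) * (vec_inner n u x)\<^sup>2 \<le> c * (vec_inner n u x)\<^sup>2"
      by (intro mult_right_mono) auto
    moreover have "(1 / s) * (vec_inner n u x)\<^sup>2 \<le> vec_inner n u u"
      using CS s_pos by (simp add: field_simps)
    ultimately show ?thesis by simp
  qed
  finally show "0 \<le> (\<Sum>i<n. \<Sum>j<n. u i * S i j * u j)" .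
  assume ij: "i < n" "j < n"
  have ss: "(\<Sum>k<n. C * (x k * x k)) = C * s" for C
    by (simp add: s vec_inner_def sum_distrib_left)
  have "(\<Sum>k<n. S i k * S k j) = (\<Sum>k<n. (if k = i then (if k = j then 1 else 0) else 0)
     + (if k = i then c * x k * x j else 0) + (if k = j then c * x i * x k else 0)
     + c\<^sup>2 * x i * x j * (x k * x k))"
    by (intro sum.cong refl) (simp add: S power2_eq_square algebra_simps)
  also have "\<dots> = (if i = j then 1 else 0) + (2 * c + c\<^sup>2 * s) * x i * x j"
    unfolding sum.distrib ss using ij by (simp add: algebra_simps)
  also have "(2 * c + c\<^sup>2 * s) * x i * x j = \<beta> * x i * x j"
  proof (cases "s = 0")
    case False
    then have cs: "c * s = q - 1" by (simp add: c_def)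
    have "s * (2 * c + c\<^sup>2 * s) = 2 * (c * s) + (c * s)\<^sup>2" by (simp add: power2_eq_square algebra_simps)
    also have "\<dots> = q\<^sup>2 - 1" unfolding cs by (simp add: power2_eq_square algebra_simps)
    finally show ?thesis using False q by simp
  qed (use x0 ij in simp)
  finally show "(\<Sum>k<n. S i k * S k j) = spiked_cov \<beta> x i j" by (simp add: spiked_cov_def)
qed

lemma psd_sqrt_spiked_cov:
  fixes \<beta> :: real
  assumes s: "s = vec_inner n x x" and \<beta>: "1 + \<beta> * s \<ge> 0" and ij: "i < n" "j < n"
  shows "psd_sqrt n (spiked_cov \<beta> x) i j = (if i = j then 1 else 0) + (sqrt (1 + \<beta> * s) - 1) / s * x i * x j"
proof -
  define P where "P S \<longleftrightarrow> (\<forall>i<n. \<forall>j<n. S i j = S j i) \<and> (\<forall>u. 0 \<le> (\<Sum>i<n. \<Sum>j<n. u i * S i j * u j)) \<and>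
     (\<forall>i<n. \<forall>j<n. (\<Sum>k<n. S i k * S k j) = spiked_cov \<beta> x i j)" for S
  have "P (\<lambda>i j. (if i = j then 1 else 0) + (sqrt (1 + \<beta> * s) - 1) / s * x i * x j)"
    unfolding P_def using rank_one_sqrt_props[OF s \<beta>] by (intro conjI allI impI) (simp_all add: mult_ac)
  then have "P (SOME S. P S)" by (rule someI[of P])
  then have "P (psd_sqrt n (spiked_cov \<beta> x))" unfolding psd_sqrt_def P_def .
  then show ?thesis
    unfolding P_def by (intro psd_sqrt_spiked_cov_unique[OF _ _ _ s \<beta> ij]) blast+
qed

lemma gaussian_vec_spiked_cov:
  fixes \<beta> :: real
  assumes s: "s = vec_inner n x x" and \<beta>: "1 + \<beta> * s \<ge> 0"
  shows "gaussian_vec n (spiked_cov \<beta> x) =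
    distr (std_gauss n) (borel_vec n) (rank_one_shift n ((sqrt (1 + \<beta> * s) - 1) / s) x)"
proof -
  define c where "c = (sqrt (1 + \<beta> * s) - 1) / s"
  have "(\<Sum>j<n. psd_sqrt n (spiked_cov \<beta> x) i j * g j) = g i + c * vec_inner n x g * x i" if i: "i < n" for g i
  proof -
    have "(\<Sum>j<n. psd_sqrt n (spiked_cov \<beta> x) i j * g j) = (\<Sum>j<n. (if i = j then g j else 0) + c * x i * (x j * g j))"
      using i by (intro sum.cong refl) (simp add: psd_sqrt_spiked_cov[OF s \<beta>] c_def algebra_simps)
    also have "\<dots> = g i + c * vec_inner n x g * x i"
      unfolding sum.distrib sum_distrib_left[symmetric] vec_inner_def[symmetric] using i by simp
    finally show ?thesis .
  qed
  then show ?thesis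
    unfolding gaussian_vec_def rank_one_shift_def c_def
    by (intro distr_cong refl) auto
qed

section \<open>The likelihood of the columns\<close>

abbreviation gauss_columns :: "nat \<Rightarrow> nat \<Rightarrow> (nat \<Rightarrow> nat \<Rightarrow> real) measure" where
  "gauss_columns n N \<equiv> PiM {..<N} (\<lambda>_. std_gauss n)"

abbreviation borel_columns :: "nat \<Rightarrow> nat \<Rightarrow> (nat \<Rightarrow> nat \<Rightarrow> real) measure" where
  "borel_columns n N \<equiv> PiM {..<N} (\<lambda>_. borel_vec n)"

lemma sets_gauss_columns [measurable_cong]: "sets (gauss_columns n N) = sets (borel_columns n N)"
  by (intro sets_PiM_cong refl sets_std_gauss)

lemma prob_space_gauss_columns: "prob_space (gauss_columns n N)"
  by (intro prob_space_PiM prob_space_std_gauss)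

lemma product_sigma_finite_std_gauss: "product_sigma_finite (\<lambda>_. std_gauss n)"
  using prob_space_std_gauss prob_space_imp_sigma_finite by (auto simp: product_sigma_finite_def)

lemma PiM_density_const:
  assumes I: "finite I" and M: "prob_space M" and D: "prob_space (density M f)"
    and f [measurable]: "f \<in> borel_measurable M"
  shows "PiM I (\<lambda>_. density M f) = density (PiM I (\<lambda>_. M)) (\<lambda>\<omega>. \<Prod>i\<in>I. f (\<omega> i))"
proof -
  interpret D: product_sigma_finite "\<lambda>_. density M f"
    using D prob_space_imp_sigma_finite by (auto simp: product_sigma_finite_def)
  interpret M: product_sigma_finite "\<lambda>_. M"
    using M prob_space_imp_sigma_finite by (auto simp: product_sigma_finite_def)
  show ?thesis
  proof (rule D.PiM_eqI[OF I, symmetric])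
    show "sets (density (PiM I (\<lambda>_. M)) (\<lambda>\<omega>. \<Prod>i\<in>I. f (\<omega> i))) = sets (PiM I (\<lambda>_. density M f))"
      unfolding sets_density by (intro sets_PiM_cong) auto
  next
    fix A assume A: "\<And>i. i \<in> I \<Longrightarrow> A i \<in> sets (density M f)"
    then have A' [measurable]: "\<And>i. i \<in> I \<Longrightarrow> A i \<in> sets M" by simp
    have "emeasure (density (PiM I (\<lambda>_. M)) (\<lambda>\<omega>. \<Prod>i\<in>I. f (\<omega> i))) (Pi\<^sub>E I A) =
      (\<integral>\<^sup>+\<omega>. (\<Prod>i\<in>I. f (\<omega> i)) * indicator (Pi\<^sub>E I A) \<omega> \<partial>PiM I (\<lambda>_. M))"
      using I A' by (intro emeasure_density) (auto intro!: sets_PiM_I_finite borel_measurable_prod_ennreal)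
    also have "\<dots> = (\<integral>\<^sup>+\<omega>. (\<Prod>i\<in>I. f (\<omega> i) * indicator (A i) (\<omega> i)) \<partial>PiM I (\<lambda>_. M))"
    proof (rule nn_integral_cong)
      fix \<omega> assume "\<omega> \<in> space (PiM I (\<lambda>_. M))"
      then have ext: "\<omega> \<in> extensional I" by (simp add: space_PiM PiE_def)
      have "indicator (Pi\<^sub>E I A) \<omega> = (\<Prod>i\<in>I. indicator (A i) (\<omega> i) :: ennreal)"
        using I ext by (cases "\<forall>i\<in>I. \<omega> i \<in> A i")
          (auto simp: indicator_def PiE_def Pi_def prod_zero_iff intro!: prod_zero[symmetric])
      then show "(\<Prod>i\<in>I. f (\<omega> i)) * indicator (Pi\<^sub>E I A) \<omega> = (\<Prod>i\<in>I. f (\<omega> i) * indicator (A i) (\<omega> i))"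
        by (simp add: prod.distrib)
    qed
    also have "\<dots> = (\<Prod>i\<in>I. \<integral>\<^sup>+\<omega>. f \<omega> * indicator (A i) \<omega> \<partial>M)"
      using I A' by (intro M.product_nn_integral_prod) auto
    also have "\<dots> = (\<Prod>i\<in>I. emeasure (density M f) (A i))"
      using A' by (intro prod.cong refl emeasure_density[symmetric]) auto
    finally show "emeasure (density (PiM I (\<lambda>_. M)) (\<lambda>\<omega>. \<Prod>i\<in>I. f (\<omega> i))) (Pi\<^sub>E I A) =
      (\<Prod>i\<in>I. emeasure (density M f) (A i))" .
  qed
qed

lemma nn_integral_gauss_columns_exp_sum:
  assumes [measurable]: "h \<in> borel_measurable (borel_vec n)"
  shows "(\<integral>\<^sup>+Y. ennreal (exp (\<Sum>k<N. h (Y k))) \<partial>gauss_columns n N) =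
    (\<integral>\<^sup>+g. ennreal (exp (h g)) \<partial>std_gauss n) ^ N"
proof -
  interpret product_sigma_finite "\<lambda>_. std_gauss n" by (rule product_sigma_finite_std_gauss)
  have "(\<integral>\<^sup>+Y. ennreal (exp (\<Sum>k<N. h (Y k))) \<partial>gauss_columns n N) =
    (\<integral>\<^sup>+Y. (\<Prod>k<N. ennreal (exp (h (Y k)))) \<partial>gauss_columns n N)"
    by (simp add: exp_sum prod_ennreal)
  also have "\<dots> = (\<integral>\<^sup>+g. ennreal (exp (h g)) \<partial>std_gauss n) ^ N"
    by (subst product_nn_integral_prod) auto
  finally show ?thesis .
qed

section \<open>The likelihood ratio and the concentration of the energy\<close>

definition energy :: "nat \<Rightarrow> nat \<Rightarrow> (nat \<Rightarrow> real) \<Rightarrow> (nat \<Rightarrow> nat \<Rightarrow> real) \<Rightarrow> real" where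
  "energy n N x Y = (\<Sum>k<N. (vec_inner n x (Y k))\<^sup>2)"

text \<open>The density of N independent columns of covariance I + \<beta> x x^T against standard
  ones. The determinant is 1 + \<beta> s and the inverse is I - \<beta>/(1 + \<beta> s) x x^T, hence
  the data enter only through the energy.\<close>

definition likelihood :: "nat \<Rightarrow> nat \<Rightarrow> real \<Rightarrow> (nat \<Rightarrow> real) \<Rightarrow> (nat \<Rightarrow> nat \<Rightarrow> real) \<Rightarrow> real" where
  "likelihood n N \<beta> x Y =
     (let s = vec_inner n x x in exp (\<beta> / (2 * (1 + \<beta> * s)) * energy n N x Y - real N * (ln (1 + \<beta> * s) / 2)))"

text \<open>Under the spiked law of the columns, the energy has mean \<open>N s (1 + \<beta> s)\<close>.\<close>

definition typical :: "nat \<Rightarrow> nat \<Rightarrow> real \<Rightarrow> real \<Rightarrow> (nat \<Rightarrow> real) \<Rightarrow> (nat \<Rightarrow> nat \<Rightarrow> real) \<Rightarrow> bool" where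
  "typical n N \<beta> \<delta> x Y \<longleftrightarrow>
     (let s = vec_inner n x x in \<bar>energy n N x Y - real N * (s * (1 + \<beta> * s))\<bar> \<le> \<delta> * real N)"

definition trunc_likelihood ::
  "nat \<Rightarrow> nat \<Rightarrow> real \<Rightarrow> real \<Rightarrow> (nat \<Rightarrow> real) \<Rightarrow> (nat \<Rightarrow> nat \<Rightarrow> real) \<Rightarrow> real" where
  "trunc_likelihood n N \<beta> \<delta> x Y = (if typical n N \<beta> \<delta> x Y then likelihood n N \<beta> x Y else 0)"

lemma measurable_energy [measurable]:
  assumes [measurable]: "f \<in> M \<rightarrow>\<^sub>M borel_vec n" "g \<in> M \<rightarrow>\<^sub>M borel_columns n N"
  shows "(\<lambda>z. energy n N (f z) (g z)) \<in> borel_measurable M"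
  unfolding energy_def by measurable

lemma measurable_likelihood [measurable]:
  assumes [measurable]: "f \<in> M \<rightarrow>\<^sub>M borel_vec n" "g \<in> M \<rightarrow>\<^sub>M borel_columns n N"
  shows "(\<lambda>z. likelihood n N \<beta> (f z) (g z)) \<in> borel_measurable M"
  unfolding likelihood_def Let_def by measurable

lemma measurable_typical [measurable]:
  assumes [measurable]: "f \<in> M \<rightarrow>\<^sub>M borel_vec n" "g \<in> M \<rightarrow>\<^sub>M borel_columns n N"
  shows "Measurable.pred M (\<lambda>z. typical n N \<beta> \<delta> (f z) (g z))"
  unfolding typical_def Let_def by measurable

lemma measurable_trunc_likelihood [measurable]:
  assumes [measurable]: "f \<in> M \<rightarrow>\<^sub>M borel_vec n" "g \<in> M \<rightarrow>\<^sub>M borel_columns n N"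
  shows "(\<lambda>z. trunc_likelihood n N \<beta> \<delta> (f z) (g z)) \<in> borel_measurable M"
  unfolding trunc_likelihood_def by measurable

lemma likelihood_eq_sum:
  assumes "s = vec_inner n x x"
  shows "likelihood n N \<beta> x Y =
    exp (\<Sum>k<N. \<beta> / (2 * (1 + \<beta> * s)) * (vec_inner n x (Y k))\<^sup>2 - ln (1 + \<beta> * s) / 2)"
  using assms by (simp add: likelihood_def Let_def energy_def sum_subtractf sum_distrib_left)

lemma exp_half_ln: "0 < (y::real) \<Longrightarrow> exp (- (ln y / 2)) = 1 / sqrt y"
  by (simp add: exp_minus ln_sqrt[symmetric] inverse_eq_divide)

text \<open>Strict positivity of 1 + \<beta> s makes the spiked covariance invertible, so that a
  density exists: one column has it by the rank-one change of variables, and independence multiplies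
  it up.\<close>

lemma emeasure_spiked_columns:
  fixes \<beta> :: real
  assumes x: "x \<in> {..<n} \<rightarrow>\<^sub>E UNIV" and s: "s = vec_inner n x x" "s > 0" and \<beta>: "1 + \<beta> * s > 0"
    and B [measurable]: "B \<in> sets (borel_columns n N)"
  shows "emeasure (PiM {..<N} (\<lambda>_. gaussian_vec n (spiked_cov \<beta> x))) B =
    (\<integral>\<^sup>+Y. ennreal (likelihood n N \<beta> x Y) * indicator B Y \<partial>gauss_columns n N)"
proof -
  define f where "f g = \<beta> / (2 * (1 + \<beta> * s)) * (vec_inner n x g)\<^sup>2 - ln (1 + \<beta> * s) / 2" for g
  have xm [measurable]: "x \<in> space (borel_vec n)" using x by (simp add: space_PiM)
  have f_meas [measurable]: "f \<in> borel_measurable (borel_vec n)" unfolding f_def by measurable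
  have f_exp: "exp (f g) = exp (\<beta> / (2 * (1 + \<beta> * s)) * (vec_inner n x g)\<^sup>2) / sqrt (1 + \<beta> * s)" for g
    unfolding f_def diff_conv_add_uminus exp_add exp_half_ln[OF \<beta>] by simp
  have eq: "gaussian_vec n (spiked_cov \<beta> x) = density (std_gauss n) (\<lambda>g. ennreal (exp (f g)))"
  proof (rule measure_eqI)
    show "sets (gaussian_vec n (spiked_cov \<beta> x)) = sets (density (std_gauss n) (\<lambda>g. ennreal (exp (f g))))"
      by (simp add: gaussian_vec_def sets_std_gauss)
    fix A assume "A \<in> sets (gaussian_vec n (spiked_cov \<beta> x))"
    then have A [measurable]: "A \<in> sets (borel_vec n)" by (simp add: gaussian_vec_def)
    let ?S = "rank_one_shift n ((sqrt (1 + \<beta> * s) - 1) / s) x"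
    have "emeasure (gaussian_vec n (spiked_cov \<beta> x)) A = (\<integral>\<^sup>+g. indicator A g \<partial>distr (std_gauss n) (borel_vec n) ?S)"
      using \<beta> s by (subst gaussian_vec_spiked_cov[of s]) auto
    also have "\<dots> = (\<integral>\<^sup>+g. indicator A (?S g) \<partial>std_gauss n)"
      by (intro nn_integral_distr) measurable
    also have "\<dots> = (\<integral>\<^sup>+g. ennreal (exp (f g)) * indicator A g \<partial>std_gauss n)"
      unfolding f_exp by (rule nn_integral_rank_one_shift[OF x s \<beta>]) measurable
    also have "\<dots> = emeasure (density (std_gauss n) (\<lambda>g. ennreal (exp (f g)))) A"
      by (rule emeasure_density[symmetric]) measurable
    finally show "emeasure (gaussian_vec n (spiked_cov \<beta> x)) A =
      emeasure (density (std_gauss n) (\<lambda>g. ennreal (exp (f g)))) A" .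
  qed
  have "prob_space (gaussian_vec n (spiked_cov \<beta> x))"
    using \<beta> s by (subst gaussian_vec_spiked_cov[of s]) (auto intro!: prob_space.prob_space_distr prob_space_std_gauss)
  then have "PiM {..<N} (\<lambda>_. gaussian_vec n (spiked_cov \<beta> x)) =
      density (gauss_columns n N) (\<lambda>Y. \<Prod>k<N. ennreal (exp (f (Y k))))"
    unfolding eq by (intro PiM_density_const prob_space_std_gauss) auto
  also have "(\<lambda>Y. \<Prod>k<N. ennreal (exp (f (Y k)))) = (\<lambda>Y. ennreal (likelihood n N \<beta> x Y))"
    by (simp add: likelihood_eq_sum[OF s(1)] exp_sum prod_ennreal f_def)
  finally show ?thesis by (simp add: emeasure_density)
qed

lemma minus_half_ln_le:
  fixes y :: real
  assumes "\<bar>y\<bar> \<le> 1 / 4"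
  shows "- (ln (1 - 2 * y) / 2) \<le> y + 4 * y\<^sup>2"
proof -
  have "\<bar>ln (1 + - 2 * y) - - 2 * y\<bar> \<le> 2 * (- 2 * y)\<^sup>2"
    by (rule abs_ln_one_plus_x_minus_x_bound) (use assms in \<open>simp add: abs_mult\<close>)
  then have "- (2 * y) - ln (1 - 2 * y) \<le> 8 * y\<^sup>2" by (simp add: power_mult_distrib abs_le_iff)
  then show ?thesis by simp
qed

text \<open>Under the spiked law <x, Y k> is Gaussian with variance v = s (1 + \<beta> s). The left
  side is thus the Laplace transform of v times a chi-square variable with N degrees of freedom, and
  the quadratic bound on its logarithm is inserted.\<close>

lemma nn_integral_likelihood_tilt:
  fixes \<beta> :: real
  assumes x: "x \<in> {..<n} \<rightarrow>\<^sub>E UNIV" and s: "s = vec_inner n x x" "s > 0" and \<beta>: "1 + \<beta> * s > 0"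
    and \<theta>: "\<bar>\<theta>\<bar> * (s * (1 + \<beta> * s)) \<le> 1 / 4"
  shows "(\<integral>\<^sup>+Y. ennreal (likelihood n N \<beta> x Y * exp (\<theta> * energy n N x Y)) \<partial>gauss_columns n N)
    \<le> ennreal (exp (real N * (\<theta> * (s * (1 + \<beta> * s)) + 4 * (\<theta> * (s * (1 + \<beta> * s)))\<^sup>2)))"
proof -
  define v where "v = s * (1 + \<beta> * s)"
  define a where "a = \<beta> / (2 * (1 + \<beta> * s)) + \<theta>"
  have xm [measurable]: "x \<in> space (borel_vec n)" using x by (simp add: space_PiM)
  have v: "v > 0" using s \<beta> by (simp add: v_def)
  have \<theta>v: "\<bar>\<theta> * v\<bar> \<le> 1 / 4" 
  proof -
    have "\<bar>\<theta> * v\<bar> = \<bar>\<theta>\<bar> * v" using v by (simp add: abs_mult)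
    then show ?thesis using \<theta> by (simp add: v_def)
  qed
  have as: "1 - 2 * a * s = (1 - 2 * (\<theta> * v)) / (1 + \<beta> * s)"
    using \<beta> by (simp add: a_def v_def field_simps)
  have as1: "2 * a * s < 1"
    using \<theta>v \<beta> as divide_pos_pos[of "1 - 2 * (\<theta> * v)" "1 + \<beta> * s"] by linarith
  have "(\<integral>\<^sup>+Y. ennreal (likelihood n N \<beta> x Y * exp (\<theta> * energy n N x Y)) \<partial>gauss_columns n N) =
    (\<integral>\<^sup>+Y. ennreal (exp (\<Sum>k<N. a * (vec_inner n x (Y k))\<^sup>2 - ln (1 + \<beta> * s) / 2)) \<partial>gauss_columns n N)"
    unfolding likelihood_eq_sum[OF s(1)] exp_add[symmetric] energy_def sum_distrib_left sum.distrib[symmetric]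
    by (intro nn_integral_cong) (simp add: a_def algebra_simps)
  also have "\<dots> = (\<integral>\<^sup>+g. ennreal (exp (a * (vec_inner n x g)\<^sup>2 - ln (1 + \<beta> * s) / 2)) \<partial>std_gauss n) ^ N"
    by (rule nn_integral_gauss_columns_exp_sum) measurable
  also have "(\<integral>\<^sup>+g. ennreal (exp (a * (vec_inner n x g)\<^sup>2 - ln (1 + \<beta> * s) / 2)) \<partial>std_gauss n) =
    (\<integral>\<^sup>+g. ennreal (exp (- (ln (1 + \<beta> * s) / 2))) * ennreal (exp (a * (vec_inner n x g)\<^sup>2)) \<partial>std_gauss n)"
    by (intro nn_integral_cong) (simp add: ennreal_mult[symmetric] exp_add[symmetric])
  also have "\<dots> = ennreal (exp (- (ln (1 + \<beta> * s) / 2))) * ennreal (1 / sqrt (1 - 2 * a * s))"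
    by (subst nn_integral_cmult) (auto simp: nn_integral_exp_inner_sq[OF x s(1) as1])
  also have "\<dots> = ennreal (exp (- (ln (1 - 2 * (\<theta> * v)) / 2)))"
    using \<beta> \<theta>v unfolding exp_half_ln[OF \<beta>] as
    by (simp add: ennreal_mult[symmetric] exp_half_ln real_sqrt_divide)
  also have "\<dots> ^ N = ennreal (exp (real N * (- (ln (1 - 2 * (\<theta> * v)) / 2))))"
    by (simp only: ennreal_power exp_ge_zero exp_of_nat_mult)
  also have "\<dots> \<le> ennreal (exp (real N * (\<theta> * v + 4 * (\<theta> * v)\<^sup>2)))"
    by (intro ennreal_leI) (simp only: exp_le_cancel_iff, intro mult_left_mono minus_half_ln_le \<theta>v, simp)
  finally show ?thesis by (simp add: v_def)
qed

text \<open>A two-sided Chernoff bound with tilts \<theta> and -\<theta>. The condition 8 \<theta>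
  \<open>V\<^sup>2\<close> \<le> \<delta> makes the second-order term at most half of the gain
  \<theta> \<delta>. Bounding v by V allows one \<theta> for all spikes.\<close>

lemma nn_integral_likelihood_atypical:
  fixes \<beta> :: real
  assumes x: "x \<in> {..<n} \<rightarrow>\<^sub>E UNIV" and s: "s = vec_inner n x x" "s > 0" and \<beta>: "1 + \<beta> * s > 0"
    and v: "s * (1 + \<beta> * s) \<le> V" and \<theta>: "\<theta> > 0" "\<theta> * V \<le> 1 / 4" "8 * \<theta> * V\<^sup>2 \<le> \<delta>"
  shows "(\<integral>\<^sup>+Y. ennreal (if typical n N \<beta> \<delta> x Y then 0 else likelihood n N \<beta> x Y) \<partial>gauss_columns n N)
    \<le> ennreal (2 * exp (- (real N * (\<theta> * \<delta> / 2))))"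
proof -
  define v where "v = s * (1 + \<beta> * s)"
  have xm [measurable]: "x \<in> space (borel_vec n)" using x by (simp add: space_PiM)
  have v0: "v > 0" "v \<le> V" using s \<beta> v by (simp_all add: v_def)
  define E where "E = energy n N x"
  define T where "T \<eta> = (\<integral>\<^sup>+Y. ennreal (likelihood n N \<beta> x Y * exp (\<eta> * E Y)) \<partial>gauss_columns n N)" for \<eta>
  have [measurable]: "E \<in> borel_measurable (borel_columns n N)" unfolding E_def by measurable
  have \<theta>v: "\<theta> * v \<le> 1 / 4" using mult_left_mono[OF v0(2), of \<theta>] \<theta> by linarith
  have lik0: "likelihood n N \<beta> x Y \<ge> 0" for Y by (simp add: likelihood_def Let_def)
  have T: "ennreal (exp (- \<eta> * real N * v - real N * (\<theta> * \<delta>))) * T \<eta> \<le> ennreal (exp (- (real N * (\<theta> * \<delta> / 2))))"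
    if \<eta>: "\<bar>\<eta>\<bar> = \<theta>" for \<eta>
  proof -
    have "T \<eta> \<le> ennreal (exp (real N * (\<eta> * v + 4 * (\<eta> * v)\<^sup>2)))"
      unfolding T_def E_def v_def
      by (rule nn_integral_likelihood_tilt[OF x s \<beta>])
         (use \<eta> \<theta>v in \<open>simp add: v_def\<close>)
    then have "ennreal (exp (- \<eta> * real N * v - real N * (\<theta> * \<delta>))) * T \<eta> \<le>
      ennreal (exp (- \<eta> * real N * v - real N * (\<theta> * \<delta>))) * ennreal (exp (real N * (\<eta> * v + 4 * (\<eta> * v)\<^sup>2)))"
      by (rule mult_left_mono) simp
    also have "\<dots> = ennreal (exp (real N * (4 * (\<eta> * v)\<^sup>2 - \<theta> * \<delta>)))"
      by (simp add: ennreal_mult[symmetric] exp_add[symmetric] algebra_simps)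
    also have "\<dots> \<le> ennreal (exp (- (real N * (\<theta> * \<delta> / 2))))"
    proof -
      have "(\<eta> * v)\<^sup>2 = \<theta>\<^sup>2 * v\<^sup>2" by (simp add: power_mult_distrib flip: \<eta>)
      also have "\<dots> \<le> \<theta>\<^sup>2 * V\<^sup>2" using v0 by (intro mult_left_mono power_mono) auto
      finally have "4 * (\<eta> * v)\<^sup>2 \<le> \<theta> * (8 * \<theta> * V\<^sup>2) / 2" by (simp add: power2_eq_square algebra_simps)
      also have "\<dots> \<le> \<theta> * \<delta> / 2" using \<theta> by (intro divide_right_mono mult_left_mono) auto
      finally have "4 * (\<eta> * v)\<^sup>2 - \<theta> * \<delta> \<le> - (\<theta> * \<delta> / 2)" by simp
      then have "real N * (4 * (\<eta> * v)\<^sup>2 - \<theta> * \<delta>) \<le> real N * - (\<theta> * \<delta> / 2)" by (intro mult_left_mono) auto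
      then show ?thesis by (intro ennreal_leI) simp
    qed
    finally show ?thesis .
  qed
  have "(\<integral>\<^sup>+Y. ennreal (if typical n N \<beta> \<delta> x Y then 0 else likelihood n N \<beta> x Y) \<partial>gauss_columns n N) \<le>
    (\<integral>\<^sup>+Y. ennreal (exp (- \<theta> * real N * v - real N * (\<theta> * \<delta>))) * ennreal (likelihood n N \<beta> x Y * exp (\<theta> * E Y))
     + ennreal (exp (- (- \<theta>) * real N * v - real N * (\<theta> * \<delta>))) * ennreal (likelihood n N \<beta> x Y * exp (- \<theta> * E Y))
     \<partial>gauss_columns n N)"
  proof (rule nn_integral_mono)
    fix Y
    let ?L = "likelihood n N \<beta> x Y"
    \<comment> \<open>When the energy is atypical, one of the two exponentials is at least
      1.\<close>
    have "(if typical n N \<beta> \<delta> x Y then 0 else ?L) \<le>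
      ?L * exp (\<theta> * (E Y - real N * v - \<delta> * real N)) + ?L * exp (- \<theta> * (E Y - real N * v + \<delta> * real N))"
    proof (cases "typical n N \<beta> \<delta> x Y")
      case False
      then have "E Y - real N * v - \<delta> * real N \<ge> 0 \<or> - (E Y - real N * v + \<delta> * real N) \<ge> 0"
        using s by (auto simp: typical_def Let_def E_def v_def)
      then have "1 \<le> exp (\<theta> * (E Y - real N * v - \<delta> * real N)) \<or> 1 \<le> exp (- \<theta> * (E Y - real N * v + \<delta> * real N))"
        using \<theta> by (auto simp: mult_le_0_iff)
      then have "1 \<le> exp (\<theta> * (E Y - real N * v - \<delta> * real N)) + exp (- \<theta> * (E Y - real N * v + \<delta> * real N))"
        by (auto intro: add_increasing add_increasing2)
      from mult_left_mono[OF this lik0[of Y]] show ?thesis using False by (simp add: distrib_left)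
    qed (simp add: lik0)
    also have "\<dots> = exp (- \<theta> * real N * v - real N * (\<theta> * \<delta>)) * (?L * exp (\<theta> * E Y)) +
       exp (- (- \<theta>) * real N * v - real N * (\<theta> * \<delta>)) * (?L * exp (- \<theta> * E Y))"
    proof -
      have "exp (\<theta> * (E Y - real N * v - \<delta> * real N)) = exp (- \<theta> * real N * v - real N * (\<theta> * \<delta>)) * exp (\<theta> * E Y)"
           "exp (- \<theta> * (E Y - real N * v + \<delta> * real N)) = exp (- (- \<theta>) * real N * v - real N * (\<theta> * \<delta>)) * exp (- \<theta> * E Y)"
        unfolding exp_add[symmetric] by (simp_all add: algebra_simps)
      then show ?thesis by (simp only: mult_ac)
    qed
    finally show "ennreal (if typical n N \<beta> \<delta> x Y then 0 else ?L) \<le>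
      ennreal (exp (- \<theta> * real N * v - real N * (\<theta> * \<delta>))) * ennreal (likelihood n N \<beta> x Y * exp (\<theta> * E Y))
     + ennreal (exp (- (- \<theta>) * real N * v - real N * (\<theta> * \<delta>))) * ennreal (likelihood n N \<beta> x Y * exp (- \<theta> * E Y))"
      using lik0[of Y] by (simp add: ennreal_mult[symmetric] ennreal_plus[symmetric] ennreal_leI del: ennreal_plus)
  qed
  also have "\<dots> = ennreal (exp (- \<theta> * real N * v - real N * (\<theta> * \<delta>))) * T \<theta> +
      ennreal (exp (- (- \<theta>) * real N * v - real N * (\<theta> * \<delta>))) * T (- \<theta>)"
    unfolding T_def by (subst nn_integral_add, measurable, subst (1 2) nn_integral_cmult) auto
  also have "\<dots> \<le> ennreal (exp (- (real N * (\<theta> * \<delta> / 2)))) + ennreal (exp (- (real N * (\<theta> * \<delta> / 2))))"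
    by (intro add_mono T) (use \<theta> in auto)
  also have "\<dots> = ennreal (2 * exp (- (real N * (\<theta> * \<delta> / 2))))"
    by (simp add: ennreal_plus[symmetric] del: ennreal_plus)
  finally show ?thesis .
qed

section \<open>Second moments for a pair of spikes\<close>

definition tilt_det :: "real \<Rightarrow> real \<Rightarrow> real \<Rightarrow> real \<Rightarrow> real" where
  "tilt_det a s r t = (1 - 2 * a * s) * (1 - 2 * a * r) - 4 * a\<^sup>2 * t\<^sup>2"

text \<open>The cost per column of changing the exponent of one likelihood from \<beta>/(2(1 +
  \<beta> s)) to a: its normalisation, the difference of exponents times the typical energy per
  column, and an error proportional to the width \<delta> of the truncation.\<close>

definition side_rate :: "real \<Rightarrow> real \<Rightarrow> real \<Rightarrow> real \<Rightarrow> real" where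
  "side_rate \<beta> \<delta> a s =
     - (ln (1 + \<beta> * s) / 2) + (\<beta> / (2 * (1 + \<beta> * s)) - a) * (s * (1 + \<beta> * s))
     + \<bar>\<beta> / (2 * (1 + \<beta> * s)) - a\<bar> * \<delta>"

definition overlap_exponent :: "real \<Rightarrow> real \<Rightarrow> real \<Rightarrow> real \<Rightarrow> real \<Rightarrow> real \<Rightarrow> real" where
  "overlap_exponent \<beta> \<delta> a s r t =
     side_rate \<beta> \<delta> a s + side_rate \<beta> \<delta> a r - ln (tilt_det a s r t) / 2"

lemma trunc_likelihood_nonneg: "0 \<le> trunc_likelihood n N \<beta> \<delta> x Y"
  by (simp add: trunc_likelihood_def likelihood_def Let_def)

lemma trunc_likelihood_le_likelihood: "trunc_likelihood n N \<beta> \<delta> x Y \<le> likelihood n N \<beta> x Y"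
  by (simp add: trunc_likelihood_def likelihood_def Let_def)

text \<open>On the truncation event the energy may be replaced by its typical value up to \<delta> N
  in the term with the difference of exponents; off the event the left side is 0. The bound
  therefore holds for every Y and every a, and a is free to be optimised.\<close>

lemma trunc_likelihood_le:
  fixes \<beta> a :: real
  assumes s: "s = vec_inner n x x"
  shows "trunc_likelihood n N \<beta> \<delta> x Y \<le> exp (a * energy n N x Y + real N * side_rate \<beta> \<delta> a s)"
proof (cases "typical n N \<beta> \<delta> x Y")
  case True
  define \<kappa> where "\<kappa> = \<beta> / (2 * (1 + \<beta> * s))"
  define v where "v = s * (1 + \<beta> * s)"
  have "\<bar>energy n N x Y - real N * v\<bar> \<le> \<delta> * real N"
    using True s by (simp add: typical_def Let_def v_def)
  then have "\<bar>\<kappa> - a\<bar> * \<bar>energy n N x Y - real N * v\<bar> \<le> \<bar>\<kappa> - a\<bar> * (\<delta> * real N)"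
    by (rule mult_left_mono) simp
  moreover have "(\<kappa> - a) * (energy n N x Y - real N * v) \<le> \<bar>\<kappa> - a\<bar> * \<bar>energy n N x Y - real N * v\<bar>"
    unfolding abs_mult[symmetric] by simp
  ultimately have "(\<kappa> - a) * (energy n N x Y - real N * v) \<le> \<bar>\<kappa> - a\<bar> * (\<delta> * real N)" by simp
  then have "\<kappa> * energy n N x Y - real N * (ln (1 + \<beta> * s) / 2) \<le>
    a * energy n N x Y + real N * (- (ln (1 + \<beta> * s) / 2) + (\<kappa> - a) * v + \<bar>\<kappa> - a\<bar> * \<delta>)"
    by (simp add: algebra_simps)
  then show ?thesis
    using True by (simp add: trunc_likelihood_def likelihood_def Let_def side_rate_def s \<kappa>_def v_def)
qed (simp add: trunc_likelihood_def)

lemma nn_integral_trunc_likelihood_pair_le: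
  fixes \<beta> a :: real
  assumes x: "x \<in> {..<n} \<rightarrow>\<^sub>E UNIV" and y: "y \<in> {..<n} \<rightarrow>\<^sub>E UNIV"
    and s: "s = vec_inner n x x" "s > 0" and r: "r = vec_inner n y y" and t: "t = vec_inner n x y"
    and a: "2 * a * s < 1" and D: "tilt_det a s r t > 0"
  shows "(\<integral>\<^sup>+Y. ennreal (trunc_likelihood n N \<beta> \<delta> x Y * trunc_likelihood n N \<beta> \<delta> y Y) \<partial>gauss_columns n N)
    \<le> ennreal (exp (real N * overlap_exponent \<beta> \<delta> a s r t))"
proof -
  have xm [measurable]: "x \<in> space (borel_vec n)" "y \<in> space (borel_vec n)" using x y by (auto simp: space_PiM)
  define C where "C = side_rate \<beta> \<delta> a s + side_rate \<beta> \<delta> a r"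
  have D': "tilt_det a s r t = (1 - 2 * a * s) * (1 - 2 * a * r) - 4 * a * a * t\<^sup>2"
    by (simp add: tilt_det_def power2_eq_square)
  have "(\<integral>\<^sup>+Y. ennreal (trunc_likelihood n N \<beta> \<delta> x Y * trunc_likelihood n N \<beta> \<delta> y Y) \<partial>gauss_columns n N) \<le>
    (\<integral>\<^sup>+Y. ennreal (exp (\<Sum>k<N. a * (vec_inner n x (Y k))\<^sup>2 + a * (vec_inner n y (Y k))\<^sup>2 + C)) \<partial>gauss_columns n N)"
  proof (rule nn_integral_mono, rule ennreal_leI)
    fix Y
    have "trunc_likelihood n N \<beta> \<delta> x Y * trunc_likelihood n N \<beta> \<delta> y Y \<le>
      exp (a * energy n N x Y + real N * side_rate \<beta> \<delta> a s) * exp (a * energy n N y Y + real N * side_rate \<beta> \<delta> a r)"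
      by (intro mult_mono trunc_likelihood_le s r trunc_likelihood_nonneg) auto
    also have "\<dots> = exp (\<Sum>k<N. a * (vec_inner n x (Y k))\<^sup>2 + a * (vec_inner n y (Y k))\<^sup>2 + C)"
      by (simp add: exp_add[symmetric] energy_def sum.distrib sum_distrib_left C_def algebra_simps)
    finally show "trunc_likelihood n N \<beta> \<delta> x Y * trunc_likelihood n N \<beta> \<delta> y Y \<le>
      exp (\<Sum>k<N. a * (vec_inner n x (Y k))\<^sup>2 + a * (vec_inner n y (Y k))\<^sup>2 + C)" .
  qed
  also have "\<dots> = (\<integral>\<^sup>+g. ennreal (exp (a * (vec_inner n x g)\<^sup>2 + a * (vec_inner n y g)\<^sup>2 + C)) \<partial>std_gauss n) ^ N"
    by (rule nn_integral_gauss_columns_exp_sum) measurable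
  also have "(\<integral>\<^sup>+g. ennreal (exp (a * (vec_inner n x g)\<^sup>2 + a * (vec_inner n y g)\<^sup>2 + C)) \<partial>std_gauss n) =
    (\<integral>\<^sup>+g. ennreal (exp C) * ennreal (exp (a * (vec_inner n x g)\<^sup>2 + a * (vec_inner n y g)\<^sup>2)) \<partial>std_gauss n)"
    by (intro nn_integral_cong) (simp add: ennreal_mult[symmetric] exp_add[symmetric] algebra_simps)
  also have "\<dots> = ennreal (exp C) * ennreal (1 / sqrt (tilt_det a s r t))"
    by (subst nn_integral_cmult) (auto simp: nn_integral_exp_inner_sq_pair[OF x y s r t a D' D])
  also have "\<dots> = ennreal (exp (overlap_exponent \<beta> \<delta> a s r t))"
    by (simp add: exp_half_ln[OF D, symmetric] ennreal_mult[symmetric] exp_add[symmetric] C_def overlap_exponent_def)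
  also have "\<dots> ^ N = ennreal (exp (real N * overlap_exponent \<beta> \<delta> a s r t))"
    by (simp add: ennreal_power exp_of_nat_mult)
  finally show ?thesis .
qed

text \<open>With the untouched exponents of both likelihoods, the normalisations cancel the factors
  1 + \<beta> s and 1 + \<beta> r of the determinant. The result depends on the overlap alone and is
  exact, which is what small overlaps require.\<close>

lemma nn_integral_likelihood_pair:
  fixes \<beta> :: real
  assumes x: "x \<in> {..<n} \<rightarrow>\<^sub>E UNIV" and y: "y \<in> {..<n} \<rightarrow>\<^sub>E UNIV"
    and s: "s = vec_inner n x x" "s > 0" and r: "r = vec_inner n y y" and t: "t = vec_inner n x y"
    and \<beta>: "1 + \<beta> * s > 0" "1 + \<beta> * r > 0" and bt: "\<beta>\<^sup>2 * t\<^sup>2 < 1"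
  shows "(\<integral>\<^sup>+Y. ennreal (likelihood n N \<beta> x Y * likelihood n N \<beta> y Y) \<partial>gauss_columns n N)
    = ennreal (exp (real N * - (ln (1 - \<beta>\<^sup>2 * t\<^sup>2) / 2)))"
proof -
  have xm [measurable]: "x \<in> space (borel_vec n)" "y \<in> space (borel_vec n)" using x y by (auto simp: space_PiM)
  define a where "a = \<beta> / (2 * (1 + \<beta> * s))"
  define b where "b = \<beta> / (2 * (1 + \<beta> * r))"
  define C where "C = - (ln (1 + \<beta> * s) / 2) - ln (1 + \<beta> * r) / 2"
  define D where "D = (1 - 2 * a * s) * (1 - 2 * b * r) - 4 * a * b * t\<^sup>2"
  have as: "1 - 2 * a * s = 1 / (1 + \<beta> * s)" using \<beta> by (simp add: a_def field_simps)
  have br: "1 - 2 * b * r = 1 / (1 + \<beta> * r)" using \<beta> by (simp add: b_def field_simps)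
  have D': "D = (1 - \<beta>\<^sup>2 * t\<^sup>2) / ((1 + \<beta> * s) * (1 + \<beta> * r))"
  proof -
    have "4 * (\<beta> / (2 * p)) * (\<beta> / (2 * q)) = \<beta>\<^sup>2 / (p * q)" for p q by (simp add: power2_eq_square)
    then have "4 * a * b = \<beta>\<^sup>2 / ((1 + \<beta> * s) * (1 + \<beta> * r))" unfolding a_def b_def .
    then show ?thesis unfolding D_def as br by (simp add: diff_divide_distrib)
  qed
  have D_pos: "D > 0" unfolding D' using \<beta> bt by simp
  have as1: "2 * a * s < 1" using as \<beta> divide_pos_pos[of 1 "1 + \<beta> * s"] by linarith
  have "(\<integral>\<^sup>+Y. ennreal (likelihood n N \<beta> x Y * likelihood n N \<beta> y Y) \<partial>gauss_columns n N) =
    (\<integral>\<^sup>+Y. ennreal (exp (\<Sum>k<N. a * (vec_inner n x (Y k))\<^sup>2 + b * (vec_inner n y (Y k))\<^sup>2 + C)) \<partial>gauss_columns n N)"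
    unfolding likelihood_eq_sum[OF s(1)] likelihood_eq_sum[OF r] exp_add[symmetric] sum.distrib[symmetric]
    by (intro nn_integral_cong) (simp add: a_def b_def C_def algebra_simps)
  also have "\<dots> = (\<integral>\<^sup>+g. ennreal (exp (a * (vec_inner n x g)\<^sup>2 + b * (vec_inner n y g)\<^sup>2 + C)) \<partial>std_gauss n) ^ N"
    by (rule nn_integral_gauss_columns_exp_sum) measurable
  also have "(\<integral>\<^sup>+g. ennreal (exp (a * (vec_inner n x g)\<^sup>2 + b * (vec_inner n y g)\<^sup>2 + C)) \<partial>std_gauss n) =
    (\<integral>\<^sup>+g. ennreal (exp C) * ennreal (exp (a * (vec_inner n x g)\<^sup>2 + b * (vec_inner n y g)\<^sup>2)) \<partial>std_gauss n)"
    by (intro nn_integral_cong) (simp add: ennreal_mult[symmetric] exp_add[symmetric] algebra_simps)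
  also have "\<dots> = ennreal (exp C) * ennreal (1 / sqrt D)"
    by (subst nn_integral_cmult) (auto simp: nn_integral_exp_inner_sq_pair[OF x y s r t as1 D_def D_pos])
  also have "\<dots> = ennreal (exp (- (ln (1 - \<beta>\<^sup>2 * t\<^sup>2) / 2)))"
  proof -
    have "C - ln D / 2 = - (ln (1 - \<beta>\<^sup>2 * t\<^sup>2) / 2)"
    proof -
      have "ln D = ln (1 - \<beta>\<^sup>2 * t\<^sup>2) - (ln (1 + \<beta> * s) + ln (1 + \<beta> * r))"
        unfolding D' using \<beta> bt by (simp add: ln_div ln_mult)
      then show ?thesis unfolding C_def by linarith
    qed
    then show ?thesis
      by (simp add: exp_half_ln[OF D_pos, symmetric] ennreal_mult[symmetric] exp_add[symmetric])
  qed
  also have "\<dots> ^ N = ennreal (exp (real N * - (ln (1 - \<beta>\<^sup>2 * t\<^sup>2) / 2)))"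
    by (simp only: ennreal_power exp_ge_zero exp_of_nat_mult)
  finally show ?thesis .
qed

section \<open>The optimal tilt\<close>

text \<open>This is t * sqrt (\<open>A\<^sup>2\<close> + 1) for 0 < t < 1 and the A of the rate
  hypothesis, with the factor t taken inside so that nothing is divided by t.\<close>

definition opt_root :: "real \<Rightarrow> real \<Rightarrow> real" where
  "opt_root \<beta> t = sqrt (t\<^sup>2 + ((1 - t\<^sup>2) / (2 * (1 + \<beta>)))\<^sup>2)"

text \<open>For \<open>0 < t < 1\<close> this is \<open>(w - t) / (2 w (1 - t\<^sup>2))\<close> with \<open>w\<close> the maximiser of the rate;
  the form chosen here has no singularity at \<open>t = 1\<close>.\<close>

definition opt_tilt :: "real \<Rightarrow> real \<Rightarrow> real" where
  "opt_tilt \<beta> t =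
     ((1 - (1 - t\<^sup>2) / (4 * (1 + \<beta>)\<^sup>2)) / (1 + opt_root \<beta> t) - 1 / (2 * (1 + \<beta>))) / 2"

definition opt_exponent :: "real \<Rightarrow> real \<Rightarrow> real" where
  "opt_exponent \<beta> t = overlap_exponent \<beta> 0 (opt_tilt \<beta> t) 1 1 t"

text \<open>The w of the rate hypothesis. For unit x, x' of overlap t in (0, 1), reweight the
  Gaussian by exp (a (\<open><x, g>\<^sup>2\<close> + \<open><x', g>\<^sup>2\<close>)) with a
  optimal: then <x, g> and <x', g> have variance 1 + \<beta> and correlation w.\<close>

definition opt_corr :: "real \<Rightarrow> real \<Rightarrow> real" where
  "opt_corr \<beta> t = (let A = (1 - t\<^sup>2) / (2 * t * (\<beta> + 1)) in sqrt (A\<^sup>2 + 1) - A)"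

lemma opt_root_nonneg: "opt_root \<beta> t \<ge> 0"
  by (simp add: opt_root_def)

text \<open>Everything comes from \<open>w\<^sup>2\<close> + 2 A w = 1. The third identity is the
  stationarity condition of the optimal tilt; the last two express w through quantities that stay
  regular at t = 1.\<close>

lemma opt_corr_props:
  fixes \<beta> t :: real
  assumes \<beta>: "\<beta> > -1" and t: "0 < t" "t < 1"
  defines "w \<equiv> opt_corr \<beta> t"
  shows "0 < w" "w < 1" "(1 - t\<^sup>2) * w = (1 + \<beta>) * t * (1 - w\<^sup>2)"
    "w * (opt_root \<beta> t + (1 - t\<^sup>2) / (2 * (1 + \<beta>))) = t"
    "2 * opt_tilt \<beta> t * w * (1 - t\<^sup>2) = w - t"
proof -
  define A where "A = (1 - t\<^sup>2) / (2 * t * (\<beta> + 1))"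
  define D where "D = 1 - t\<^sup>2"
  have D: "0 < D" using t by (simp add: D_def power_less_one_iff abs_square_less_1)
  have A: "A > 0" using D t \<beta> by (simp add: A_def D_def)
  have w: "w = sqrt (A\<^sup>2 + 1) - A" by (simp add: w_def opt_corr_def A_def Let_def)
  have sA: "sqrt (A\<^sup>2 + 1) * sqrt (A\<^sup>2 + 1) = A\<^sup>2 + 1" by (simp add: add_nonneg_nonneg)
  have w1: "w * (sqrt (A\<^sup>2 + 1) + A) = 1"
    unfolding w using sA by (simp add: power2_eq_square algebra_simps)
  have "sqrt (A\<^sup>2 + 1) > sqrt (A\<^sup>2)" by (simp del: real_sqrt_abs)
  then show w0: "0 < w" using A by (simp add: w)
  have "sqrt (A\<^sup>2 + 1) < A + 1"
    by (rule real_less_lsqrt) (use A in \<open>auto simp: power2_eq_square algebra_simps\<close>)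
  then show "w < 1" by (simp add: w)
  have w2: "1 - w\<^sup>2 = 2 * A * w" unfolding w using sA by (simp add: power2_eq_square algebra_simps)
  have At: "2 * A * t * (1 + \<beta>) = D"
  proof -
    have "2 * t * (\<beta> + 1) \<noteq> 0" using t \<beta> by simp
    then have "A * (2 * t * (\<beta> + 1)) = D" by (simp add: A_def D_def)
    then show ?thesis by (simp add: algebra_simps)
  qed
  show "(1 - t\<^sup>2) * w = (1 + \<beta>) * t * (1 - w\<^sup>2)"
    unfolding w2 D_def[symmetric] At[symmetric] by (simp add: algebra_simps)
  have tA: "t * A = D / (2 * (1 + \<beta>))" 
    using \<beta> At by (subst nonzero_eq_divide_eq) (auto simp: algebra_simps)
  have root: "opt_root \<beta> t = t * sqrt (A\<^sup>2 + 1)"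
  proof -
    have "opt_root \<beta> t = sqrt (t\<^sup>2 * (A\<^sup>2 + 1))"
      unfolding opt_root_def D_def[symmetric] tA[symmetric] by (simp add: power_mult_distrib algebra_simps)
    then show ?thesis using t by (simp add: real_sqrt_mult)
  qed
  have wt: "w * (opt_root \<beta> t + D / (2 * (1 + \<beta>))) = t"
    unfolding root tA[symmetric] using w1 by (simp add: algebra_simps) (metis mult.commute mult.left_commute mult_1_right distrib_left)
  then show "w * (opt_root \<beta> t + (1 - t\<^sup>2) / (2 * (1 + \<beta>))) = t" by (simp add: D_def)
  define B where "B = D / (2 * (1 + \<beta>))"
  define R where "R = opt_root \<beta> t"
  have R: "1 + R > 0" "R\<^sup>2 = (1 - D) + B\<^sup>2"
    using opt_root_nonneg[of \<beta> t] by (simp add: R_def) (simp add: R_def opt_root_def B_def D_def)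
  \<comment> \<open>This factorisation is the origin of \<open>opt_tilt\<close>: the natural formula
    for 2 a is (1 - R - B) / D, and expanding (1 - R) / D by 1 + R removes the division by
    D.\<close>
  have "(1 - D / (4 * (1 + \<beta>)\<^sup>2)) * D = D - B\<^sup>2"
    using \<beta> by (simp add: B_def power_divide power_mult_distrib algebra_simps power2_eq_square)
  also have "\<dots> = (1 - R) * (1 + R)" using R by (simp add: power2_eq_square algebra_simps)
  finally have "(1 - D / (4 * (1 + \<beta>)\<^sup>2)) * D / (1 + R) = 1 - R" using R by simp
  moreover have "2 * opt_tilt \<beta> t = (1 - D / (4 * (1 + \<beta>)\<^sup>2)) / (1 + R) - 1 / (2 * (1 + \<beta>))"
    unfolding opt_tilt_def D_def[symmetric] R_def[symmetric] by (simp only: times_divide_eq_right nonzero_mult_div_cancel_left zero_neq_numeral not_False_eq_True)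
  then have "2 * opt_tilt \<beta> t * D = (1 - D / (4 * (1 + \<beta>)\<^sup>2)) * D / (1 + R) - B"
    by (simp only: left_diff_distrib times_divide_eq_left mult_1_left B_def)
  ultimately have e: "2 * opt_tilt \<beta> t * D = 1 - R - B" by (simp only:)
  have "2 * opt_tilt \<beta> t * D * w = w - w * (R + B)" unfolding e by (simp add: algebra_simps)
  then show "2 * opt_tilt \<beta> t * w * (1 - t\<^sup>2) = w - t"
    using wt by (simp add: R_def B_def D_def mult_ac)
qed

text \<open>The Gram matrix of two unit vectors of overlap t has eigenvalues 1 + t and 1 - t, so the
  determinant is the product of 1 - 2 a (1 + t) and 1 - 2 a (1 - t). Both are positive, and their
  sum gives the first claim.\<close>

lemma opt_tilt_det:
  fixes \<beta> t :: real
  assumes \<beta>: "\<beta> > -1" and t: "0 < t" "t < 1"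
  defines "w \<equiv> opt_corr \<beta> t"
  shows "2 * opt_tilt \<beta> t < 1"
    "tilt_det (opt_tilt \<beta> t) 1 1 t = (1 - t\<^sup>2) / ((1 + \<beta>)\<^sup>2 * (1 - w\<^sup>2))"
proof -
  note w = opt_corr_props[OF \<beta> t, folded w_def]
  define a where "a = opt_tilt \<beta> t"
  have D: "0 < 1 - t\<^sup>2" using t by (simp add: power_less_one_iff abs_square_less_1)
  have w2: "0 < 1 - w\<^sup>2" using w by (simp add: power_less_one_iff abs_square_less_1)
  have a: "2 * a = (w - t) / (w * (1 - t\<^sup>2))" using w D by (simp add: a_def field_simps)
  have D2: "1 - t\<^sup>2 = (1 - t) * (1 + t)" by (simp add: power2_eq_square algebra_simps)
  have om: "1 - y / q = (q - y) / q" if "q \<noteq> 0" for y q :: real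
    using that by (simp add: diff_divide_distrib)
  have f1: "1 - 2 * a * (1 + t) = t * (1 - w) / (w * (1 - t))"
  proof -
    have nz: "w * (1 - t) \<noteq> 0" using t w by simp
    have e: "2 * a * (1 + t) = (w - t) / (w * (1 - t))" unfolding a D2 using t by simp
    have "w * (1 - t) - (w - t) = t * (1 - w)" by (simp add: algebra_simps)
    then show ?thesis unfolding e om[OF nz] by (rule arg_cong)
  qed
  have f2: "1 - 2 * a * (1 - t) = t * (1 + w) / (w * (1 + t))"
  proof -
    have nz: "w * (1 + t) \<noteq> 0" using t w by simp
    have e: "2 * a * (1 - t) = (w - t) / (w * (1 + t))" unfolding a D2 using t by simp
    have "w * (1 + t) - (w - t) = t * (1 + w)" by (simp add: algebra_simps)
    then show ?thesis unfolding e om[OF nz] by (rule arg_cong)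
  qed
  have p1: "1 - 2 * a * (1 + t) > 0" unfolding f1 using t w by simp
  have p2: "1 - 2 * a * (1 - t) > 0" unfolding f2 using t w by simp
  have "(1 - 2 * a * (1 + t)) + (1 - 2 * a * (1 - t)) > 0" using p1 p2 by simp
  then show "2 * opt_tilt \<beta> t < 1" by (simp add: a_def algebra_simps)
  have "tilt_det a 1 1 t = (1 - 2 * a * (1 + t)) * (1 - 2 * a * (1 - t))"
    by (simp add: tilt_det_def power2_eq_square algebra_simps)
  also have "\<dots> = t\<^sup>2 * (1 - w\<^sup>2) / (w\<^sup>2 * (1 - t\<^sup>2))"
    unfolding f1 f2 D2 by (simp add: power2_eq_square algebra_simps)
  also have "\<dots> = (1 - t\<^sup>2) / ((1 + \<beta>)\<^sup>2 * (1 - w\<^sup>2))"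
  proof -
    have "(1 - t\<^sup>2)\<^sup>2 * w\<^sup>2 = (1 + \<beta>)\<^sup>2 * t\<^sup>2 * (1 - w\<^sup>2)\<^sup>2"
      using arg_cong[OF w(3), of power2] by (simp add: power_mult_distrib)
    moreover have "t\<^sup>2 * P / (w\<^sup>2 * Q) = Q / (b\<^sup>2 * P)"
      if "Q\<^sup>2 * w\<^sup>2 = b\<^sup>2 * t\<^sup>2 * P\<^sup>2" "P \<noteq> 0" "Q \<noteq> 0" "b \<noteq> 0" for P Q b :: real
      using that w by (subst frac_eq_eq) (simp_all add: power2_eq_square mult_ac)
    ultimately show ?thesis using D w2 \<beta> by simp
  qed
  finally show "tilt_det (opt_tilt \<beta> t) 1 1 t = (1 - t\<^sup>2) / ((1 + \<beta>)\<^sup>2 * (1 - w\<^sup>2))" by (simp add: a_def)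
qed

section \<open>The optimal exponent as a function of the overlap\<close>

lemma opt_exponent_eq_general:
  assumes "\<beta> > -1"
  shows "opt_exponent \<beta> t =
    - ln (1 + \<beta>) + \<beta> - 2 * opt_tilt \<beta> t * (1 + \<beta>) - ln (tilt_det (opt_tilt \<beta> t) 1 1 t) / 2"
proof -
  have "(\<beta> / (2 * p) - a) * p = \<beta> / 2 - a * p" if "p \<noteq> 0" for a p
    using that by (simp add: left_diff_distrib)
  from this[of "1 + \<beta>"] assms
  have "(\<beta> / (2 * (1 + \<beta>)) - a) * (1 + \<beta>) = \<beta> / 2 - a * (1 + \<beta>)" for a by simp
  then show ?thesis by (simp add: opt_exponent_def overlap_exponent_def side_rate_def)
qed

text \<open>Identifies the exponent of the truncated second moment with the right-hand side of the
  rate hypothesis.\<close>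

lemma opt_exponent_eq:
  fixes \<beta> t :: real
  assumes \<beta>: "\<beta> > -1" and t: "0 < t" "t < 1"
  defines "w \<equiv> opt_corr \<beta> t"
  shows "opt_exponent \<beta> t = (1 + \<beta>) * (t * (w - t) / (1 - t\<^sup>2)) + 1 / 2 * ln ((1 - w\<^sup>2) / (1 - t\<^sup>2))"
proof -
  note w = opt_corr_props[OF \<beta> t, folded w_def]
  note td = opt_tilt_det[OF \<beta> t, folded w_def]
  have D: "0 < 1 - t\<^sup>2" using t by (simp add: power_less_one_iff abs_square_less_1)
  have w2: "0 < 1 - w\<^sup>2" using w by (simp add: power_less_one_iff abs_square_less_1)
  have "ln (tilt_det (opt_tilt \<beta> t) 1 1 t) = ln (1 - t\<^sup>2) - (2 * ln (1 + \<beta>) + ln (1 - w\<^sup>2))"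
    unfolding td using D w2 \<beta> by (simp add: ln_div ln_mult ln_realpow)
  moreover have "ln ((1 - w\<^sup>2) / (1 - t\<^sup>2)) = ln (1 - w\<^sup>2) - ln (1 - t\<^sup>2)"
    using D w2 by (simp add: ln_div)
  moreover have "\<beta> - 2 * opt_tilt \<beta> t * (1 + \<beta>) = (1 + \<beta>) * (t * (w - t) / (1 - t\<^sup>2))"
  proof -
    define X where "X = \<beta> - 2 * opt_tilt \<beta> t * (1 + \<beta>)"
    \<comment> \<open>Multiplying by w (1 - \<open>t\<^sup>2\<close>) turns the tilt into w - t; the
      stationarity condition then removes the remaining term.\<close>
    have "w * ((1 - t\<^sup>2) * X) = \<beta> * ((1 - t\<^sup>2) * w) - (2 * opt_tilt \<beta> t * w * (1 - t\<^sup>2)) * (1 + \<beta>)"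
      by (simp add: X_def algebra_simps)
    also have "\<dots> = \<beta> * ((1 - t\<^sup>2) * w) - (w - t) * (1 + \<beta>)" unfolding w(5) ..
    also have "\<dots> = (1 + \<beta>) * ((1 - t\<^sup>2) * w) - (1 - t\<^sup>2) * w - (w - t) * (1 + \<beta>)"
      by (simp add: algebra_simps)
    also have "\<dots> = (1 + \<beta>) * ((1 - t\<^sup>2) * w) - (1 + \<beta>) * t * (1 - w\<^sup>2) - (w - t) * (1 + \<beta>)"
      using w(3) by simp
    also have "\<dots> = w * ((1 + \<beta>) * (t * (w - t)))" by (simp add: power2_eq_square algebra_simps)
    finally have "(1 - t\<^sup>2) * X = (1 + \<beta>) * (t * (w - t))" using w by simp
    moreover have "X = (1 - t\<^sup>2) * X / (1 - t\<^sup>2)" using D by simp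
    ultimately have "X = (1 + \<beta>) * (t * (w - t) / (1 - t\<^sup>2))" by simp
    then show ?thesis by (simp add: X_def)
  qed
  ultimately show ?thesis unfolding opt_exponent_eq_general[OF \<beta>] by linarith
qed

text \<open>Stationarity turns the first term into w (w - t) / (1 - \<open>w\<^sup>2\<close>), and
  ln y \<le> y - 1 bounds the second; the sum is a perfect square. This one bound yields both
  positivity and the quadratic growth near t = 0.\<close>

lemma opt_exponent_ge:
  fixes \<beta> t :: real
  assumes \<beta>: "\<beta> > -1" and t: "0 < t" "t < 1"
  defines "w \<equiv> opt_corr \<beta> t"
  shows "opt_exponent \<beta> t \<ge> (w - t)\<^sup>2 / 2"
proof -
  note w = opt_corr_props[OF \<beta> t, folded w_def]
  have D: "0 < 1 - t\<^sup>2" using t by (simp add: power_less_one_iff abs_square_less_1)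
  have w2: "0 < 1 - w\<^sup>2" using w by (simp add: power_less_one_iff abs_square_less_1)
  have "ln ((1 - t\<^sup>2) / (1 - w\<^sup>2)) \<le> (1 - t\<^sup>2) / (1 - w\<^sup>2) - 1"
    using D w2 by (intro ln_le_minus_one) simp
  also have "\<dots> = (w\<^sup>2 - t\<^sup>2) / (1 - w\<^sup>2)" using w2 by (simp add: field_simps)
  finally have "ln ((1 - w\<^sup>2) / (1 - t\<^sup>2)) \<ge> - ((w\<^sup>2 - t\<^sup>2) / (1 - w\<^sup>2))"
    using D w2 by (simp add: ln_div)
  moreover have "(1 + \<beta>) * (t * (w - t) / (1 - t\<^sup>2)) = w * (w - t) / (1 - w\<^sup>2)"
  proof -
    have "(1 + \<beta>) * t / (1 - t\<^sup>2) = w / (1 - w\<^sup>2)" using w(3) D w2 by (simp add: field_simps)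
    then have "(1 + \<beta>) * t / (1 - t\<^sup>2) * (w - t) = w / (1 - w\<^sup>2) * (w - t)" by simp
    then show ?thesis by simp
  qed
  moreover have "w * (w - t) / (1 - w\<^sup>2) - (w\<^sup>2 - t\<^sup>2) / (1 - w\<^sup>2) / 2 = (w - t)\<^sup>2 / (1 - w\<^sup>2) / 2"
  proof -
    have gen: "x / Q - y / Q / 2 = (x - y / 2) / Q" for x y Q :: real by (simp add: diff_divide_distrib)
    have num: "w * (w - t) - (w\<^sup>2 - t\<^sup>2) / 2 = (w - t)\<^sup>2 / 2"
      by (simp add: field_simps power2_eq_square)
    show ?thesis unfolding gen num by simp
  qed
  moreover have "x \<le> e + 1 / 2 * l" if "- u \<le> l" "e = v" "v - u / 2 = x" for u v e l x :: real
    using that by linarith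
  ultimately have "opt_exponent \<beta> t \<ge> (w - t)\<^sup>2 / (1 - w\<^sup>2) / 2"
    unfolding opt_exponent_eq[OF \<beta> t, folded w_def] by blast
  moreover have "(w - t)\<^sup>2 / (1 - w\<^sup>2) \<ge> (w - t)\<^sup>2"
    using w2 by (simp add: field_simps mult_right_le_one_le)
  then have "(w - t)\<^sup>2 / 2 \<le> (w - t)\<^sup>2 / (1 - w\<^sup>2) / 2" by (rule divide_right_mono) simp
  ultimately show ?thesis by (rule order_trans[rotated])
qed

text \<open>For coinciding unit spikes each carries half of \<beta>/(2(1 + \<beta>)), so the tilted
  law is the spiked law itself. Accordingly the exponent at t = 1 is (\<beta> - ln (1 + \<beta>)) /
  2, the relative entropy of N(0, 1 + \<beta>) to N(0, 1).\<close>

lemma opt_tilt_1: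
  assumes "\<beta> > -1"
  shows "4 * opt_tilt \<beta> 1 = 1 - 1 / (1 + \<beta>)"
proof -
  have root: "opt_root \<beta> 1 = 1" by (simp add: opt_root_def)
  have "4 * (((1 - (1 - 1\<^sup>2) / (4 * p\<^sup>2)) / (1 + 1) - 1 / (2 * p)) / 2) = 1 - 1 / p" for p :: real by simp
  then show ?thesis unfolding opt_tilt_def root .
qed

lemma opt_tilt_det_1:
  assumes "\<beta> > -1"
  shows "tilt_det (opt_tilt \<beta> 1) 1 1 1 = 1 / (1 + \<beta>)"
proof -
  have "tilt_det a 1 1 1 = 1 - 4 * a" for a by (simp add: tilt_det_def power2_eq_square algebra_simps)
  then show ?thesis using opt_tilt_1[OF assms] by simp
qed

lemma opt_tilt_det_pos:
  assumes \<beta>: "\<beta> > -1" and t: "0 < t" "t \<le> 1"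
  shows "2 * opt_tilt \<beta> t < 1" "tilt_det (opt_tilt \<beta> t) 1 1 t > 0"
proof -
  have "2 * opt_tilt \<beta> t < 1 \<and> tilt_det (opt_tilt \<beta> t) 1 1 t > 0"
  proof (cases "t = 1")
    case True
    have "4 * opt_tilt \<beta> 1 < 1" unfolding opt_tilt_1[OF \<beta>] using \<beta> by simp
    then show ?thesis using True \<beta> by (simp add: opt_tilt_det_1)
  next
    case False
    then have t: "0 < t" "t < 1" using t by auto
    define w where "w = opt_corr \<beta> t"
    have "0 < w" "w < 1" using opt_corr_props[OF \<beta> t] by (auto simp: w_def)
    then have "0 < 1 - w\<^sup>2" "0 < 1 - t\<^sup>2" using t by (simp_all add: power_less_one_iff abs_square_less_1)
    then show ?thesis using opt_tilt_det[OF \<beta> t] \<beta> by (simp add: w_def)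
  qed
  then show "2 * opt_tilt \<beta> t < 1" "tilt_det (opt_tilt \<beta> t) 1 1 t > 0" by auto
qed

text \<open>By the stationarity condition w = t is possible only for \<beta> = 0, so the perfect
  square in the lower bound does not vanish; t = 1 is computed directly.\<close>

lemma opt_exponent_pos:
  assumes \<beta>: "\<beta> > -1" "\<beta> \<noteq> 0" and t: "0 < t" "t \<le> 1"
  shows "opt_exponent \<beta> t > 0"
proof (cases "t = 1")
  case True
  have "4 * opt_tilt \<beta> 1 * (1 + \<beta>) = (1 - 1 / (1 + \<beta>)) * (1 + \<beta>)" by (simp add: opt_tilt_1 \<beta>)
  also have "\<dots> = \<beta>" using \<beta> by (simp add: left_diff_distrib)
  finally have "2 * opt_tilt \<beta> 1 * (1 + \<beta>) = \<beta> / 2" by simp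
  then have "opt_exponent \<beta> 1 = (\<beta> - ln (1 + \<beta>)) / 2"
    unfolding opt_exponent_eq_general[OF \<beta>(1)] opt_tilt_det_1[OF \<beta>(1)] using \<beta> by (simp add: ln_div field_simps)
  moreover have "ln (1 + \<beta>) < \<beta>" using \<beta> ln_add_one_self_le_self2[of \<beta>] ln_eq_minus_one[of "1 + \<beta>"] by force
  ultimately show ?thesis using True by simp
next
  case False
  then have t: "0 < t" "t < 1" using t by auto
  define w where "w = opt_corr \<beta> t"
  note w = opt_corr_props[OF \<beta>(1) t, folded w_def]
  have D: "0 < 1 - t\<^sup>2" using t by (simp add: power_less_one_iff abs_square_less_1)
  have "w \<noteq> t"
  proof
    assume "w = t"
    then have "(1 - t\<^sup>2) * t = (1 + \<beta>) * ((1 - t\<^sup>2) * t)" using w(3) by (simp add: mult_ac)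
    then show False using D t \<beta> by simp
  qed
  then have "0 < (w - t)\<^sup>2 / 2" by simp
  also have "\<dots> \<le> opt_exponent \<beta> t" unfolding w_def by (rule opt_exponent_ge[OF \<beta>(1) t])
  finally show ?thesis .
qed

lemma continuous_opt_root: "isCont (opt_root \<beta>) t" if "\<beta> > -1"
  unfolding opt_root_def[abs_def] using that by (intro continuous_intros) auto

text \<open>Two-sided continuity at t = 1 is the purpose of the regular form of
  \<open>opt_tilt\<close>: the hypothesis on f can then be used at points just below 1 to control
  overlaps around 1.\<close>

lemma continuous_opt_exponent:
  assumes \<beta>: "\<beta> > -1" and t: "0 < t" "t \<le> 1"
  shows "isCont (opt_exponent \<beta>) t"
proof -
  have R: "1 + opt_root \<beta> t \<noteq> 0" using opt_root_nonneg[of \<beta> t] by linarith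
  have nz: "4 * (1 + \<beta>)\<^sup>2 \<noteq> 0" "2 * (1 + \<beta>) \<noteq> 0"
    using \<beta> by (simp_all only: mult_eq_0_iff power_eq_0_iff) auto
  have "isCont (opt_tilt \<beta>) t"
    unfolding opt_tilt_def[abs_def]
    by (intro continuous_intros continuous_opt_root \<beta> R nz) simp_all
  then have "isCont (\<lambda>t. - ln (1 + \<beta>) + \<beta> - 2 * opt_tilt \<beta> t * (1 + \<beta>) - ln (tilt_det (opt_tilt \<beta> t) 1 1 t) / 2) t"
    using opt_tilt_det_pos[OF \<beta> t] unfolding tilt_det_def
    by (intro continuous_intros) auto
  then show ?thesis unfolding opt_exponent_eq_general[OF \<beta>, abs_def] .
qed

lemma opt_exponent_near_0:
  assumes \<beta>: "\<beta> > -1" and c: "c < \<beta>\<^sup>2"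
  obtains \<tau> where "0 < \<tau>" "\<tau> < 1" "\<And>t. 0 < t \<Longrightarrow> t < \<tau> \<Longrightarrow> opt_exponent \<beta> t \<ge> c * t\<^sup>2 / 2"
proof -
  \<comment> \<open>\<open>g t\<close> is the square of (w - t) / t. As t tends to 0, w / t tends to
    1 + \<beta>, so the limit is \<open>\<beta>\<^sup>2\<close>.\<close>
  define g where "g t = (1 / (opt_root \<beta> t + (1 - t\<^sup>2) / (2 * (1 + \<beta>))) - 1)\<^sup>2" for t
  have root0: "opt_root \<beta> 0 = 1 / (2 * (1 + \<beta>))" using \<beta> by (simp add: opt_root_def)
  have g0: "g 0 = \<beta>\<^sup>2"
  proof -
    have "1 / (2 * (1 + \<beta>)) + 1 / (2 * (1 + \<beta>)) = 1 / (1 + \<beta>)" using \<beta> by (simp add: field_simps)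
    then show ?thesis by (simp add: g_def root0)
  qed
  have "1 / (2 * (1 + \<beta>)) > 0" using \<beta> by simp
  then have "opt_root \<beta> 0 + (1 - 0\<^sup>2) / (2 * (1 + \<beta>)) \<noteq> 0" unfolding root0 by simp
  then have "isCont g 0"
    unfolding g_def[abs_def] using \<beta> by (intro continuous_intros continuous_opt_root) auto
  then have "eventually (\<lambda>t. g t > c) (nhds 0)"
    using c g0 unfolding isCont_def tendsto_at_iff_tendsto_nhds by (auto dest: order_tendstoD(1))
  then obtain d where d: "d > 0" "\<And>t. \<bar>t\<bar> < d \<Longrightarrow> g t > c"
    unfolding eventually_nhds_metric by (auto simp: dist_real_def)
  show thesis
  proof (rule that[of "min d (1/2)"])
    fix t :: real assume t: "0 < t" "t < min d (1/2)"
    then have t1: "0 < t" "t < 1" by auto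
    define w where "w = opt_corr \<beta> t"
    define h where "h = opt_root \<beta> t + (1 - t\<^sup>2) / (2 * (1 + \<beta>))"
    have w: "0 < w" "w * h = t" using opt_corr_props[OF \<beta> t1] by (simp_all add: w_def h_def)
    then have h: "h \<noteq> 0" using t1 by auto
    have "w - t = t * (1 / h - 1)" using w h by (simp add: field_simps)
    then have "(w - t)\<^sup>2 = t\<^sup>2 * g t" by (simp add: power_mult_distrib g_def h_def)
    also have "\<dots> \<ge> t\<^sup>2 * c" using d(2)[of t] t by (intro mult_left_mono) auto
    finally have "t\<^sup>2 * c \<le> (w - t)\<^sup>2" .
    then show "c * t\<^sup>2 / 2 \<le> opt_exponent \<beta> t" using opt_exponent_ge[OF \<beta> t1] by (simp add: w_def mult.commute)
  qed (use d in auto)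
qed

text \<open>The tilt stays frozen at its optimum for the centre t while norms, overlap and
  truncation width vary, so plain continuity of an explicit expression suffices and t' may exceed
  1.\<close>

lemma overlap_exponent_local_bound:
  assumes \<beta>: "\<beta> > -1" and t: "0 < t" "t \<le> 1" and \<epsilon>: "\<epsilon> > 0"
  obtains d where "d > 0"
    "\<And>\<delta> s r t'. \<bar>s - 1\<bar> < d \<Longrightarrow> \<bar>r - 1\<bar> < d \<Longrightarrow> \<bar>t' - t\<bar> < d \<Longrightarrow> \<bar>\<delta>\<bar> < d \<Longrightarrow>
       2 * opt_tilt \<beta> t * s < 1 \<and> tilt_det (opt_tilt \<beta> t) s r t' > 0 \<and>
       overlap_exponent \<beta> \<delta> (opt_tilt \<beta> t) s r t' < opt_exponent \<beta> t + \<epsilon>"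
proof -
  define a where "a = opt_tilt \<beta> t"
  define z where "z = (1::real, 1::real, t, 0::real)"
  have det: "2 * a < 1" "tilt_det a 1 1 t > 0" using opt_tilt_det_pos[OF \<beta> t] by (auto simp: a_def)
  define P where "P p \<longleftrightarrow> 2 * a * fst p < 1 \<and> tilt_det a (fst p) (fst (snd p)) (fst (snd (snd p))) > 0 \<and>
       overlap_exponent \<beta> (snd (snd (snd p))) a (fst p) (fst (snd p)) (fst (snd (snd p))) < opt_exponent \<beta> t + \<epsilon>"
    for p :: "real \<times> real \<times> real \<times> real"
  have fs: "((\<lambda>p. fst p) \<longlongrightarrow> 1) (nhds z)" "((\<lambda>p. fst (snd p)) \<longlongrightarrow> 1) (nhds z)"
    "((\<lambda>p. fst (snd (snd p))) \<longlongrightarrow> t) (nhds z)" "((\<lambda>p. snd (snd (snd p))) \<longlongrightarrow> 0) (nhds z)"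
    using tendsto_fst[OF tendsto_ident_at[where a=z and s=UNIV]]
    by (auto simp: z_def intro!: tendsto_eq_intros filterlim_ident)
  have td: "((\<lambda>p. tilt_det a (fst p) (fst (snd p)) (fst (snd (snd p)))) \<longlongrightarrow> tilt_det a 1 1 t) (nhds z)"
    unfolding tilt_det_def by (intro tendsto_intros fs)
  have "((\<lambda>p. overlap_exponent \<beta> (snd (snd (snd p))) a (fst p) (fst (snd p)) (fst (snd (snd p))))
     \<longlongrightarrow> overlap_exponent \<beta> 0 a 1 1 t) (nhds z)"
    unfolding overlap_exponent_def side_rate_def
    by (intro tendsto_intros fs td) (use \<beta> det in auto)
  then have "eventually (\<lambda>p. overlap_exponent \<beta> (snd (snd (snd p))) a (fst p) (fst (snd p)) (fst (snd (snd p)))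
     < opt_exponent \<beta> t + \<epsilon>) (nhds z)"
    by (rule order_tendstoD(2)) (use \<epsilon> in \<open>simp add: opt_exponent_def a_def\<close>)
  moreover have "eventually (\<lambda>p. tilt_det a (fst p) (fst (snd p)) (fst (snd (snd p))) > 0) (nhds z)"
    using td det(2) by (rule order_tendstoD(1))
  moreover have "((\<lambda>p. 2 * a * fst p) \<longlongrightarrow> 2 * a * 1) (nhds z)"
    by (intro tendsto_intros fs)
  then have "eventually (\<lambda>p. 2 * a * fst p < 1) (nhds z)"
    by (rule order_tendstoD(2)) (use det in simp)
  ultimately have "eventually P (nhds z)" unfolding P_def by eventually_elim auto
  then obtain e where e: "e > 0" "\<And>p. dist p z < e \<Longrightarrow> P p" unfolding eventually_nhds_metric by blast
  show thesis
  \<comment> \<open>A quarter each, since the distance in the fourfold product is at most the sum of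
    the four coordinate distances.\<close>
  proof (rule that[of "e / 4"])
    fix \<delta> s r t' :: real
    assume near: "\<bar>s - 1\<bar> < e / 4" "\<bar>r - 1\<bar> < e / 4" "\<bar>t' - t\<bar> < e / 4" "\<bar>\<delta>\<bar> < e / 4"
    have le: "dist (u, v) (u', v') \<le> \<bar>u - u'\<bar> + dist v v'" for u u' :: real and v v' :: "'z::metric_space"
      using sqrt_sum_squares_le_sum_abs[of "dist u u'" "dist v v'"] by (simp add: dist_Pair_Pair dist_real_def)
    have "dist (s, r, t', \<delta>) z \<le> \<bar>s - 1\<bar> + (\<bar>r - 1\<bar> + (\<bar>t' - t\<bar> + \<bar>\<delta>\<bar>))"
      unfolding z_def by (intro order_trans[OF le] add_mono order_refl) (simp add: dist_real_def)
    then have "dist (s, r, t', \<delta>) z < e" using near by linarith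
    from e(2)[OF this] show "2 * opt_tilt \<beta> t * s < 1 \<and> tilt_det (opt_tilt \<beta> t) s r t' > 0 \<and>
       overlap_exponent \<beta> \<delta> (opt_tilt \<beta> t) s r t' < opt_exponent \<beta> t + \<epsilon>"
      by (simp add: P_def a_def)
  qed (use e in simp)
qed

section \<open>Overlap tails\<close>

text \<open>Layers k \<le> V \<le> k + 1 are summed. Rounding V up costs the factor exp 1, and
  \<rho> > 1 makes the series geometric with ratio exp (1 - \<rho>).\<close>

lemma nn_integral_exp_le_of_geometric_tail:
  assumes A [measurable]: "Measurable.pred M A" and V [measurable]: "V \<in> borel_measurable M"
    and V0: "\<And>x. V x \<ge> 0" and \<rho>: "\<rho> > 1" and C: "C \<ge> 0"
    and tail: "\<And>k::nat. emeasure M {x \<in> space M. A x \<and> V x \<ge> real k} \<le> ennreal (C * exp (- \<rho> * real k))"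
  shows "(\<integral>\<^sup>+x. ennreal (if A x then exp (V x) else 0) \<partial>M) \<le> ennreal (C * exp 1 / (1 - exp (1 - \<rho>)))"
proof -
  let ?E = "\<lambda>k::nat. {x \<in> space M. A x \<and> V x \<ge> real k}"
  have "(\<integral>\<^sup>+x. ennreal (if A x then exp (V x) else 0) \<partial>M) \<le>
    (\<integral>\<^sup>+x. (\<Sum>k. ennreal (exp (real k + 1)) * indicator (?E k) x) \<partial>M)"
  proof (rule nn_integral_mono)
    fix x assume x: "x \<in> space M"
    show "ennreal (if A x then exp (V x) else 0) \<le> (\<Sum>k. ennreal (exp (real k + 1)) * indicator (?E k) x)"
    proof (cases "A x")
      case True
      define k where "k = nat \<lfloor>V x\<rfloor>"
      have k: "real k \<le> V x" "V x \<le> real k + 1" using V0[of x] by (auto simp: k_def)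
      define u where "u k = ennreal (exp (real k + 1)) * indicator (?E k) x" for k
      have "ennreal (exp (V x)) \<le> u k"
        using k True x by (auto simp: u_def intro!: ennreal_leI)
      also have "u k \<le> (\<Sum>k. u k)"
        using sum_le_suminf[of u "{k}"] by simp
      finally show ?thesis using True by (simp add: u_def)
    qed simp
  qed
  also have "\<dots> = (\<Sum>k. \<integral>\<^sup>+x. ennreal (exp (real k + 1)) * indicator (?E k) x \<partial>M)"
    by (intro nn_integral_suminf) measurable
  also have "\<dots> = (\<Sum>k. ennreal (exp (real k + 1)) * emeasure M (?E k))"
    by (intro suminf_cong nn_integral_cmult_indicator) measurable
  also have "\<dots> \<le> (\<Sum>k. ennreal (C * exp 1 * exp (1 - \<rho>) ^ k))"
  proof (intro suminf_le)
    fix k :: nat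
    have "ennreal (exp (real k + 1)) * emeasure M (?E k) \<le> ennreal (exp (real k + 1)) * ennreal (C * exp (- \<rho> * real k))"
      by (intro mult_left_mono tail) simp
    also have "\<dots> = ennreal (C * exp 1 * exp (1 - \<rho>) ^ k)"
    proof -
      have "exp (real k + 1) * exp (- \<rho> * real k) = exp 1 * exp (real k * (1 - \<rho>))"
        unfolding exp_add[symmetric] by (simp add: algebra_simps)
      then have "exp (real k + 1) * (C * exp (- \<rho> * real k)) = C * exp 1 * exp (1 - \<rho>) ^ k"
        unfolding exp_of_nat_mult[symmetric] by (simp add: mult_ac)
      then show ?thesis using C by (simp only: ennreal_mult[symmetric] exp_ge_zero mult_nonneg_nonneg)
    qed
    finally show "ennreal (exp (real k + 1)) * emeasure M (?E k) \<le> ennreal (C * exp 1 * exp (1 - \<rho>) ^ k)" .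
  qed auto
  also have "\<dots> = ennreal (\<Sum>k. C * exp 1 * exp (1 - \<rho>) ^ k)"
    using \<rho> C by (intro suminf_ennreal2 summable_mult summable_geometric) auto
  also have "(\<Sum>k. C * exp 1 * exp (1 - \<rho>) ^ k) = C * exp 1 / (1 - exp (1 - \<rho>))"
    using \<rho> by (subst suminf_mult) (auto simp: suminf_geometric summable_geometric)
  finally show ?thesis .
qed

lemma spike_prior_space:
  assumes "spike_prior \<X>"
  shows "prob_space (\<X> n)" "sets (\<X> n) = sets (borel_vec n)" "space (\<X> n) = {..<n} \<rightarrow>\<^sub>E UNIV"
  using assms sets_eq_imp_space_eq[of "\<X> n" "borel_vec n"] by (auto simp: spike_prior_def space_PiM)

lemma prob_space_spike_pair:
  assumes "spike_prior \<X>"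
  shows "prob_space (\<X> n \<Otimes>\<^sub>M \<X> n)"
  by (intro prob_space_pair spike_prior_space(1)[OF assms])

definition overlap :: "nat \<Rightarrow> (nat \<Rightarrow> real) \<times> (nat \<Rightarrow> real) \<Rightarrow> real" where
  "overlap n p = \<bar>vec_inner n (fst p) (snd p)\<bar>"

lemma measurable_overlap:
  assumes "spike_prior \<X>"
  shows "overlap n \<in> borel_measurable (\<X> n \<Otimes>\<^sub>M \<X> n)"
proof -
  have [measurable_cong]: "sets (\<X> n) = sets (borel_vec n)" by (rule spike_prior_space(2)[OF assms])
  show ?thesis unfolding overlap_def by measurable
qed

lemma emeasure_overlap_ge:
  assumes "spike_prior \<X>"
  shows "emeasure (\<X> n \<Otimes>\<^sub>M \<X> n) {p \<in> space (\<X> n \<Otimes>\<^sub>M \<X> n). overlap n p \<ge> t} = ennreal (overlap_tail \<X> n t)"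
proof -
  interpret prob_space "\<X> n \<Otimes>\<^sub>M \<X> n" by (rule prob_space_spike_pair[OF assms])
  show ?thesis by (simp add: overlap_tail_def overlap_def emeasure_eq_measure)
qed

lemma overlap_tail_le_of_rate:
  assumes n: "n \<ge> 1" and b: "ereal b \<le> overlap_rate \<X> n t"
  shows "overlap_tail \<X> n t \<le> exp (- real n * b)"
proof (cases "overlap_tail \<X> n t = 0")
  case False
  then have pos: "overlap_tail \<X> n t > 0" by (simp add: overlap_tail_def less_le)
  have "b \<le> - (1 / real n) * ln (overlap_tail \<X> n t)"
    using b False by (simp add: overlap_rate_def)
  then have "real n * b \<le> real n * (- (1 / real n) * ln (overlap_tail \<X> n t))"
    by (rule mult_left_mono) simp
  then have "ln (overlap_tail \<X> n t) \<le> - real n * b" using n by simp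
  then show ?thesis using pos by (metis exp_le_cancel_iff exp_ln)
qed simp

text \<open>The supremum may fail to be attained, and the strict inequality m < u makes up for
  it.\<close>

lemma wigner_threshold_witness:
  assumes sp: "spike_prior \<X>" and th: "ereal u \<le> (wigner_threshold \<X>)\<^sup>2" and m: "0 \<le> m" "m < u"
  obtains l B where "m < l\<^sup>2" "eventually (\<lambda>n. wigner_second_moment \<X> l n \<le> ennreal B) sequentially"
proof -
  define L where "L = {l. \<exists>B::real. eventually (\<lambda>n. wigner_second_moment \<X> l n \<le> ennreal B) sequentially}"
  have "\<exists>l\<in>L. m < l\<^sup>2"
  proof (rule ccontr)
    assume "\<not> (\<exists>l\<in>L. m < l\<^sup>2)"
    then have le: "l \<le> sqrt m" if "l \<in> L" for l
      using that by (intro real_le_rsqrt) auto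
    have th_le: "wigner_threshold \<X> \<le> ereal (sqrt m)"
      unfolding wigner_threshold_def L_def[symmetric] by (rule Sup_least) (use le in auto)
    have "wigner_second_moment \<X> 0 n = 1" for n
      using prob_space.emeasure_space_1[OF prob_space_spike_pair[OF sp]] by (simp add: wigner_second_moment_def)
    \<comment> \<open>Membership of 0 makes the threshold nonnegative, so that squaring is monotone;
      a value of minus infinity would square to infinity.\<close>
    then have "0 \<in> L" by (auto simp: L_def intro!: exI[of _ 1])
    then have th0: "0 \<le> wigner_threshold \<X>"
      unfolding wigner_threshold_def L_def[symmetric] by (intro Sup_upper) (auto simp: zero_ereal_def)
    have "(wigner_threshold \<X>)\<^sup>2 \<le> (ereal (sqrt m))\<^sup>2"
      unfolding power2_eq_square using th_le th0 m by (intro ereal_mult_mono) auto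
    also have "\<dots> = ereal m" using m by (simp add: power2_eq_square)
    finally have "ereal u \<le> ereal m" using th by (rule order_trans[rotated])
    then show False using m by simp
  qed
  then show thesis using that by (auto simp: L_def)
qed

section \<open>Balancing the exponents in N against the rates in n\<close>

lemma sample_size_ratio:
  assumes "(\<lambda>n. real n / real (N n)) \<longlonglongrightarrow> \<gamma>" "\<gamma> > 0"
  shows "(\<lambda>n. real (N n) / real n) \<longlonglongrightarrow> 1 / \<gamma>" "filterlim N at_top sequentially"
proof -
  show lim: "(\<lambda>n. real (N n) / real n) \<longlonglongrightarrow> 1 / \<gamma>"
    using tendsto_inverse[OF assms(1)] assms(2) by (simp add: inverse_eq_divide)
  have "filterlim (\<lambda>n. real (N n) / real n * real n) at_top sequentially"
    by (rule filterlim_tendsto_pos_mult_at_top[OF lim _ filterlim_real_sequentially]) (use assms in simp)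
  moreover have "eventually (\<lambda>n. real (N n) / real n * real n = real (N n)) sequentially"
    using eventually_gt_at_top[of 0] by eventually_elim simp
  ultimately have "filterlim (\<lambda>n. real (N n)) at_top sequentially"
    by (simp cong: filterlim_cong)
  then have ev: "eventually (\<lambda>n. Z \<le> real (N n)) sequentially" for Z by (simp add: filterlim_at_top)
  show "filterlim N at_top sequentially"
    unfolding filterlim_at_top
  proof
    fix Z :: nat
    show "eventually (\<lambda>n. Z \<le> N n) sequentially" using ev[of "real Z"] by simp
  qed
qed

lemma eventually_sample_size_less:
  assumes "(\<lambda>n. real n / real (N n)) \<longlonglongrightarrow> \<gamma>" "\<gamma> > 0" "b \<longlonglongrightarrow> y" "x / \<gamma> < y"
  shows "eventually (\<lambda>n. real (N n) * x \<le> real n * b n) sequentially"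
proof -
  have "(\<lambda>n. b n - real (N n) / real n * x) \<longlonglongrightarrow> y - 1 / \<gamma> * x"
    by (intro tendsto_intros assms sample_size_ratio)
  then have "eventually (\<lambda>n. b n - real (N n) / real n * x > 0) sequentially"
    by (rule order_tendstoD(1)) (use assms in simp)
  with eventually_gt_at_top[of 0] show ?thesis
  proof eventually_elim
    case (elim n)
    then have "real n * (real (N n) / real n * x) \<le> real n * b n" by (intro mult_left_mono) auto
    then show ?case using elim by simp
  qed
qed

text \<open>The weight exceeds the exponent of the untruncated moment slightly, since c >
  \<open>\<beta>\<^sup>2\<close>. Here the rate bounds b would be too coarse, so the expectation is
  controlled either by the Wigner second moment or by the Chernoff bound, which carries only a
  constant factor.\<close>

lemma small_overlap_second_moment:
  fixes \<beta> :: real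
  assumes sp: "spike_prior \<X>" and rf: "is_rate_function \<X> f" and \<beta>: "\<beta> > -1" "\<beta> \<noteq> 0" and \<gamma>: "\<gamma>' > 0" "\<gamma> > \<gamma>'"
    and near0: "ereal (\<beta>\<^sup>2 / \<gamma>') \<le> (wigner_threshold \<X>)\<^sup>2 \<or> local_chernoff_bound \<X> f"
    and rate: "\<And>t. 0 < t \<Longrightarrow> t < 1 \<Longrightarrow> opt_exponent \<beta> t \<le> \<gamma>' * f t"
    and N: "(\<lambda>n. real n / real (N n)) \<longlonglongrightarrow> \<gamma>"
  obtains c \<tau> B where "\<beta>\<^sup>2 < c" "0 < \<tau>" "\<tau> < 1"
    "eventually (\<lambda>n. (\<integral>\<^sup>+p. ennreal (if overlap n p < \<tau> then exp (real (N n) * (c * (overlap n p)\<^sup>2 / 2)) else 0)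
        \<partial>(\<X> n \<Otimes>\<^sub>M \<X> n)) \<le> ennreal B) sequentially"
proof -
  have \<beta>2: "\<beta>\<^sup>2 > 0" using \<beta> by simp
  have "\<beta>\<^sup>2 / \<gamma> < \<beta>\<^sup>2 / \<gamma>'" using \<beta>2 \<gamma> by (simp add: divide_strict_left_mono)
  \<comment> \<open>The gap between \<gamma>' and \<gamma> is spent twice: \<open>m\<^sub>1\<close>
    leaves room for c > \<open>\<beta>\<^sup>2\<close> with N c \<le> n \<open>m\<^sub>1\<close>
    eventually, and in the Chernoff case \<open>m\<^sub>2 / m\<^sub>1\<close> > 1 is the decay rate
    of the geometric tail.\<close>
  then obtain m\<^sub>1 where m1: "\<beta>\<^sup>2 / \<gamma> < m\<^sub>1" "m\<^sub>1 < \<beta>\<^sup>2 / \<gamma>'" using dense by blast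
  then obtain m\<^sub>2 where m2: "m\<^sub>1 < m\<^sub>2" "m\<^sub>2 < \<beta>\<^sup>2 / \<gamma>'" using dense by blast
  have m1_pos: "m\<^sub>1 > 0" using m1(1) \<beta>2 \<gamma> by (smt (verit) divide_pos_pos)
  obtain c where c: "\<beta>\<^sup>2 < c" "c < m\<^sub>1 * \<gamma>"
    using m1(1) \<gamma> dense[of "\<beta>\<^sup>2" "m\<^sub>1 * \<gamma>"] by (auto simp: field_simps)
  have "eventually (\<lambda>n. real (N n) * c \<le> real n * m\<^sub>1) sequentially"
    by (rule eventually_sample_size_less[OF N _ tendsto_const]) (use \<gamma> c in \<open>auto simp: field_simps\<close>)
  then have ev: "eventually (\<lambda>n. n \<ge> 1 \<and> real (N n) * c \<le> real n * m\<^sub>1) sequentially"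
    using eventually_ge_at_top[of 1] by eventually_elim auto
  show thesis
  proof (cases "ereal (\<beta>\<^sup>2 / \<gamma>') \<le> (wigner_threshold \<X>)\<^sup>2")
    case True
    obtain l B where l: "m\<^sub>1 < l\<^sup>2" and B: "eventually (\<lambda>n. wigner_second_moment \<X> l n \<le> ennreal B) sequentially"
      using wigner_threshold_witness[OF sp True, of m\<^sub>1] m1 m1_pos by auto
    show thesis
    \<comment> \<open>The cutoff 1/2 is arbitrary, since the Wigner moment bounds the weight over
      all overlaps at once.\<close>
    proof (rule that[of c "1/2" B])
      show "eventually (\<lambda>n. (\<integral>\<^sup>+p. ennreal (if overlap n p < 1/2 then exp (real (N n) * (c * (overlap n p)\<^sup>2 / 2)) else 0)
        \<partial>(\<X> n \<Otimes>\<^sub>M \<X> n)) \<le> ennreal B) sequentially"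
        using ev B
      proof eventually_elim
        case (elim n)
        have "exp (real (N n) * (c * (overlap n p)\<^sup>2 / 2)) \<le> exp (real n * l\<^sup>2 / 2 * (overlap n p)\<^sup>2)" for p
        proof -
          have "real (N n) * c \<le> real n * l\<^sup>2"
            using elim l mult_left_mono[of "m\<^sub>1" "l\<^sup>2" "real n"] by linarith
          then have "real (N n) * c * ((overlap n p)\<^sup>2 / 2) \<le> real n * l\<^sup>2 * ((overlap n p)\<^sup>2 / 2)"
            by (rule mult_right_mono) simp
          then show ?thesis by (simp add: algebra_simps)
        qed
        then have "(\<integral>\<^sup>+p. ennreal (if overlap n p < 1/2 then exp (real (N n) * (c * (overlap n p)\<^sup>2 / 2)) else 0)
            \<partial>(\<X> n \<Otimes>\<^sub>M \<X> n)) \<le> (\<integral>\<^sup>+p. ennreal (exp (real n * l\<^sup>2 / 2 * (overlap n p)\<^sup>2)) \<partial>(\<X> n \<Otimes>\<^sub>M \<X> n))"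
          by (intro nn_integral_mono ennreal_leI) auto
        also have "\<dots> = wigner_second_moment \<X> l n" by (simp add: wigner_second_moment_def overlap_def)
        also have "\<dots> \<le> ennreal B" using elim by simp
        finally show ?case .
      qed
    qed (use c in auto)
  next
    case False
    then obtain T C where T: "0 < T" "T < 1" "0 < C"
      and chern: "\<And>n t. n \<ge> 1 \<Longrightarrow> 0 \<le> t \<Longrightarrow> t \<le> T \<Longrightarrow> overlap_tail \<X> n t \<le> C * exp (- real n * f t)"
      using near0 unfolding local_chernoff_bound_def by auto
    have "m\<^sub>2 * \<gamma>' < \<beta>\<^sup>2" using m2(2) \<gamma> by (simp add: field_simps)
    from opt_exponent_near_0[OF \<beta>(1) this]
    obtain \<tau>' where \<tau>': "0 < \<tau>'" "\<tau>' < 1" "\<And>t. 0 < t \<Longrightarrow> t < \<tau>' \<Longrightarrow> m\<^sub>2 * \<gamma>' * t\<^sup>2 / 2 \<le> opt_exponent \<beta> t" by blast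
    define \<tau> where "\<tau> = min T \<tau>'"
    have f_ge: "f t \<ge> m\<^sub>2 / 2 * t\<^sup>2" if "0 \<le> t" "t < \<tau>" for t
    proof (cases "t = 0")
      case True
      then show ?thesis using rf by (simp add: is_rate_function_def)
    next
      case False
      then have "m\<^sub>2 * \<gamma>' * t\<^sup>2 / 2 \<le> \<gamma>' * f t"
        using that \<tau>'(3)[of t] rate[of t] \<tau>'(2) by (auto simp: \<tau>_def)
      then have "\<gamma>' * (m\<^sub>2 / 2 * t\<^sup>2) \<le> \<gamma>' * f t" by (simp add: mult_ac)
      then show ?thesis using \<gamma> by simp
    qed
    show thesis
    proof (rule that[of c \<tau> "C * exp 1 / (1 - exp (1 - m\<^sub>2 / m\<^sub>1))"])
      show "eventually (\<lambda>n. (\<integral>\<^sup>+p. ennreal (if overlap n p < \<tau> then exp (real (N n) * (c * (overlap n p)\<^sup>2 / 2)) else 0)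
        \<partial>(\<X> n \<Otimes>\<^sub>M \<X> n)) \<le> ennreal (C * exp 1 / (1 - exp (1 - m\<^sub>2 / m\<^sub>1)))) sequentially"
        using ev
      proof eventually_elim
        case (elim n)
        define V where "V p = real n * m\<^sub>1 / 2 * (overlap n p)\<^sup>2" for p
        have nm: "real n * m\<^sub>1 / 2 > 0" using elim m1_pos by simp
        have [measurable]: "overlap n \<in> borel_measurable (\<X> n \<Otimes>\<^sub>M \<X> n)" by (rule measurable_overlap[OF sp])
        have [measurable]: "V \<in> borel_measurable (\<X> n \<Otimes>\<^sub>M \<X> n)" unfolding V_def by measurable
        have "exp (real (N n) * (c * (overlap n p)\<^sup>2 / 2)) \<le> exp (V p)" for p
        proof -
          have "real (N n) * c * ((overlap n p)\<^sup>2 / 2) \<le> real n * m\<^sub>1 * ((overlap n p)\<^sup>2 / 2)"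
            using elim by (intro mult_right_mono) auto
          then show ?thesis by (simp add: V_def algebra_simps)
        qed
        then have "(\<integral>\<^sup>+p. ennreal (if overlap n p < \<tau> then exp (real (N n) * (c * (overlap n p)\<^sup>2 / 2)) else 0)
            \<partial>(\<X> n \<Otimes>\<^sub>M \<X> n)) \<le> (\<integral>\<^sup>+p. ennreal (if overlap n p < \<tau> then exp (V p) else 0) \<partial>(\<X> n \<Otimes>\<^sub>M \<X> n))"
          by (intro nn_integral_mono ennreal_leI) auto
        also have "\<dots> \<le> ennreal (C * exp 1 / (1 - exp (1 - m\<^sub>2 / m\<^sub>1)))"
        proof (rule nn_integral_exp_le_of_geometric_tail)
          fix k :: nat
          \<comment> \<open>The overlap at which the weight exponent \<open>V\<close> reaches k. If
            it is \<tau> or more, the event is empty.\<close>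
          define t where "t = sqrt (real k / (real n * m\<^sub>1 / 2))"
          have t0: "t \<ge> 0" using nm by (simp add: t_def)
          have t2: "real n * m\<^sub>1 / 2 * t\<^sup>2 = real k"
          proof -
            have "c * (x / c) = x" if "c > 0" for c x :: real using that by simp
            moreover have "t\<^sup>2 = real k / (real n * m\<^sub>1 / 2)"
              unfolding t_def by (intro real_sqrt_pow2 divide_nonneg_pos nm) simp
            ultimately show ?thesis using nm by (simp only:)
          qed
          have ge_iff: "real k \<le> V p \<longleftrightarrow> t \<le> overlap n p" for p
          proof -
            have "real k \<le> V p \<longleftrightarrow> t\<^sup>2 \<le> (overlap n p)\<^sup>2"
              unfolding V_def t2[symmetric] using nm by (simp only: mult_le_cancel_left_pos)
            then show ?thesis using t0 by (simp add: overlap_def abs_le_square_iff[symmetric])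
          qed
          show "emeasure (\<X> n \<Otimes>\<^sub>M \<X> n) {p \<in> space (\<X> n \<Otimes>\<^sub>M \<X> n). overlap n p < \<tau> \<and> real k \<le> V p}
            \<le> ennreal (C * exp (- (m\<^sub>2 / m\<^sub>1) * real k))"
          proof (cases "t < \<tau>")
            case True
            have "emeasure (\<X> n \<Otimes>\<^sub>M \<X> n) {p \<in> space (\<X> n \<Otimes>\<^sub>M \<X> n). overlap n p < \<tau> \<and> real k \<le> V p}
              \<le> emeasure (\<X> n \<Otimes>\<^sub>M \<X> n) {p \<in> space (\<X> n \<Otimes>\<^sub>M \<X> n). overlap n p \<ge> t}"
              unfolding ge_iff by (intro emeasure_mono) auto
            also have "\<dots> \<le> ennreal (C * exp (- real n * f t))"
              unfolding emeasure_overlap_ge[OF sp] using chern[of n t] elim t0 True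
              by (intro ennreal_leI) (simp add: \<tau>_def)
            also have "\<dots> \<le> ennreal (C * exp (- (m\<^sub>2 / m\<^sub>1) * real k))"
            proof -
              have "m\<^sub>2 / m\<^sub>1 * real k = real n * (m\<^sub>2 / 2 * t\<^sup>2)" unfolding t2[symmetric] using m1_pos by simp
              also have "\<dots> \<le> real n * f t" using f_ge[OF t0 True] by (intro mult_left_mono) auto
              finally show ?thesis using T by (intro ennreal_leI mult_left_mono) auto
            qed
            finally show ?thesis .
          next
            case False
            then have empty: "{p \<in> space (\<X> n \<Otimes>\<^sub>M \<X> n). overlap n p < \<tau> \<and> real k \<le> V p} = {}"
              unfolding ge_iff by auto
            show ?thesis unfolding empty by simp
          qed
        qed (use m1_pos m2 T nm in \<open>auto simp: V_def\<close>)
        finally show ?case .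
      qed
    qed (use c T \<tau>' in \<open>auto simp: \<tau>_def\<close>)
  qed
qed

text \<open>One cell of the cover. All overlaps of the cell lie above its left end p < 1, so the
  tail at p bounds its probability, while h bounds the exponent throughout. By h / \<gamma> < f p
  the tail wins.\<close>

lemma large_overlap_point:
  fixes \<beta> :: real
  assumes \<beta>: "\<beta> > -1" "\<beta> \<noteq> 0" and \<gamma>: "\<gamma>' > 0" "\<gamma> > \<gamma>'"
    and rate: "\<And>t. 0 < t \<Longrightarrow> t < 1 \<Longrightarrow> opt_exponent \<beta> t \<le> \<gamma>' * f t"
    and t: "0 < t" "t \<le> 1"
  obtains d p h where "d > 0" "0 < p" "p < 1" "h / \<gamma> < f p" "\<And>t'. \<bar>t' - t\<bar> < d \<Longrightarrow> p \<le> t'"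
    "\<And>\<delta> s r t'. \<bar>s - 1\<bar> < d \<Longrightarrow> \<bar>r - 1\<bar> < d \<Longrightarrow> \<bar>t' - t\<bar> < d \<Longrightarrow> \<bar>\<delta>\<bar> < d \<Longrightarrow>
       2 * opt_tilt \<beta> t * s < 1 \<and> tilt_det (opt_tilt \<beta> t) s r t' > 0 \<and>
       overlap_exponent \<beta> \<delta> (opt_tilt \<beta> t) s r t' < h"
proof -
  define E where "E = opt_exponent \<beta> t"
  have E: "E > 0" unfolding E_def by (rule opt_exponent_pos[OF \<beta> t])
  \<comment> \<open>The required inequality amounts to \<epsilon> (\<gamma> + \<gamma>') < E
    (\<gamma> - \<gamma>'); half of the critical value is taken.\<close>
  define \<epsilon> where "\<epsilon> = E * (\<gamma> - \<gamma>') / (2 * (\<gamma> + \<gamma>'))"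
  have \<epsilon>: "\<epsilon> > 0" "(E + \<epsilon>) / \<gamma> < (E - \<epsilon>) / \<gamma>'"
  proof -
    show "\<epsilon> > 0" using E \<gamma> by (simp add: \<epsilon>_def)
    have "x / (2 * q) * q = x / 2" if "q \<noteq> 0" for x q :: real using that by simp
    from this[of "\<gamma> + \<gamma>'"] have "\<epsilon> * (\<gamma> + \<gamma>') = E * (\<gamma> - \<gamma>') / 2"
      using \<gamma> unfolding \<epsilon>_def by force
    also have "\<dots> < E * (\<gamma> - \<gamma>')" using E \<gamma> by simp
    finally have "\<gamma>' * (E + \<epsilon>) < \<gamma> * (E - \<epsilon>)" by (simp add: algebra_simps)
    then show "(E + \<epsilon>) / \<gamma> < (E - \<epsilon>) / \<gamma>'" using \<gamma> by (simp add: field_simps)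
  qed
  have "eventually (\<lambda>u. opt_exponent \<beta> u > E - \<epsilon>) (nhds t)"
  proof (rule order_tendstoD(1))
    show "(opt_exponent \<beta> \<longlongrightarrow> E) (nhds t)"
      using continuous_opt_exponent[OF \<beta>(1) t] unfolding isCont_def tendsto_at_iff_tendsto_nhds E_def .
  qed (use \<epsilon> in simp)
  then obtain d1 where d1: "d1 > 0" "\<And>u. \<bar>u - t\<bar> < d1 \<Longrightarrow> opt_exponent \<beta> u > E - \<epsilon>"
    unfolding eventually_nhds_metric by (auto simp: dist_real_def)
  obtain d2 where d2: "d2 > 0"
    "\<And>\<delta> s r t'. \<bar>s - 1\<bar> < d2 \<Longrightarrow> \<bar>r - 1\<bar> < d2 \<Longrightarrow> \<bar>t' - t\<bar> < d2 \<Longrightarrow> \<bar>\<delta>\<bar> < d2 \<Longrightarrow>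
       2 * opt_tilt \<beta> t * s < 1 \<and> tilt_det (opt_tilt \<beta> t) s r t' > 0 \<and>
       overlap_exponent \<beta> \<delta> (opt_tilt \<beta> t) s r t' < E + \<epsilon>"
    using overlap_exponent_local_bound[OF \<beta>(1) t \<epsilon>(1)] unfolding E_def by blast
  \<comment> \<open>Halving d1 keeps p = t - d inside the continuity neighbourhood, and t / 2 keeps
    p positive.\<close>
  define d where "d = Min {d1 / 2, d2, t / 2}"
  have d: "d > 0" "d \<le> d1 / 2" "d \<le> d2" "d \<le> t / 2" using d1 d2 t by (auto simp: d_def)
  define p where "p = t - d"
  have p: "0 < p" "p < 1" using d t by (auto simp: p_def)
  have "E - \<epsilon> < opt_exponent \<beta> p" using d d1 by (intro d1(2)) (auto simp: p_def)
  also have "\<dots> \<le> \<gamma>' * f p" by (rule rate[OF p])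
  finally have "(E - \<epsilon>) / \<gamma>' < f p" using \<gamma> by (simp add: field_simps)
  with \<epsilon> have h: "(E + \<epsilon>) / \<gamma> < f p" by simp
  show thesis
  proof (rule that[OF d(1) p h])
    show "p \<le> t'" if "\<bar>t' - t\<bar> < d" for t' using that by (simp add: p_def)
    show "2 * opt_tilt \<beta> t * s < 1 \<and> tilt_det (opt_tilt \<beta> t) s r t' > 0 \<and>
       overlap_exponent \<beta> \<delta> (opt_tilt \<beta> t) s r t' < E + \<epsilon>"
      if "\<bar>s - 1\<bar> < d" "\<bar>r - 1\<bar> < d" "\<bar>t' - t\<bar> < d" "\<bar>\<delta>\<bar> < d" for \<delta> s r t'
      using that d by (intro d2(2)) linarith+
  qed
qed

section \<open>The truncated second moment\<close>

lemma neg_ln_one_minus_le: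
  fixes b c :: real
  assumes b: "b > 0" and c: "b < c"
  obtains \<tau> where "\<tau> > 0" "\<And>t. 0 \<le> t \<Longrightarrow> t < \<tau> \<Longrightarrow> b * t\<^sup>2 < 1 \<and> - (ln (1 - b * t\<^sup>2) / 2) \<le> c * t\<^sup>2 / 2"
proof -
  \<comment> \<open>The first bound gives b \<open>t\<^sup>2\<close> \<le> 1/2, where the quadratic
    estimate of the logarithm is valid; the second makes its error term 2
    \<open>(b * t\<^sup>2)\<^sup>2\<close> fit into (c - b) \<open>t\<^sup>2\<close>.\<close>
  define u where "u = min (1 / (2 * b)) ((c / b - 1) / (2 * b))"
  have u: "u > 0" using b c by (simp add: u_def)
  show thesis
  proof (rule that[of "sqrt u"])
    fix t assume t: "0 \<le> t" "t < sqrt u"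
    have "t\<^sup>2 \<le> u" using t u by (metis less_imp_le power_mono real_sqrt_pow2)
    then have "t\<^sup>2 \<le> 1 / (2 * b)" "t\<^sup>2 \<le> (c / b - 1) / (2 * b)" by (auto simp: u_def)
    then have z: "b * t\<^sup>2 \<le> 1 / 2" "2 * (b * t\<^sup>2) \<le> c / b - 1" using b by (auto simp: field_simps)
    have "- (b * t\<^sup>2) - 2 * (b * t\<^sup>2)\<^sup>2 \<le> ln (1 - b * t\<^sup>2)"
      by (rule ln_one_minus_pos_lower_bound) (use b z in auto)
    moreover have "b * t\<^sup>2 + 2 * (b * t\<^sup>2)\<^sup>2 \<le> c * t\<^sup>2"
    proof -
      have "b * t\<^sup>2 * (1 + 2 * (b * t\<^sup>2)) \<le> b * t\<^sup>2 * (c / b)"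
        using z b by (intro mult_left_mono) auto
      then show ?thesis using b by (simp add: power2_eq_square algebra_simps)
    qed
    ultimately show "b * t\<^sup>2 < 1 \<and> - (ln (1 - b * t\<^sup>2) / 2) \<le> c * t\<^sup>2 / 2" using z by simp
  qed (use u in simp)
qed

definition near_unit :: "nat \<Rightarrow> real \<Rightarrow> (nat \<Rightarrow> real) \<Rightarrow> bool" where
  "near_unit n \<epsilon> x \<longleftrightarrow> \<bar>vec_norm n x - 1\<bar> \<le> \<epsilon>"

lemma near_unit_inner:
  assumes "near_unit n \<epsilon> x" "0 < D" "\<epsilon> \<le> D / 4" "\<epsilon> \<le> 1 / 2"
  shows "\<bar>vec_inner n x x - 1\<bar> < D"
proof -
  define r where "r = vec_norm n x"
  have r: "\<bar>r - 1\<bar> \<le> \<epsilon>" "r \<ge> 0" using assms by (auto simp: near_unit_def r_def vec_norm_def)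
  have "vec_inner n x x - 1 = (r - 1) * (r + 1)"
    unfolding vec_norm_sq[symmetric] r_def[symmetric] by (simp add: power2_eq_square algebra_simps)
  then have "\<bar>vec_inner n x x - 1\<bar> = \<bar>r - 1\<bar> * (r + 1)" using r by (simp add: abs_mult)
  also have "\<dots> \<le> \<epsilon> * (5 / 2)" using r assms by (intro mult_mono) auto
  also have "\<dots> < D" using assms by simp
  finally show ?thesis .
qed

text \<open>For negative \<beta> a change of s by less than 1 + \<beta> lowers 1 + \<beta> s by less
  than 1 + \<beta>, as |\<beta>| < 1. It follows that spikes of norm near 1 never produce the
  failure symbol.\<close>

lemma one_plus_mult_pos:
  fixes \<beta> s :: real
  assumes "\<beta> > -1" "\<bar>s - 1\<bar> < min (1 / 2) (1 + \<beta>)"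
  shows "s > 0" "1 + \<beta> * s > 0"
proof -
  have "\<bar>s - 1\<bar> < 1 / 2" using assms by simp
  then show s: "s > 0" by linarith
  show "1 + \<beta> * s > 0"
  proof (cases "\<beta> \<ge> 0")
    case True
    then show ?thesis using s by (intro add_pos_nonneg) auto
  next
    case False
    have "1 + \<beta> * s = (1 + \<beta>) + \<beta> * (s - 1)" by (simp add: algebra_simps)
    moreover have "\<bar>\<beta> * (s - 1)\<bar> \<le> 1 * \<bar>s - 1\<bar>"
      unfolding abs_mult using False assms by (intro mult_right_mono) auto
    ultimately show ?thesis using assms by (auto simp: abs_le_iff)
  qed
qed

lemma near_unit_overlap_le:
  assumes "vec_inner n x x < 1 + D" "vec_inner n y y < 1 + D" "D \<ge> 0"
  shows "overlap n (x, y) < 1 + D"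
proof -
  have "(vec_inner n x y)\<^sup>2 \<le> vec_inner n x x * vec_inner n y y"
    using Cauchy_Schwarz_ineq_sum[of x y "{..<n}"] by (simp add: vec_inner_def power2_eq_square)
  also have "\<dots> < (1 + D) * (1 + D)"
    using assms by (intro mult_strict_mono) (auto simp: vec_inner_self_nonneg)
  finally have "\<bar>vec_inner n x y\<bar>\<^sup>2 < (1 + D)\<^sup>2" by (simp add: power2_eq_square)
  then have "\<bar>vec_inner n x y\<bar> < 1 + D" by (rule power_less_imp_less_base) (use assms in simp)
  then show ?thesis by (simp add: overlap_def)
qed

text \<open>Pairs of small overlap are charged to the untruncated moment, all others to one of
  finitely many cells. Each cell eventually contributes at most exp (N h) times a tail of at most
  exp (- N h), whence the final constant |B| plus the number of cells.\<close>

lemma truncated_second_moment_bounded: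
  fixes \<beta> :: real
  assumes sp: "spike_prior \<X>" and rf: "is_rate_function \<X> f" and \<beta>: "\<beta> > -1" "\<beta> \<noteq> 0" and \<gamma>: "\<gamma>' > 0" "\<gamma> > \<gamma>'"
    and near0: "ereal (\<beta>\<^sup>2 / \<gamma>') \<le> (wigner_threshold \<X>)\<^sup>2 \<or> local_chernoff_bound \<X> f"
    and rate: "\<And>t. 0 < t \<Longrightarrow> t < 1 \<Longrightarrow> opt_exponent \<beta> t \<le> \<gamma>' * f t"
    and N: "(\<lambda>n. real n / real (N n)) \<longlonglongrightarrow> \<gamma>"
  obtains \<epsilon> \<delta> C where "\<epsilon> > 0" "\<delta> > 0" "C \<ge> 0"
    "\<And>n x. near_unit n \<epsilon> x \<Longrightarrow> \<bar>vec_inner n x x - 1\<bar> < min (1 / 2) (1 + \<beta>)"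
    "eventually (\<lambda>n. (\<integral>\<^sup>+p. (if near_unit n \<epsilon> (fst p) \<and> near_unit n \<epsilon> (snd p)
        then \<integral>\<^sup>+Y. ennreal (trunc_likelihood n (N n) \<beta> \<delta> (fst p) Y * trunc_likelihood n (N n) \<beta> \<delta> (snd p) Y)
          \<partial>gauss_columns n (N n) else 0) \<partial>(\<X> n \<Otimes>\<^sub>M \<X> n)) \<le> ennreal C) sequentially"
proof -
  obtain c \<tau>0 B where c: "\<beta>\<^sup>2 < c" and \<tau>0: "0 < \<tau>0" "\<tau>0 < 1" and
    small: "eventually (\<lambda>n. (\<integral>\<^sup>+p. ennreal (if overlap n p < \<tau>0 then exp (real (N n) * (c * (overlap n p)\<^sup>2 / 2)) else 0)
        \<partial>(\<X> n \<Otimes>\<^sub>M \<X> n)) \<le> ennreal B) sequentially"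
    using small_overlap_second_moment[OF sp rf \<beta> \<gamma> near0 rate N] by blast
  have "\<beta>\<^sup>2 > 0" using \<beta> by simp
  from neg_ln_one_minus_le[OF this c]
  obtain \<tau>1 where \<tau>1: "\<tau>1 > 0" "\<And>t. 0 \<le> t \<Longrightarrow> t < \<tau>1 \<Longrightarrow> \<beta>\<^sup>2 * t\<^sup>2 < 1 \<and> - (ln (1 - \<beta>\<^sup>2 * t\<^sup>2) / 2) \<le> c * t\<^sup>2 / 2"
    by blast
  define \<tau> where "\<tau> = min \<tau>0 \<tau>1"
  have \<tau>: "0 < \<tau>" "\<tau> < 1" "\<tau> \<le> \<tau>0" "\<tau> \<le> \<tau>1" using \<tau>0 \<tau>1 by (auto simp: \<tau>_def)
  define P where "P t d p h \<longleftrightarrow> d > 0 \<and> 0 < p \<and> p < 1 \<and> h / \<gamma> < f p \<and> (\<forall>t'. \<bar>t' - t\<bar> < d \<longrightarrow> p \<le> t') \<and>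
    (\<forall>\<delta> s r t'. \<bar>s - 1\<bar> < d \<longrightarrow> \<bar>r - 1\<bar> < d \<longrightarrow> \<bar>t' - t\<bar> < d \<longrightarrow> \<bar>\<delta>\<bar> < d \<longrightarrow>
       2 * opt_tilt \<beta> t * s < 1 \<and> tilt_det (opt_tilt \<beta> t) s r t' > 0 \<and>
       overlap_exponent \<beta> \<delta> (opt_tilt \<beta> t) s r t' < h)" for t d p h
  have "\<forall>t\<in>{\<tau>..1}. \<exists>d p h. P t d p h"
  proof
    fix t assume "t \<in> {\<tau>..1}"
    then have t: "0 < t" "t \<le> 1" using \<tau> by auto
    from large_overlap_point[OF \<beta> \<gamma> rate t] show "\<exists>d p h. P t d p h" unfolding P_def by metis
  qed
  then obtain d p h where dph: "\<And>t. t \<in> {\<tau>..1} \<Longrightarrow> P t (d t) (p t) (h t)" by metis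
  have "compact {\<tau>..1}" by (rule compact_Icc)
  then obtain I' where I': "I' \<subseteq> {\<tau>..1}" "finite I'" "{\<tau>..1} \<subseteq> (\<Union>t\<in>I'. ball t (d t))"
    by (rule compactE_image[of "{\<tau>..1}" "{\<tau>..1}" "\<lambda>t. ball t (d t)"]) (use dph in \<open>auto simp: P_def\<close>)
  \<comment> \<open>The point 1 is added by hand: overlaps between 1 and 1 + D lie outside the
    covered interval and are assigned to the cell around 1.\<close>
  define I where "I = insert 1 I'"
  have I: "I \<subseteq> {\<tau>..1}" "finite I" "1 \<in> I" using I' \<tau> by (auto simp: I_def)
  have cover: "\<exists>i\<in>I. \<bar>t - i\<bar> < d i" if "t \<in> {\<tau>..1}" for t
  proof -
    from I'(3) that obtain i where "i \<in> I'" "t \<in> ball i (d i)" by blast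
    then show ?thesis by (auto simp: I_def dist_real_def abs_minus_commute)
  qed
  have PI: "P i (d i) (p i) (h i)" if "i \<in> I" for i using dph I that by auto
  \<comment> \<open>One tolerance for all cells; the first entry also keeps s and 1 + \<beta> s
    positive.\<close>
  define D where "D = Min (insert (min (1 / 2) (1 + \<beta>)) (d ` I))"
  have D_le: "D \<le> min (1 / 2) (1 + \<beta>)" "\<And>i. i \<in> I \<Longrightarrow> D \<le> d i"
    unfolding D_def by (rule Min_le; use I in simp)+
  have D: "D > 0"
    unfolding D_def using I PI \<beta> by (subst Min_gr_iff) (auto simp: P_def)
  define \<epsilon> where "\<epsilon> = min (D / 4) (1 / 2)"
  define \<delta> where "\<delta> = D / 2"
  have near: "\<bar>vec_inner n x x - 1\<bar> < D" if "near_unit n \<epsilon> x" for n x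
    by (rule near_unit_inner[OF that D]) (auto simp: \<epsilon>_def)
  obtain b where b: "\<And>n t. n \<ge> 1 \<Longrightarrow> t \<in> {0..<1} \<Longrightarrow> ereal (b n t) \<le> overlap_rate \<X> n t"
    and ub: "uniform_limit {0..<1} b f sequentially"
    using rf unfolding is_rate_function_def by blast
  have ev: "eventually (\<lambda>n. \<forall>i\<in>I. real (N n) * h i \<le> real n * b n (p i)) sequentially"
  proof (rule eventually_ball_finite[OF I(2)], rule ballI)
    fix i assume i: "i \<in> I"
    then have lim: "(\<lambda>n. b n (p i)) \<longlonglongrightarrow> f (p i)"
      using PI[OF i] by (intro tendsto_uniform_limitI[OF ub]) (auto simp: P_def)
    show "eventually (\<lambda>n. real (N n) * h i \<le> real n * b n (p i)) sequentially"
      by (rule eventually_sample_size_less[OF N _ lim]) (use PI[OF i] \<gamma> in \<open>auto simp: P_def\<close>)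
  qed
  define K where "K n q = (\<integral>\<^sup>+Y. ennreal (trunc_likelihood n (N n) \<beta> \<delta> (fst q) Y * trunc_likelihood n (N n) \<beta> \<delta> (snd q) Y)
          \<partial>gauss_columns n (N n))" for n and q :: "(nat \<Rightarrow> real) \<times> (nat \<Rightarrow> real)"
  have K_le: "K n q \<le> ennreal (if overlap n q < \<tau>0 then exp (real (N n) * (c * (overlap n q)\<^sup>2 / 2)) else 0) +
      (\<Sum>i\<in>I. ennreal (exp (real (N n) * h i)) * indicator {q \<in> space (\<X> n \<Otimes>\<^sub>M \<X> n). overlap n q \<ge> p i} q)"
    if q: "q \<in> space (\<X> n \<Otimes>\<^sub>M \<X> n)" "near_unit n \<epsilon> (fst q)" "near_unit n \<epsilon> (snd q)" for n q
  proof -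
    define x y where "x = fst q" and "y = snd q"
    have xy: "x \<in> {..<n} \<rightarrow>\<^sub>E UNIV" "y \<in> {..<n} \<rightarrow>\<^sub>E UNIV"
      using q(1) spike_prior_space(3)[OF sp, of n] by (auto simp: x_def y_def space_pair_measure)
    define s r t where "s = vec_inner n x x" and "r = vec_inner n y y" and "t = vec_inner n x y"
    have sr: "\<bar>s - 1\<bar> < D" "\<bar>r - 1\<bar> < D" using near q by (auto simp: s_def r_def x_def y_def)
    have s0: "s > 0" "1 + \<beta> * s > 0" using one_plus_mult_pos[OF \<beta>(1), of s] sr D_le by auto
    have r0: "r > 0" "1 + \<beta> * r > 0" using one_plus_mult_pos[OF \<beta>(1), of r] sr D_le by auto
    have ov: "overlap n q = \<bar>t\<bar>" by (simp add: overlap_def t_def x_def y_def)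
    show ?thesis
    proof (cases "\<bar>t\<bar> < \<tau>")
      case True
      have lt: "\<beta>\<^sup>2 * t\<^sup>2 < 1" "- (ln (1 - \<beta>\<^sup>2 * t\<^sup>2) / 2) \<le> c * t\<^sup>2 / 2"
        using \<tau>1(2)[of "\<bar>t\<bar>"] True \<tau> by auto
      have "K n q \<le> (\<integral>\<^sup>+Y. ennreal (likelihood n (N n) \<beta> x Y * likelihood n (N n) \<beta> y Y) \<partial>gauss_columns n (N n))"
        unfolding K_def x_def[symmetric] y_def[symmetric]
        by (intro nn_integral_mono ennreal_leI mult_mono trunc_likelihood_le_likelihood trunc_likelihood_nonneg)
           (simp add: likelihood_def Let_def)
      also have "\<dots> = ennreal (exp (real (N n) * - (ln (1 - \<beta>\<^sup>2 * t\<^sup>2) / 2)))"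
        by (rule nn_integral_likelihood_pair[OF xy s_def s0(1) r_def t_def s0(2) r0(2) lt(1)])
      also have "\<dots> \<le> ennreal (exp (real (N n) * (c * t\<^sup>2 / 2)))"
        using lt(2) by (intro ennreal_leI iffD2[OF exp_le_cancel_iff] mult_left_mono) auto
      also have "\<dots> = ennreal (if overlap n q < \<tau>0 then exp (real (N n) * (c * (overlap n q)\<^sup>2 / 2)) else 0)"
        using True \<tau> by (simp add: ov)
      finally show ?thesis by (rule order_trans) simp
    next
      case False
      have "\<bar>t\<bar> < 1 + D"
        using near_unit_overlap_le[of n x D y] sr D by (auto simp: s_def r_def overlap_def t_def abs_less_iff)
      have "\<exists>i\<in>I. \<bar>\<bar>t\<bar> - i\<bar> < d i"
      proof (cases "\<bar>t\<bar> \<le> 1")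
        case True
        then show ?thesis using False by (intro cover) auto
      next
        case False
        then show ?thesis using I(3) D_le(2)[OF I(3)] \<open>\<bar>t\<bar> < 1 + D\<close> by (intro bexI[of _ 1]) auto
      qed
      then obtain i where i: "i \<in> I" "\<bar>\<bar>t\<bar> - i\<bar> < d i" by blast
      note Pi = PI[OF i(1), unfolded P_def]
      have di: "\<bar>s - 1\<bar> < d i" "\<bar>r - 1\<bar> < d i" "\<bar>\<delta>\<bar> < d i"
        using sr D_le(2)[OF i(1)] D by (auto simp: \<delta>_def)
      have pt: "p i \<le> \<bar>t\<bar>" using Pi i by blast
      have bd: "2 * opt_tilt \<beta> i * s < 1" "tilt_det (opt_tilt \<beta> i) s r \<bar>t\<bar> > 0"
        "overlap_exponent \<beta> \<delta> (opt_tilt \<beta> i) s r \<bar>t\<bar> < h i"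
        using Pi di i by blast+
      \<comment> \<open>The cells speak of |t|, the Gaussian integral of t; only the square of t
        enters either.\<close>
      have td: "tilt_det a s r \<bar>t\<bar> = tilt_det a s r t" for a by (simp add: tilt_det_def)
      then have oe: "overlap_exponent \<beta> \<delta> a s r \<bar>t\<bar> = overlap_exponent \<beta> \<delta> a s r t" for a
        by (simp add: overlap_exponent_def)
      have "K n q \<le> ennreal (exp (real (N n) * overlap_exponent \<beta> \<delta> (opt_tilt \<beta> i) s r t))"
        unfolding K_def x_def[symmetric] y_def[symmetric]
        by (rule nn_integral_trunc_likelihood_pair_le[OF xy s_def s0(1) r_def t_def bd(1) bd(2)[unfolded td]])
      also have "\<dots> \<le> ennreal (exp (real (N n) * h i))"
        using bd(3) unfolding oe by (intro ennreal_leI iffD2[OF exp_le_cancel_iff] mult_left_mono) auto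
      also have "\<dots> = ennreal (exp (real (N n) * h i)) * indicator {q \<in> space (\<X> n \<Otimes>\<^sub>M \<X> n). overlap n q \<ge> p i} q"
        using q pt by (simp add: ov)
      also have "\<dots> \<le> (\<Sum>i\<in>I. ennreal (exp (real (N n) * h i)) * indicator {q \<in> space (\<X> n \<Otimes>\<^sub>M \<X> n). overlap n q \<ge> p i} q)"
        by (rule member_le_sum[OF i(1)]) (use I in auto)
      finally show ?thesis by (rule order_trans) simp
    qed
  qed
  have "eventually (\<lambda>n. (\<integral>\<^sup>+q. (if near_unit n \<epsilon> (fst q) \<and> near_unit n \<epsilon> (snd q) then K n q else 0)
      \<partial>(\<X> n \<Otimes>\<^sub>M \<X> n)) \<le> ennreal (\<bar>B\<bar> + real (card I))) sequentially"
    using small ev eventually_ge_at_top[of 1]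
  proof eventually_elim
    case (elim n)
    have [measurable]: "overlap n \<in> borel_measurable (\<X> n \<Otimes>\<^sub>M \<X> n)" by (rule measurable_overlap[OF sp])
    let ?E = "\<lambda>i. {q \<in> space (\<X> n \<Otimes>\<^sub>M \<X> n). overlap n q \<ge> p i}"
    have "(\<integral>\<^sup>+q. (if near_unit n \<epsilon> (fst q) \<and> near_unit n \<epsilon> (snd q) then K n q else 0) \<partial>(\<X> n \<Otimes>\<^sub>M \<X> n)) \<le>
      (\<integral>\<^sup>+q. ennreal (if overlap n q < \<tau>0 then exp (real (N n) * (c * (overlap n q)\<^sup>2 / 2)) else 0) +
      (\<Sum>i\<in>I. ennreal (exp (real (N n) * h i)) * indicator (?E i) q) \<partial>(\<X> n \<Otimes>\<^sub>M \<X> n))"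
    proof (rule nn_integral_mono)
      fix q assume q: "q \<in> space (\<X> n \<Otimes>\<^sub>M \<X> n)"
      show "(if near_unit n \<epsilon> (fst q) \<and> near_unit n \<epsilon> (snd q) then K n q else 0) \<le>
        ennreal (if overlap n q < \<tau>0 then exp (real (N n) * (c * (overlap n q)\<^sup>2 / 2)) else 0) +
        (\<Sum>i\<in>I. ennreal (exp (real (N n) * h i)) * indicator (?E i) q)"
      proof (cases "near_unit n \<epsilon> (fst q) \<and> near_unit n \<epsilon> (snd q)")
        case True
        then show ?thesis unfolding if_P[OF True] by (intro K_le[OF q]) blast+
      next
        case False
        show ?thesis unfolding if_not_P[OF False] by (rule zero_le)
      qed
    qed
    also have "\<dots> = (\<integral>\<^sup>+q. ennreal (if overlap n q < \<tau>0 then exp (real (N n) * (c * (overlap n q)\<^sup>2 / 2)) else 0) \<partial>(\<X> n \<Otimes>\<^sub>M \<X> n))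
       + (\<Sum>i\<in>I. ennreal (exp (real (N n) * h i)) * emeasure (\<X> n \<Otimes>\<^sub>M \<X> n) (?E i))"
      by (simp add: nn_integral_add nn_integral_sum nn_integral_cmult_indicator)
    also have "\<dots> \<le> ennreal \<bar>B\<bar> + (\<Sum>i\<in>I. 1)"
    proof (intro add_mono sum_mono)
      show "(\<integral>\<^sup>+q. ennreal (if overlap n q < \<tau>0 then exp (real (N n) * (c * (overlap n q)\<^sup>2 / 2)) else 0) \<partial>(\<X> n \<Otimes>\<^sub>M \<X> n)) \<le> ennreal \<bar>B\<bar>"
        using elim(1) by (rule order_trans) (simp add: ennreal_leI)
      fix i assume i: "i \<in> I"
      have "overlap_tail \<X> n (p i) \<le> exp (- real n * b n (p i))"
        using PI[OF i] elim by (intro overlap_tail_le_of_rate b) (auto simp: P_def)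
      then have "exp (real (N n) * h i) * overlap_tail \<X> n (p i) \<le> exp (real (N n) * h i) * exp (- real n * b n (p i))"
        by (intro mult_left_mono) auto
      also have "\<dots> \<le> 1" using elim(2) i unfolding exp_add[symmetric] by simp
      finally show "ennreal (exp (real (N n) * h i)) * emeasure (\<X> n \<Otimes>\<^sub>M \<X> n) (?E i) \<le> 1"
        unfolding emeasure_overlap_ge[OF sp] by (simp add: ennreal_mult'[symmetric] ennreal_le_1)
    qed
    also have "\<dots> = ennreal (\<bar>B\<bar> + real (card I))" by (simp add: ennreal_of_nat_eq_real_of_nat)
    finally show ?case .
  qed
  from this[unfolded K_def] show thesis
  proof (rule that[rotated -1])
    show "\<bar>vec_inner n x x - 1\<bar> < min (1 / 2) (1 + \<beta>)" if "near_unit n \<epsilon> x" for n x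
      using near[OF that] D_le(1) by (rule less_le_trans)
  qed (use D in \<open>auto simp: \<epsilon>_def \<delta>_def\<close>)
qed

section \<open>Contiguity\<close>

definition gram :: "nat \<Rightarrow> nat \<Rightarrow> (nat \<Rightarrow> nat \<Rightarrow> real) \<Rightarrow> nat \<times> nat \<Rightarrow> real" where
  "gram n N Y = (\<lambda>(i, j)\<in>{..<n} \<times> {..<n}. 1 / real N * (\<Sum>k<N. Y k i * Y k j))"

lemma measurable_gram [measurable]: "gram n N \<in> borel_columns n N \<rightarrow>\<^sub>M borel_mat n"
proof -
  have "(\<lambda>Y. case q of (i, j) \<Rightarrow> 1 / real N * (\<Sum>k<N. Y k i * Y k j)) \<in> borel_measurable (borel_columns n N)"
    if "q \<in> {..<n} \<times> {..<n}" for q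
  proof -
    from that obtain i j where q: "q = (i, j)" "i < n" "j < n" by auto
    have "(\<lambda>Y. Y k l) \<in> borel_measurable (borel_columns n N)" if "k < N" "l < n" for k l
    proof -
      have "(\<lambda>Y. Y k) \<in> borel_columns n N \<rightarrow>\<^sub>M borel_vec n"
        using that by (intro measurable_component_singleton) auto
      then show ?thesis
        by (rule measurable_compose) (use that in \<open>auto intro!: measurable_component_singleton\<close>)
    qed
    then show ?thesis using q by (auto intro!: borel_measurable_times borel_measurable_sum)
  qed
  then show ?thesis unfolding gram_def by (intro measurable_restrict) auto
qed

section \<open>The Wishart law as an image of the column law\<close>

lemma space_option_algebra: "space (option_algebra M) = insert None (Some ` space M)"
  unfolding option_algebra_def by (rule space_measure_of) auto

lemma measurable_Some_option_algebra [measurable]: "Some \<in> M \<rightarrow>\<^sub>M option_algebra M"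
  unfolding option_algebra_def
proof (rule measurable_measure_of)
  fix A assume "A \<in> {A. A \<subseteq> insert None (Some ` space M) \<and> Some -` A \<in> sets M}"
  then show "Some -` A \<inter> space M \<in> sets M" by auto
qed auto

lemma wishart_given_eq_distr:
  "wishart_given n N \<Sigma> = distr (PiM {..<N} (\<lambda>_. gaussian_vec n \<Sigma>)) (borel_mat n) (gram n N)"
  unfolding wishart_given_def gram_def ..

lemma sets_PiM_gaussian_vec [measurable_cong]:
  "sets (PiM {..<N} (\<lambda>_. gaussian_vec n \<Sigma>)) = sets (borel_columns n N)"
  by (intro sets_PiM_cong) (auto simp: gaussian_vec_def)

lemma emeasure_wishart_given_Some:
  assumes A: "A \<in> sets (option_algebra (borel_mat n))"
  shows "emeasure (distr (wishart_given n N \<Sigma>) (option_algebra (borel_mat n)) Some) A =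
    emeasure (PiM {..<N} (\<lambda>_. gaussian_vec n \<Sigma>)) {Y \<in> space (borel_columns n N). Some (gram n N Y) \<in> A}"
proof -
  have [measurable]: "Some \<in> distr (PiM {..<N} (\<lambda>_. gaussian_vec n \<Sigma>)) (borel_mat n) (gram n N) \<rightarrow>\<^sub>M option_algebra (borel_mat n)"
    using measurable_Some_option_algebra[of "borel_mat n"] by simp
  have g: "gram n N \<in> PiM {..<N} (\<lambda>_. gaussian_vec n \<Sigma>) \<rightarrow>\<^sub>M borel_mat n" by measurable
  have "space (PiM {..<N} (\<lambda>_. gaussian_vec n \<Sigma>)) = space (borel_columns n N)"
    by (rule sets_eq_imp_space_eq) (rule sets_PiM_gaussian_vec)
  then show ?thesis
    unfolding wishart_given_eq_distr
    using A g by (subst distr_distr[OF measurable_Some_option_algebra g])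
      (auto simp: emeasure_distr measurable_comp[OF g measurable_Some_option_algebra] intro!: arg_cong2[where f=emeasure])
qed

text \<open>Realising the columns as an image of fixed standard ones moves the dependence on x from
  the measure into the map, where measurability in x can be checked. The singular case 1 + \<beta> s
  = 0 is included.\<close>

lemma PiM_gaussian_vec_spiked_cov:
  fixes \<beta> :: real
  assumes s: "s = vec_inner n x x" and \<beta>: "1 + \<beta> * s \<ge> 0" and x: "x \<in> {..<n} \<rightarrow>\<^sub>E UNIV"
  shows "PiM {..<N} (\<lambda>_. gaussian_vec n (spiked_cov \<beta> x)) =
    distr (gauss_columns n N) (borel_columns n N)
      (\<lambda>Y. \<lambda>k\<in>{..<N}. rank_one_shift n ((sqrt (1 + \<beta> * s) - 1) / s) x (Y k))"
proof -
  have [measurable]: "x \<in> space (borel_vec n)" using x by (simp add: space_PiM)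
  let ?S = "rank_one_shift n ((sqrt (1 + \<beta> * s) - 1) / s) x"
  have "PiM {..<N} (\<lambda>_. gaussian_vec n (spiked_cov \<beta> x)) = PiM {..<N} (\<lambda>_. distr (std_gauss n) (std_gauss n) ?S)"
    unfolding gaussian_vec_spiked_cov[OF s \<beta>] by (intro PiM_cong refl distr_cong sets_std_gauss[symmetric])
  also have "\<dots> = distr (gauss_columns n N) (gauss_columns n N) (compose {..<N} ?S)"
    by (rule distr_PiM_finite_prob_space'[symmetric]) (auto intro: prob_space_std_gauss)
  also have "\<dots> = distr (gauss_columns n N) (borel_columns n N) (\<lambda>Y. \<lambda>k\<in>{..<N}. ?S (Y k))"
    by (intro distr_cong refl sets_gauss_columns) (auto simp: compose_def)
  finally show ?thesis .
qed

definition wishart_kernel :: "nat \<Rightarrow> nat \<Rightarrow> real \<Rightarrow> (nat \<Rightarrow> real) \<Rightarrow> (nat \<times> nat \<Rightarrow> real) option measure" where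
  "wishart_kernel n N \<beta> x = (if \<beta> < 0 \<and> \<bar>\<beta>\<bar> * (vec_norm n x)\<^sup>2 > 1
     then return (option_algebra (borel_mat n)) None
     else distr (wishart_given n N (spiked_cov \<beta> x)) (option_algebra (borel_mat n)) Some)"

lemma wishart_eq_bind: "wishart N \<beta> \<X> n = bind (\<X> n) (wishart_kernel n (N n) \<beta>)"
  unfolding wishart_def wishart_kernel_def ..

lemma sets_wishart_kernel: "sets (wishart_kernel n N \<beta> x) = sets (option_algebra (borel_mat n))"
  by (simp add: wishart_kernel_def)

text \<open>Needed to evaluate \<open>bind\<close> as an integral over the spike. The root given by
  a choice operator is first replaced by the explicit rank-one map, which is jointly measurable in
  the spike and the columns.\<close>

lemma measurable_wishart_kernel:
  assumes sp: "spike_prior \<X>"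
  shows "wishart_kernel n N \<beta> \<in> \<X> n \<rightarrow>\<^sub>M subprob_algebra (option_algebra (borel_mat n))"
proof -
  have [measurable_cong]: "sets (\<X> n) = sets (borel_vec n)" by (rule spike_prior_space(2)[OF sp])
  let ?OA = "option_algebra (borel_mat n)"
  let ?c = "\<lambda>x. (sqrt (1 + \<beta> * vec_inner n x x) - 1) / vec_inner n x x"
  let ?W = "\<lambda>x Y. Some (gram n N (\<lambda>k\<in>{..<N}. rank_one_shift n (?c x) x (Y k)))"
  have W: "(\<lambda>p. ?W (fst p) (snd p)) \<in> \<X> n \<Otimes>\<^sub>M gauss_columns n N \<rightarrow>\<^sub>M ?OA"
    by measurable
  have "wishart_kernel n N \<beta> x =
    (if \<beta> < 0 \<and> \<bar>\<beta>\<bar> * (vec_norm n x)\<^sup>2 > 1 then return ?OA None else distr (gauss_columns n N) ?OA (?W x))"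
    if x: "x \<in> space (\<X> n)" for x
  proof (cases "\<beta> < 0 \<and> \<bar>\<beta>\<bar> * (vec_norm n x)\<^sup>2 > 1")
    case False
    have x': "x \<in> {..<n} \<rightarrow>\<^sub>E UNIV" using x spike_prior_space(3)[OF sp] by auto
    then have [measurable]: "x \<in> space (borel_vec n)" by (simp add: space_PiM)
    have "1 + \<beta> * vec_inner n x x \<ge> 0"
    proof (cases "\<beta> < 0")
      case True
      then show ?thesis using False by (simp add: vec_norm_sq)
    next
      case False
      then show ?thesis using vec_inner_self_nonneg[of n x] by simp
    qed
    from PiM_gaussian_vec_spiked_cov[OF refl this x', of N]
    have "distr (wishart_given n N (spiked_cov \<beta> x)) ?OA Some =
      distr (distr (distr (gauss_columns n N) (borel_columns n N) (\<lambda>Y. \<lambda>k\<in>{..<N}. rank_one_shift n (?c x) x (Y k)))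
        (borel_mat n) (gram n N)) ?OA Some"
      unfolding wishart_given_eq_distr by simp
    also have "\<dots> = distr (gauss_columns n N) ?OA (?W x)"
      by (subst distr_distr, measurable, subst distr_distr, measurable) (simp add: comp_def)
    finally show ?thesis unfolding wishart_kernel_def if_not_P[OF False] .
  next
    case True
    show ?thesis unfolding wishart_kernel_def if_P[OF True] ..
  qed
  moreover have "(\<lambda>x. if \<beta> < 0 \<and> \<bar>\<beta>\<bar> * (vec_norm n x)\<^sup>2 > 1 then return ?OA None else distr (gauss_columns n N) ?OA (?W x))
    \<in> \<X> n \<rightarrow>\<^sub>M subprob_algebra ?OA"
  proof (rule measurable_If)
    have "None \<in> space ?OA" by (simp add: space_option_algebra)
    then show "(\<lambda>x. return ?OA None) \<in> \<X> n \<rightarrow>\<^sub>M subprob_algebra ?OA"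
      by (intro measurable_const) (auto simp: space_subprob_algebra intro!: prob_space_imp_subprob_space prob_space_return)
    show "(\<lambda>x. distr (gauss_columns n N) ?OA (?W x)) \<in> \<X> n \<rightarrow>\<^sub>M subprob_algebra ?OA"
    proof (rule measurable_distr2[where M = "gauss_columns n N"])
      show "case_prod ?W \<in> \<X> n \<Otimes>\<^sub>M gauss_columns n N \<rightarrow>\<^sub>M ?OA" using W by (simp add: case_prod_beta')
      show "(\<lambda>x. gauss_columns n N) \<in> \<X> n \<rightarrow>\<^sub>M subprob_algebra (gauss_columns n N)"
        by (intro measurable_const) (auto simp: space_subprob_algebra intro!: prob_space_imp_subprob_space prob_space_gauss_columns)
    qed
    show "{x \<in> space (\<X> n). \<beta> < 0 \<and> \<bar>\<beta>\<bar> * (vec_norm n x)\<^sup>2 > 1} \<in> sets (\<X> n)" by measurable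
  qed
  ultimately show ?thesis by (simp cong: measurable_cong)
qed

lemma space_spike_prior_nonempty: "spike_prior \<X> \<Longrightarrow> space (\<X> n) \<noteq> {}"
  using prob_space.not_empty[OF spike_prior_space(1)] by blast

lemma sets_wishart:
  assumes "spike_prior \<X>"
  shows "sets (wishart N \<beta> \<X> n) = sets (option_algebra (borel_mat n))"
  unfolding wishart_eq_bind
  by (rule sets_bind[OF sets_wishart_kernel space_spike_prior_nonempty[OF assms]])

lemma emeasure_wishart:
  assumes "spike_prior \<X>" "A \<in> sets (option_algebra (borel_mat n))"
  shows "emeasure (wishart N \<beta> \<X> n) A = (\<integral>\<^sup>+x. emeasure (wishart_kernel n (N n) \<beta> x) A \<partial>\<X> n)"
  unfolding wishart_eq_bind
  by (rule emeasure_bind[OF space_spike_prior_nonempty[OF assms(1)] measurable_wishart_kernel[OF assms(1)] assms(2)])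

lemma PiM_gaussian_vec_spiked_cov_0:
  assumes x: "x \<in> {..<n} \<rightarrow>\<^sub>E UNIV"
  shows "PiM {..<N} (\<lambda>_. gaussian_vec n (spiked_cov 0 x)) = gauss_columns n N"
proof -
  have "gaussian_vec n (spiked_cov 0 x) = distr (std_gauss n) (borel_vec n) (rank_one_shift n 0 x)"
    using gaussian_vec_spiked_cov[OF refl, of 0 n x] by simp
  also have "\<dots> = distr (std_gauss n) (std_gauss n) (\<lambda>g. g)"
    by (intro distr_cong refl sets_std_gauss[symmetric])
       (auto simp: rank_one_shift_def space_std_gauss fun_eq_iff PiE_def extensional_def)
  also have "\<dots> = std_gauss n" by simp
  finally show ?thesis by simp
qed

lemma emeasure_unspiked_wishart:
  assumes sp: "spike_prior \<X>" and A: "A \<in> sets (option_algebra (borel_mat n))"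
  shows "emeasure (wishart N 0 \<X> n) A =
    emeasure (gauss_columns n (N n)) {Y \<in> space (borel_columns n (N n)). Some (gram n (N n) Y) \<in> A}"
proof -
  have "emeasure (wishart N 0 \<X> n) A =
    (\<integral>\<^sup>+x. emeasure (gauss_columns n (N n)) {Y \<in> space (borel_columns n (N n)). Some (gram n (N n) Y) \<in> A} \<partial>\<X> n)"
    unfolding emeasure_wishart[OF sp A]
    by (intro nn_integral_cong)
       (simp add: wishart_kernel_def emeasure_wishart_given_Some[OF A] PiM_gaussian_vec_spiked_cov_0 spike_prior_space(3)[OF sp])
  then show ?thesis using prob_space.emeasure_space_1[OF spike_prior_space(1)[OF sp]] by simp
qed

text \<open>Stands in for Cauchy--Schwarz: with the mixed likelihood ratio for z and integrated over
  an event, it gives M times the null probability plus the second moment divided by M. Either z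
  \<le> M, or z is at most its square divided by M.\<close>

lemma ennreal_le_add_square:
  fixes z :: ennreal
  assumes "M > 0"
  shows "z \<le> ennreal M + ennreal (1 / M) * (z * z)"
proof (cases "z \<le> ennreal M")
  case True
  then show ?thesis by (rule add_increasing2[rotated]) simp
next
  case False
  then have "ennreal (1 / M) * (ennreal M * z) \<le> ennreal (1 / M) * (z * z)"
    by (intro mult_left_mono mult_right_mono) auto
  moreover have "ennreal (1 / M) * (ennreal M * z) = z"
    using assms by (simp add: mult.assoc[symmetric] ennreal_mult[symmetric])
  ultimately show ?thesis by (intro add_increasing) auto
qed

text \<open>The four terms are spikes of norm away from 1 (which contain every failure), atypical
  energies, and the two parts of the square inequality. Fixing M and letting n grow removes all but
  C / M.\<close>

lemma spiked_wishart_bound: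
  fixes \<beta> :: real
  assumes sp: "spike_prior \<X>"
    and near: "\<And>x. near_unit n \<epsilon> x \<Longrightarrow> \<bar>vec_inner n x x - 1\<bar> < min (1 / 2) (1 + \<beta>)"
    and \<beta>: "\<beta> > -1"
    and A: "A \<in> sets (option_algebra (borel_mat n))"
    and \<theta>: "\<theta> > 0" "\<theta> * (2 * (1 + 2 * \<bar>\<beta>\<bar>)) \<le> 1 / 4" "8 * \<theta> * (2 * (1 + 2 * \<bar>\<beta>\<bar>))\<^sup>2 \<le> \<delta>"
    and M: "M > 0"
    and K: "(\<integral>\<^sup>+p. (if near_unit n \<epsilon> (fst p) \<and> near_unit n \<epsilon> (snd p)
        then \<integral>\<^sup>+Y. ennreal (trunc_likelihood n (N n) \<beta> \<delta> (fst p) Y * trunc_likelihood n (N n) \<beta> \<delta> (snd p) Y)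
          \<partial>gauss_columns n (N n) else 0) \<partial>(\<X> n \<Otimes>\<^sub>M \<X> n)) \<le> ennreal C" and C: "C \<ge> 0"
  shows "measure (wishart N \<beta> \<X> n) A \<le>
    measure (\<X> n) {x \<in> space (\<X> n). \<bar>vec_norm n x - 1\<bar> > \<epsilon>} + 2 * exp (- (real (N n) * (\<theta> * \<delta> / 2)))
    + M * measure (wishart N 0 \<X> n) A + C / M"
proof -
  have [measurable_cong]: "sets (\<X> n) = sets (borel_vec n)" by (rule spike_prior_space(2)[OF sp])
  interpret X: prob_space "\<X> n" by (rule spike_prior_space(1)[OF sp])
  interpret G: prob_space "gauss_columns n (N n)" by (rule prob_space_gauss_columns)
  interpret XG: pair_sigma_finite "\<X> n" "gauss_columns n (N n)" ..
  interpret XX: prob_space "\<X> n \<Otimes>\<^sub>M \<X> n" by (rule prob_space_spike_pair[OF sp])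
  interpret XXG: pair_sigma_finite "\<X> n \<Otimes>\<^sub>M \<X> n" "gauss_columns n (N n)" ..
  \<comment> \<open>The event pulled back to the columns. A possible failure symbol in
    \<open>A\<close> is lost here; it has probability 0 under the unspiked law and is paid for by
    \<open>bad\<close> under the spiked one.\<close>
  define B where "B = {Y \<in> space (borel_columns n (N n)). Some (gram n (N n) Y) \<in> A}"
  have B [measurable]: "B \<in> sets (borel_columns n (N n))"
    using measurable_sets[OF measurable_comp[OF measurable_gram measurable_Some_option_algebra] A]
    by (simp add: B_def vimage_def Int_def conj_commute)
  have [measurable]: "Measurable.pred (\<X> n) (near_unit n \<epsilon>)" unfolding near_unit_def by measurable
  define u where "u x Y = (if near_unit n \<epsilon> x then ennreal (trunc_likelihood n (N n) \<beta> \<delta> x Y) else 0)" for x Y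
  have u_meas [measurable]: "(\<lambda>p. u (fst p) (snd p)) \<in> borel_measurable (\<X> n \<Otimes>\<^sub>M gauss_columns n (N n))"
    unfolding u_def by measurable
  define Z where "Z Y = (\<integral>\<^sup>+x. u x Y \<partial>\<X> n)" for Y
  have Z_meas [measurable]: "Z \<in> borel_measurable (gauss_columns n (N n))"
    unfolding Z_def u_def by (intro X.borel_measurable_nn_integral) measurable
  define \<eta> where "\<eta> = 2 * exp (- (real (N n) * (\<theta> * \<delta> / 2)))"
  define bad where "bad = {x \<in> space (\<X> n). \<bar>vec_norm n x - 1\<bar> > \<epsilon>}"
  have bad [measurable]: "bad \<in> sets (\<X> n)" unfolding bad_def by measurable
  have kernel: "emeasure (wishart_kernel n (N n) \<beta> x) A \<le>
      indicator bad x + ennreal \<eta> + (\<integral>\<^sup>+Y. u x Y * indicator B Y \<partial>gauss_columns n (N n))"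
    if x: "x \<in> space (\<X> n)" for x
  proof (cases "near_unit n \<epsilon> x")
    case False
    have "wishart_kernel n (N n) \<beta> x \<in> space (subprob_algebra (option_algebra (borel_mat n)))"
      by (rule measurable_space[OF measurable_wishart_kernel[OF sp] x])
    then have "emeasure (wishart_kernel n (N n) \<beta> x) A \<le> 1"
      by (intro subprob_space.subprob_emeasure_le_1) (simp add: space_subprob_algebra)
    also have "\<dots> = indicator bad x" using False x by (simp add: bad_def near_unit_def)
    also have "\<dots> \<le> indicator bad x + (ennreal \<eta> + (\<integral>\<^sup>+Y. u x Y * indicator B Y \<partial>gauss_columns n (N n)))"
      by (rule add_increasing2) auto
    finally show ?thesis by (simp add: add.assoc)
  next
    case True
    have x': "x \<in> {..<n} \<rightarrow>\<^sub>E UNIV" using x spike_prior_space(3)[OF sp] by auto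
    then have [measurable]: "x \<in> space (borel_vec n)" by (simp add: space_PiM)
    define s where "s = vec_inner n x x"
    have s1: "\<bar>s - 1\<bar> < min (1 / 2) (1 + \<beta>)" using near[OF True] by (simp add: s_def)
    note s = one_plus_mult_pos[OF \<beta> s1]
    have "\<bar>s - 1\<bar> < 1 / 2" using s1 by simp
    then have s2: "s \<le> 2" by linarith
    \<comment> \<open>The crude bound s \<le> 2 is the source of the constant 2 (1 + 2 |\<beta>|)
      bounding the variance v.\<close>
    have "\<beta> * s \<le> \<bar>\<beta>\<bar> * 2" using s s2 by (intro mult_mono) auto
    then have v: "s * (1 + \<beta> * s) \<le> 2 * (1 + 2 * \<bar>\<beta>\<bar>)"
      using s s2 by (intro mult_mono) auto
    have nofail: "\<not> (\<beta> < 0 \<and> \<bar>\<beta>\<bar> * (vec_norm n x)\<^sup>2 > 1)"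
      using s(2) by (auto simp: vec_norm_sq s_def)
    have "emeasure (wishart_kernel n (N n) \<beta> x) A = emeasure (PiM {..<N n} (\<lambda>_. gaussian_vec n (spiked_cov \<beta> x))) B"
      unfolding wishart_kernel_def if_not_P[OF nofail] B_def by (rule emeasure_wishart_given_Some[OF A])
    also have "\<dots> = (\<integral>\<^sup>+Y. ennreal (likelihood n (N n) \<beta> x Y) * indicator B Y \<partial>gauss_columns n (N n))"
      by (rule emeasure_spiked_columns[OF x' s_def s B])
    also have "\<dots> \<le> (\<integral>\<^sup>+Y. ennreal (if typical n (N n) \<beta> \<delta> x Y then 0 else likelihood n (N n) \<beta> x Y)
        + u x Y * indicator B Y \<partial>gauss_columns n (N n))"
      using True by (intro nn_integral_mono) (auto simp: u_def trunc_likelihood_def indicator_def)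
    also have "\<dots> = (\<integral>\<^sup>+Y. ennreal (if typical n (N n) \<beta> \<delta> x Y then 0 else likelihood n (N n) \<beta> x Y) \<partial>gauss_columns n (N n))
        + (\<integral>\<^sup>+Y. u x Y * indicator B Y \<partial>gauss_columns n (N n))"
      unfolding u_def by (intro nn_integral_add) measurable
    also have "\<dots> \<le> ennreal \<eta> + (\<integral>\<^sup>+Y. u x Y * indicator B Y \<partial>gauss_columns n (N n))"
      unfolding \<eta>_def by (intro add_mono order_refl nn_integral_likelihood_atypical[OF x' s_def s v \<theta>])
    also have "\<dots> \<le> indicator bad x + (ennreal \<eta> + (\<integral>\<^sup>+Y. u x Y * indicator B Y \<partial>gauss_columns n (N n)))"
      by (rule add_increasing) auto
    finally show ?thesis by (simp add: add.assoc)
  qed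
  have ZZ: "(\<integral>\<^sup>+Y. Z Y * Z Y \<partial>gauss_columns n (N n)) \<le> ennreal C"
  proof -
    \<comment> \<open>The square of an average over the spike is an average over two independent
      spikes; exchanging the integrals leaves the second moment of each pair.\<close>
    have "(\<integral>\<^sup>+Y. Z Y * Z Y \<partial>gauss_columns n (N n)) =
      (\<integral>\<^sup>+Y. \<integral>\<^sup>+p. u (fst p) Y * u (snd p) Y \<partial>(\<X> n \<Otimes>\<^sub>M \<X> n) \<partial>gauss_columns n (N n))"
    proof (rule nn_integral_cong)
      fix Y assume Y: "Y \<in> space (gauss_columns n (N n))"
      have [measurable]: "(\<lambda>x. u x Y) \<in> borel_measurable (\<X> n)"
        using measurable_compose[OF measurable_Pair2'[OF Y] u_meas] by simp
      have "(\<integral>\<^sup>+p. u (fst p) Y * u (snd p) Y \<partial>(\<X> n \<Otimes>\<^sub>M \<X> n)) = (\<integral>\<^sup>+x. \<integral>\<^sup>+y. u x Y * u y Y \<partial>\<X> n \<partial>\<X> n)"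
        by (subst X.nn_integral_fst[symmetric]) auto
      also have "\<dots> = Z Y * Z Y" unfolding Z_def by (simp add: nn_integral_cmult nn_integral_multc)
      finally show "Z Y * Z Y = (\<integral>\<^sup>+p. u (fst p) Y * u (snd p) Y \<partial>(\<X> n \<Otimes>\<^sub>M \<X> n))" by simp
    qed
    also have "\<dots> = (\<integral>\<^sup>+p. \<integral>\<^sup>+Y. u (fst p) Y * u (snd p) Y \<partial>gauss_columns n (N n) \<partial>(\<X> n \<Otimes>\<^sub>M \<X> n))"
      unfolding u_def by (intro XXG.Fubini') measurable
    also have "\<dots> = (\<integral>\<^sup>+p. (if near_unit n \<epsilon> (fst p) \<and> near_unit n \<epsilon> (snd p)
        then \<integral>\<^sup>+Y. ennreal (trunc_likelihood n (N n) \<beta> \<delta> (fst p) Y * trunc_likelihood n (N n) \<beta> \<delta> (snd p) Y)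
          \<partial>gauss_columns n (N n) else 0) \<partial>(\<X> n \<Otimes>\<^sub>M \<X> n))"
      by (intro nn_integral_cong) (auto simp: u_def ennreal_mult trunc_likelihood_nonneg)
    also have "\<dots> \<le> ennreal C" by (rule K)
    finally show ?thesis .
  qed
  have ZB: "(\<integral>\<^sup>+Y. Z Y * indicator B Y \<partial>gauss_columns n (N n)) \<le>
      ennreal M * emeasure (gauss_columns n (N n)) B + ennreal (C / M)"
  proof -
    have "(\<integral>\<^sup>+Y. Z Y * indicator B Y \<partial>gauss_columns n (N n)) \<le>
      (\<integral>\<^sup>+Y. ennreal M * indicator B Y + ennreal (1 / M) * (Z Y * Z Y) \<partial>gauss_columns n (N n))"
      using ennreal_le_add_square[OF M] by (intro nn_integral_mono) (auto simp: indicator_def)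
    also have "\<dots> = ennreal M * emeasure (gauss_columns n (N n)) B + ennreal (1 / M) * (\<integral>\<^sup>+Y. Z Y * Z Y \<partial>gauss_columns n (N n))"
      by (simp add: nn_integral_add nn_integral_cmult nn_integral_cmult_indicator)
    also have "\<dots> \<le> ennreal M * emeasure (gauss_columns n (N n)) B + ennreal (1 / M) * ennreal C"
      by (intro add_mono order_refl mult_left_mono ZZ) auto
    also have "ennreal (1 / M) * ennreal C = ennreal (C / M)"
      using M C by (simp add: ennreal_mult[symmetric])
    finally show ?thesis .
  qed
  have "emeasure (wishart N \<beta> \<X> n) A = (\<integral>\<^sup>+x. emeasure (wishart_kernel n (N n) \<beta> x) A \<partial>\<X> n)"
    by (rule emeasure_wishart[OF sp A])
  also have "\<dots> \<le> (\<integral>\<^sup>+x. indicator bad x + ennreal \<eta> + (\<integral>\<^sup>+Y. u x Y * indicator B Y \<partial>gauss_columns n (N n)) \<partial>\<X> n)"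
    by (intro nn_integral_mono kernel)
  also have "\<dots> = emeasure (\<X> n) bad + ennreal \<eta> + (\<integral>\<^sup>+x. \<integral>\<^sup>+Y. u x Y * indicator B Y \<partial>gauss_columns n (N n) \<partial>\<X> n)"
    by (subst nn_integral_add, measurable, subst nn_integral_add) (auto simp: X.emeasure_space_1)
  also have "(\<integral>\<^sup>+x. \<integral>\<^sup>+Y. u x Y * indicator B Y \<partial>gauss_columns n (N n) \<partial>\<X> n) =
      (\<integral>\<^sup>+Y. \<integral>\<^sup>+x. u x Y * indicator B Y \<partial>\<X> n \<partial>gauss_columns n (N n))"
    unfolding u_def by (intro XG.Fubini'[symmetric]) measurable
  also have "\<dots> = (\<integral>\<^sup>+Y. Z Y * indicator B Y \<partial>gauss_columns n (N n))"
    unfolding Z_def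
  proof (intro nn_integral_cong nn_integral_multc)
    fix Y assume Y: "Y \<in> space (gauss_columns n (N n))"
    show "(\<lambda>x. u x Y) \<in> borel_measurable (\<X> n)"
      using measurable_compose[OF measurable_Pair2'[OF Y] u_meas] by simp
  qed
  also have "emeasure (\<X> n) bad + ennreal \<eta> + (\<integral>\<^sup>+Y. Z Y * indicator B Y \<partial>gauss_columns n (N n)) \<le>
      emeasure (\<X> n) bad + ennreal \<eta> + (ennreal M * emeasure (gauss_columns n (N n)) B + ennreal (C / M))"
    by (intro add_mono order_refl ZB)
  also have "\<dots> = ennreal (measure (\<X> n) bad + \<eta> + M * measure (gauss_columns n (N n)) B + C / M)"
  proof -
    have "\<eta> \<ge> 0" "C / M \<ge> 0" "M \<ge> 0" using M C by (auto simp: \<eta>_def)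
    then show ?thesis
      by (simp add: X.emeasure_eq_measure G.emeasure_eq_measure ennreal_mult[symmetric] ennreal_plus[symmetric] add_ac del: ennreal_plus)
  qed
  finally have "emeasure (wishart N \<beta> \<X> n) A \<le>
    ennreal (measure (\<X> n) bad + \<eta> + M * measure (gauss_columns n (N n)) B + C / M)" .
  then have "measure (wishart N \<beta> \<X> n) A \<le> measure (\<X> n) bad + \<eta> + M * measure (gauss_columns n (N n)) B + C / M"
    unfolding measure_def[of "wishart N \<beta> \<X> n"] using M C
    by (intro enn2real_leI) (auto simp: \<eta>_def)
  moreover have "measure (wishart N 0 \<X> n) A = measure (gauss_columns n (N n)) B"
    unfolding measure_def emeasure_unspiked_wishart[OF sp A] B_def ..
  ultimately show ?thesis by (simp add: bad_def \<eta>_def)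
qed

theorem theorem5p7:
  fixes \<X> :: "nat \<Rightarrow> (nat \<Rightarrow> real) measure"
    and f :: "real \<Rightarrow> real"
    and \<beta> \<gamma>' :: real
  assumes "spike_prior \<X>"
    and "is_rate_function \<X> f"
    and "\<beta> > -1"
    and "\<gamma>' > 0"
    and "ereal (\<beta>\<^sup>2 / \<gamma>') \<le> (wigner_threshold \<X>)\<^sup>2 \<or> local_chernoff_bound \<X> f"
    and "\<forall>t\<in>{0<..<1}.
           (let A = (1 - t\<^sup>2) / (2 * t * (\<beta> + 1)); w = sqrt (A\<^sup>2 + 1) - A in
              \<gamma>' * f t \<ge> (1 + \<beta>) * (t * (w - t) / (1 - t\<^sup>2)) + 1 / 2 * ln ((1 - w\<^sup>2) / (1 - t\<^sup>2)))"
  shows "\<forall>\<gamma>>\<gamma>'. \<forall>N :: nat \<Rightarrow> nat.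
           (\<lambda>n. real n / real (N n)) \<longlonglongrightarrow> \<gamma> \<longrightarrow> contiguous (wishart N \<beta> \<X>) (wishart N 0 \<X>)"
proof (intro allI impI)
  fix \<gamma> :: real and N :: "nat \<Rightarrow> nat"
  assume \<gamma>: "\<gamma> > \<gamma>'" and N: "(\<lambda>n. real n / real (N n)) \<longlonglongrightarrow> \<gamma>"
  note sp = assms(1) and \<beta> = assms(3)
  show "contiguous (wishart N \<beta> \<X>) (wishart N 0 \<X>)"
  proof (cases "\<beta> = 0")
    case True
    \<comment> \<open>For \<beta> = 0 both sequences coincide; positivity of the exponent, on which
      the other case rests, would fail.\<close>
    then show ?thesis by (simp add: contiguous_def)
  next
    case False
    have rate: "opt_exponent \<beta> t \<le> \<gamma>' * f t" if "0 < t" "t < 1" for t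
      using assms(6) that unfolding opt_exponent_eq[OF \<beta> that] opt_corr_def Let_def by simp
    obtain \<epsilon> \<delta> C where \<epsilon>: "\<epsilon> > 0" and \<delta>: "\<delta> > 0" and C: "C \<ge> 0"
      and near: "\<And>n x. near_unit n \<epsilon> x \<Longrightarrow> \<bar>vec_inner n x x - 1\<bar> < min (1 / 2) (1 + \<beta>)"
      and K: "eventually (\<lambda>n. (\<integral>\<^sup>+p. (if near_unit n \<epsilon> (fst p) \<and> near_unit n \<epsilon> (snd p)
        then \<integral>\<^sup>+Y. ennreal (trunc_likelihood n (N n) \<beta> \<delta> (fst p) Y * trunc_likelihood n (N n) \<beta> \<delta> (snd p) Y)
          \<partial>gauss_columns n (N n) else 0) \<partial>(\<X> n \<Otimes>\<^sub>M \<X> n)) \<le> ennreal C) sequentially"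
      using truncated_second_moment_bounded[OF sp assms(2) \<beta> False assms(4) \<gamma> assms(5) rate N] by blast
    define V where "V = 2 * (1 + 2 * \<bar>\<beta>\<bar>)"
    have V: "V > 0" unfolding V_def by simp
    \<comment> \<open>The largest \<theta> meeting both constraints of the Chernoff bound for the
      energy.\<close>
    define \<theta> where "\<theta> = min (1 / (4 * V)) (\<delta> / (8 * V\<^sup>2))"
    have "\<theta> \<le> 1 / (4 * V)" "\<theta> \<le> \<delta> / (8 * V\<^sup>2)" by (auto simp: \<theta>_def)
    then have "\<theta> * V \<le> 1 / 4" "8 * \<theta> * V\<^sup>2 \<le> \<delta>"
      using V by (simp_all add: field_simps)
    moreover have "\<theta> > 0" using V \<delta> by (simp add: \<theta>_def)
    ultimately have \<theta>: "\<theta> > 0" "\<theta> * V \<le> 1 / 4" "8 * \<theta> * V\<^sup>2 \<le> \<delta>" by auto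
    have N_top: "filterlim (\<lambda>n. real (N n)) at_top sequentially"
      using filterlim_compose[OF filterlim_real_sequentially sample_size_ratio(2)[OF N]] \<gamma> assms(4) by simp
    have \<eta>: "(\<lambda>n. 2 * exp (- (real (N n) * (\<theta> * \<delta> / 2)))) \<longlonglongrightarrow> 2 * 0"
    proof (intro tendsto_mult tendsto_const filterlim_compose[OF exp_at_bot])
      have "filterlim (\<lambda>n. real (N n) * (\<theta> * \<delta> / 2)) at_top sequentially"
        by (rule filterlim_at_top_mult_tendsto_pos[OF tendsto_const _ N_top]) (use \<theta> \<delta> in simp)
      then show "filterlim (\<lambda>n. - (real (N n) * (\<theta> * \<delta> / 2))) at_bot sequentially"
        by (simp add: filterlim_uminus_at_bot)
    qed
    have bad: "(\<lambda>n. measure (\<X> n) {x \<in> space (\<X> n). \<bar>vec_norm n x - 1\<bar> > \<epsilon>}) \<longlonglongrightarrow> 0"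
      using sp \<epsilon> by (simp add: spike_prior_def)
    show ?thesis
      unfolding contiguous_def
    proof (intro conjI allI impI)
      show "sets (wishart N \<beta> \<X> n) = sets (wishart N 0 \<X> n)" for n by (simp add: sets_wishart[OF sp])
      fix A assume A: "\<forall>n. A n \<in> sets (wishart N 0 \<X> n)"
        and P: "(\<lambda>n. measure (wishart N 0 \<X> n) (A n)) \<longlonglongrightarrow> 0"
      have A': "A n \<in> sets (option_algebra (borel_mat n))" for n using A by (simp add: sets_wishart[OF sp])
      show "(\<lambda>n. measure (wishart N \<beta> \<X> n) (A n)) \<longlonglongrightarrow> 0"
      proof (rule order_tendstoI)
        fix e :: real assume "e < 0"
        then show "eventually (\<lambda>n. e < measure (wishart N \<beta> \<X> n) (A n)) sequentially"
          by (intro always_eventually allI less_le_trans[OF _ measure_nonneg])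
      next
        fix e :: real assume e: "0 < e"
        \<comment> \<open>Then C / M is below e / 2; adding 1 to C keeps M positive when C =
          0.\<close>
        define M where "M = 2 * (C + 1) / e"
        have M0: "M > 0" using e C by (simp add: M_def)
        have "e * M = 2 * (C + 1)" using e by (simp add: M_def)
        then have "C / M < e" using M0 C by (simp add: pos_divide_less_eq)
        note M = M0 this
        define g where "g n = measure (\<X> n) {x \<in> space (\<X> n). \<bar>vec_norm n x - 1\<bar> > \<epsilon>}
          + 2 * exp (- (real (N n) * (\<theta> * \<delta> / 2))) + M * measure (wishart N 0 \<X> n) (A n) + C / M" for n
        have "g \<longlonglongrightarrow> 0 + 2 * 0 + M * 0 + C / M"
          unfolding g_def by (intro tendsto_intros bad \<eta> P)
        then have "eventually (\<lambda>n. g n < e) sequentially"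
          by (rule order_tendstoD(2)) (use M in simp)
        with K show "eventually (\<lambda>n. measure (wishart N \<beta> \<X> n) (A n) < e) sequentially"
        proof eventually_elim
          case (elim n)
          have "measure (wishart N \<beta> \<X> n) (A n) \<le> g n"
            unfolding g_def
            by (rule spiked_wishart_bound[where N = N and n = n, OF sp near \<beta> A' \<theta>[unfolded V_def] M(1) elim(1) C])
          then show ?case using elim(2) by simp
        qed
      qed
    qed
  qed
qed

end
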